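(* There exist absolute constants $c, C>0$ such that for all integers $n$ and $k\geq 2$, the minimum number $T(n,k)$ of adaptive queries needed to solve white-peg Mastermind with $n$ positions and $k$ colors satisfies $$c\left(n\frac{\log k}{\log n}+\frac{k}{n}\right)\leq T(n,k)\leq C\left(n\frac{\log k}{\log n}+\frac{k}{n}\right),$$ i.e. $T(n,k)=\Theta\left(n\frac{\log k}{\log n}+k/n\right)$.
   Context: White-peg Mastermind with $n$ positions and $k$ colors: Codemaker chooses a hidden codeword $x\in[k]^n$. Codebreaker adaptively asks queries $q\in[k]^n$ (each query may depend on all previous answers) and after each query is told both the number of black pegs $bp(x,q)=|\{i\in[n]: x_i=q_i\}|$ and the number of white pegs $wp(x,q)=\max_{\sigma}|\{i\in[n]: x_i=q_{\sigma(i)}\}|-bp(x,q)$, where $\sigma$ ranges over all permutations of $[n]$. The game is solved once the answers received determine $x$ uniquely. The minimum number of adaptive queries needed is the least $T$ such that Codebreaker has an adaptive strategy that determines every possible codeword within $T$ queries. *)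

theory Defs
  imports Complex_Main "HOL-Library.FuncSet" "HOL-Combinatorics.Permutations"
begin

type_synonym word = "nat \<Rightarrow> nat"

text \<open>Words in \<open>[k]\<^sup>n\<close>, with \<open>[m] = {1..m}\<close>; being extensional, they are determined by their
  values on \<open>{1..n}\<close>.\<close>

definition words :: "nat \<Rightarrow> nat \<Rightarrow> word set" where
  "words n k = {1..n} \<rightarrow>\<^sub>E {1..k}"

definition bp :: "nat \<Rightarrow> word \<Rightarrow> word \<Rightarrow> nat" where
  "bp n x q = card {i \<in> {1..n}. x i = q i}"

text \<open>The subtraction never truncates: \<open>\<sigma> = id\<close> attains \<open>bp n x q\<close>.\<close>

definition wp :: "nat \<Rightarrow> word \<Rightarrow> word \<Rightarrow> nat" where
  "wp n x q =
     Max {card {i \<in> {1..n}. x i = q (\<sigma> i)} | \<sigma>. \<sigma> permutes {1..n}} - bp n x q"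

definition answer :: "nat \<Rightarrow> word \<Rightarrow> word \<Rightarrow> nat \<times> nat" where
  "answer n x q = (bp n x q, wp n x q)"

text \<open>A history lists the queries asked so far, in order, each with the answer received. An
  adaptive strategy maps the history to the next query.\<close>

type_synonym history = "(word \<times> (nat \<times> nat)) list"
type_synonym strategy = "history \<Rightarrow> word"

definition strategies :: "nat \<Rightarrow> nat \<Rightarrow> strategy set" where
  "strategies n k = {s. \<forall>h. s h \<in> words n k}"

primrec play :: "nat \<Rightarrow> strategy \<Rightarrow> word \<Rightarrow> nat \<Rightarrow> history" where
  "play n s x 0 = []"
| "play n s x (Suc t) =
     (let h = play n s x t; q = s h in h @ [(q, answer n x q)])"

definition consistent :: "nat \<Rightarrow> nat \<Rightarrow> history \<Rightarrow> word set" where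
  "consistent n k h = {y \<in> words n k. \<forall>(q, a) \<in> set h. answer n y q = a}"

definition solves_within :: "nat \<Rightarrow> nat \<Rightarrow> strategy \<Rightarrow> nat \<Rightarrow> bool" where
  "solves_within n k s T \<longleftrightarrow>
     (\<forall>x \<in> words n k. \<exists>t \<le> T. consistent n k (play n s x t) = {x})"

definition min_queries :: "nat \<Rightarrow> nat \<Rightarrow> nat" where
  "min_queries n k = (LEAST T. \<exists>s \<in> strategies n k. solves_within n k s T)"

text \<open>The set under the \<open>LEAST\<close> is nonempty, since Codebreaker may query every word in turn.\<close>

lemma length_play [simp]: "length (play n s x t) = t"
  by (induction t) (simp_all add: Let_def)

lemma set_play:
  "set (play n s x t) = (\<lambda>i. (s (play n s x i), answer n x (s (play n s x i)))) ` {..<t}"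
  by (induction t) (auto simp: Let_def lessThan_Suc)

lemma bp_eq_n_imp_eq:
  assumes "x \<in> words n k" "y \<in> words n k" "bp n y x = n"
  shows "y = x"
proof -
  have "{i \<in> {1..n}. y i = x i} = {1..n}"
    using assms(3) by (intro card_subset_eq) (auto simp: bp_def)
  then have "\<And>i. i \<in> {1..n} \<Longrightarrow> y i = x i" by blast
  then show ?thesis
    using assms(1,2) unfolding words_def by (intro PiE_ext) auto
qed

lemma solvable:
  assumes "k \<ge> 1"
  shows "\<exists>T. \<exists>s \<in> strategies n k. solves_within n k s T"
proof -
  have "finite (words n k)"
    by (simp add: words_def finite_PiE)
  then obtain ws where ws: "set ws = words n k"
    using finite_list by blast
  have "words n k \<noteq> {}"
    using assms by (simp add: words_def PiE_eq_empty_iff)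
  then have pos: "length ws > 0" using ws by auto
  define s :: strategy where "s h = ws ! (length h mod length ws)" for h
  have "s \<in> strategies n k"
    using pos by (simp add: strategies_def s_def flip: ws)
  moreover have "solves_within n k s (length ws)"
    unfolding solves_within_def
  proof
    fix x assume x: "x \<in> words n k"
    then obtain i where i: "i < length ws" "ws ! i = x"
      using ws by (metis in_set_conv_nth)
    have asked: "(x, answer n x x) \<in> set (play n s x (length ws))"
      using i unfolding set_play by (intro image_eqI[of _ _ i]) (simp_all add: s_def)
    have "y = x" if y: "y \<in> consistent n k (play n s x (length ws))" for y
    proof (rule bp_eq_n_imp_eq[OF x])
      show "y \<in> words n k" using y by (simp add: consistent_def)
      have "answer n y x = answer n x x"
        using y bspec[OF _ asked, of "\<lambda>(q, a). answer n y q = a"]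
        by (simp add: consistent_def)
      then have "bp n y x = bp n x x" by (simp add: answer_def)
      then show "bp n y x = n" by (simp add: bp_def Collect_mem_eq del: atLeastAtMost_iff)
    qed
    moreover have "x \<in> consistent n k (play n s x (length ws))"
      using x by (auto simp: consistent_def set_play)
    ultimately have "consistent n k (play n s x (length ws)) = {x}" by blast
    then show "\<exists>t \<le> length ws. consistent n k (play n s x t) = {x}"
      by blast
  qed
  ultimately show ?thesis by blast
qed

end

theory Submission
  imports Defs "HOL-Library.Disjoint_Sets"
begin

text \<open>
  Lower bound: there are at most \<open>(n + 1)\<^sup>2\<close> answers, and two constant words whose colours were
  never queried are indistinguishable.

  Upper bound: if the number of occurrences of every colour on a set of positions is known, then
  splitting the set and counting each colour on the parts is a binary search for all colours at
  once, but with one count per query it costs a factor \<open>log n\<close> too much. Following Cantor and Mills,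
  two strategies \<open>f\<close>, \<open>g\<close> on disjoint sets of positions are therefore run together by asking
  \<open>f - g + h\<close> and \<open>f + g\<close>: the parity of the sum of the two answers yields for free a bit \<open>h\<close> from a
  third set of positions. Nesting this, some answers are known in advance modulo a high power of
  two, so that larger counts can be piggybacked as well; a count with range \<open>a\<close> costs \<open>O(a)\<close> queries,
  and the ranges on \<open>m\<close> positions sum to \<open>O(m)\<close>. All levels of the search are kept busy by
  a pipeline: a job of size \<open>4\<^sup>j\<close> is split into quarters, which two pipelines of the next lower level
  process two by two while the next job is being split. Their time units being four times shorter
  and their queries interleaved, the latency of a pipeline is a constant number of units on every
  level, and \<open>n\<close> positions are solved by \<open>O(n)\<close> queries.

  If \<open>k\<^sup>2 \<le> n\<close>, this strategy is run in parallel on \<open>n / k\<close> groups of \<open>k\<close> positions, saving a factor of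
  order \<open>log n / log k\<close>. If \<open>k > n\<close>, the total number of pegs reveals how many of \<open>n\<close> given colours
  occur in the secret. After \<open>k / n\<close> queries to blocks of \<open>n\<close> colours, finding the occurring colours is
  the same search, with the at most \<open>n\<close> nonempty blocks as positions.
\<close>

section \<open>Adaptive strategies of signed queries\<close>

text \<open>A real query puts a colour on every position, whereas the search wants partial queries
  with signs. Colour 1 serves as filler: the difference of two real queries reads
  \<open>[x i = c] - [x i = 1]\<close> on chosen positions with chosen signs. The places of colour 1
  are therefore found beforehand, by \<open>O(n / log n)\<close> queries, and every signed query
  costs two real ones. For \<open>k > n\<close>, the filler adds to the total of pegs an amount that
  depends only on the number of 1s in the secret.

  The linear bound rests on a packing argument: level \<open>j\<close> of the pipeline has
  \<open>2 ^ (2 * j + 5) - 1\<close> queries per time unit, a constant multiple of its job size, and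
  their capacities follow the ruler sequence, in which capacity \<open>s\<close> makes up a fraction
  of about \<open>2 ^ -(s + 1)\<close>. A count with range below \<open>2 ^ s\<close> fits one query
  of capacity \<open>s\<close>, so ranges with total \<open>R\<close> fit into \<open>O(R)\<close>
  queries.

  If \<open>k \<le> n < k * k\<close>, then \<open>log k / log n\<close> lies between 1/2 and 1, so
  \<open>O(n)\<close> queries are good enough without running groups in parallel.\<close>

definition det :: "('x \<Rightarrow> 'a) \<Rightarrow> 'x set \<Rightarrow> bool" where
  "det f X \<longleftrightarrow> (\<forall>x\<in>X. \<forall>y\<in>X. f x = f y)"

text \<open>Sets of secrets are states of knowledge, which only ever shrink. A goal that survives
  shrinking may be reached early or alongside others, and the remaining queries may be spent on
  anything.\<close>

definition hereditary :: "('x set \<Rightarrow> bool) \<Rightarrow> bool" where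
  "hereditary \<Phi> \<longleftrightarrow> (\<forall>X Y. Y \<subseteq> X \<longrightarrow> \<Phi> X \<longrightarrow> \<Phi> Y)"

lemma hereditaryI: "(\<And>X Y. Y \<subseteq> X \<Longrightarrow> \<Phi> X \<Longrightarrow> \<Phi> Y) \<Longrightarrow> hereditary \<Phi>"
  by (simp add: hereditary_def)

lemma hereditaryD: "hereditary \<Phi> \<Longrightarrow> \<Phi> X \<Longrightarrow> Y \<subseteq> X \<Longrightarrow> \<Phi> Y"
  by (simp add: hereditary_def)

lemma det_subset: "det f X \<Longrightarrow> Y \<subseteq> X \<Longrightarrow> det f Y"
  by (auto simp: det_def)

lemma hereditary_det: "hereditary (det f)"
  by (auto intro: hereditaryI det_subset)

lemma hereditary_conj:
  "hereditary \<Phi> \<Longrightarrow> hereditary \<Psi> \<Longrightarrow> hereditary (\<lambda>Y. \<Phi> Y \<and> \<Psi> Y)"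
  by (auto simp: hereditary_def)

lemma hereditary_ball: "(\<And>i. i \<in> I \<Longrightarrow> hereditary (\<Phi> i)) \<Longrightarrow> hereditary (\<lambda>Y. \<forall>i\<in>I. \<Phi> i Y)"
  by (auto simp: hereditary_def)

lemma hereditary_all_less:
  "(\<And>i::nat. i < m \<Longrightarrow> hereditary (\<Phi> i)) \<Longrightarrow> hereditary (\<lambda>Y. \<forall>i<m. \<Phi> i Y)"
  by (auto simp: hereditary_def)

lemma hereditary_const: "hereditary (\<lambda>Y. P)"
  by (auto simp: hereditary_def)

text \<open>An inclusion-maximal \<open>I1\<close> of weight below \<open>K\<close> cannot take one
  more element \<open>z\<close>, so everything outside \<open>insert z I1\<close> weighs less than
  \<open>K\<close>. The element \<open>z\<close> is left over because it may be heavy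
  itself.\<close>

lemma split_weights:
  fixes r :: "'i \<Rightarrow> nat"
  assumes "finite I" "sum r I < 2 * K"
  obtains I1 I2 Z where "I = I1 \<union> I2 \<union> Z" "I1 \<inter> I2 = {}" "I1 \<inter> Z = {}" "I2 \<inter> Z = {}"
    "sum r I1 < K" "sum r I2 < K" "Z = {} \<or> (\<exists>z. Z = {z})"
proof -
  have "K > 0" using assms by simp
  define F where "F = {J. J \<subseteq> I \<and> sum r J < K}"
  have "finite F" unfolding F_def using assms(1) by simp
  moreover have "{} \<in> F" using \<open>K > 0\<close> by (simp add: F_def)
  ultimately obtain J where J: "J \<in> F" "\<forall>J'\<in>F. J \<subseteq> J' \<longrightarrow> J = J'"
    using finite_has_maximal[of F] by (metis empty_iff)
  have fJ: "finite J" "J \<subseteq> I" "sum r J < K"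
    using J assms(1) by (auto simp: F_def intro: finite_subset)
  show ?thesis
  proof (cases "J = I")
    case True
    then show ?thesis using fJ \<open>K > 0\<close> by (intro that[of I "{}" "{}"]) auto
  next
    case False
    then obtain z where z: "z \<in> I" "z \<notin> J" using fJ by blast
    have "insert z J \<notin> F" using J(2) z(2) by blast
    then have "sum r (insert z J) \<ge> K" using fJ z by (auto simp: F_def)
    moreover have "sum r I = sum r (insert z J) + sum r (I - insert z J)"
      using assms(1) fJ z
      by (metis add.commute insert_subset sum.subset_diff)
    ultimately have "sum r (I - insert z J) < K" using assms(2) by linarith
    then show ?thesis using fJ z
      by (intro that[of J "I - insert z J" "{z}"]) auto
  qed
qed

text \<open>\<open>e p c x\<close> is what asking colour \<open>c\<close> at position
  \<open>p\<close> contributes for the secret \<open>x\<close>. It stays abstract because it stands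
  for black pegs (\<open>black\<close>), for black pegs relative to a filler
  (\<open>relative_black\<close>) and for blocks of colours acting as positions
  (\<open>white\<close>).\<close>

locale atoms =
  fixes e :: "'p \<Rightarrow> 'c \<Rightarrow> 'x \<Rightarrow> int" and U :: "'c set"
begin

text \<open>A position carries at most one colour and one sign, as in a real query;
  \<open>add_query\<close> therefore asks for disjoint supports.\<close>

definition queries :: "'p set \<Rightarrow> ('x \<Rightarrow> int) set" where
  "queries A = {f. \<exists>F s q. finite F \<and> F \<subseteq> A \<and> (\<forall>p\<in>F. s p = 1 \<or> s p = -1) \<and> q ` F \<subseteq> U \<and>
     f = (\<lambda>x. \<Sum>p\<in>F. s p * e p (q p) x)}"

lemma queriesI:
  assumes "finite F" "F \<subseteq> A" "\<And>p. p \<in> F \<Longrightarrow> s p = 1 \<or> s p = -1" "\<And>p. p \<in> F \<Longrightarrow> q p \<in> U"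
    "\<And>x. f x = (\<Sum>p\<in>F. s p * e p (q p) x)"
  shows "f \<in> queries A"
proof -
  have "q ` F \<subseteq> U" using assms(4) by blast
  moreover have "f = (\<lambda>x. \<Sum>p\<in>F. s p * e p (q p) x)" using assms(5) by (rule ext)
  ultimately show ?thesis
    unfolding queries_def mem_Collect_eq using assms(1-3)
    by (intro exI[of _ F] exI[of _ s] exI[of _ q] conjI ballI) simp_all
qed

lemma queriesE:
  assumes "f \<in> queries A"
  obtains F s q where "finite F" "F \<subseteq> A" "\<forall>p\<in>F. s p = 1 \<or> s p = -1"
    "\<forall>p\<in>F. q p \<in> U" "\<forall>x. f x = (\<Sum>p\<in>F. s p * e p (q p) x)"
proof -
  from assms obtain F s q where *: "finite F \<and> F \<subseteq> A \<and> (\<forall>p\<in>F. s p = 1 \<or> s p = -1) \<and> q ` F \<subseteq> U \<and>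
     f = (\<lambda>x. \<Sum>p\<in>F. s p * e p (q p) x)"
    unfolding queries_def mem_Collect_eq by (elim exE)
  have "\<forall>p\<in>F. q p \<in> U" using * by (simp add: image_subset_iff)
  moreover have "\<forall>x. f x = (\<Sum>p\<in>F. s p * e p (q p) x)" using * by simp
  ultimately show thesis using * by (intro that[of F s q]) simp_all
qed

lemma zero_query: "(\<lambda>_. 0) \<in> queries A"
  by (rule queriesI[of "{}"]) simp_all

lemma queries_mono: "A \<subseteq> B \<Longrightarrow> queries A \<subseteq> queries B"
  unfolding queries_def by (intro Collect_mono impI) (elim exE conjE, intro exI conjI, assumption, simp_all)

lemma uminus_query:
  assumes "f \<in> queries A"
  shows "(\<lambda>x. - f x) \<in> queries A"
proof -
  obtain F s q where *: "finite F" "F \<subseteq> A" "\<forall>p\<in>F. s p = 1 \<or> s p = -1"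
    "\<forall>p\<in>F. q p \<in> U" "\<forall>x. f x = (\<Sum>p\<in>F. s p * e p (q p) x)"
    by (rule queriesE[OF assms]) (rule that, assumption+)
  show ?thesis
  proof (rule queriesI[where F = F and s = "\<lambda>p. - s p" and q = q])
    show "- s p = 1 \<or> - s p = - 1" if "p \<in> F" for p
      using bspec[OF *(3) that] by (elim disjE) simp_all
    show "- f x = (\<Sum>p\<in>F. - s p * e p (q p) x)" for x
      using *(5) by (simp add: sum_negf)
  qed (use *(1,2,4) in simp_all)
qed

lemma add_query:
  assumes "f \<in> queries A" "g \<in> queries B" "A \<inter> B = {}"
  shows "(\<lambda>x. f x + g x) \<in> queries (A \<union> B)"
proof -
  obtain F s q where f: "finite F" "F \<subseteq> A" "\<forall>p\<in>F. s p = 1 \<or> s p = -1"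
    "\<forall>p\<in>F. q p \<in> U" "\<forall>x. f x = (\<Sum>p\<in>F. s p * e p (q p) x)"
    by (rule queriesE[OF assms(1)]) (rule that, assumption+)
  obtain G t r where g: "finite G" "G \<subseteq> B" "\<forall>p\<in>G. t p = 1 \<or> t p = -1"
    "\<forall>p\<in>G. r p \<in> U" "\<forall>x. g x = (\<Sum>p\<in>G. t p * e p (r p) x)"
    by (rule queriesE[OF assms(2)]) (rule that, assumption+)
  have FG: "F \<inter> G = {}" using f(2) g(2) assms(3) by blast
  define s' where "s' p = (if p \<in> F then s p else t p)" for p
  define q' where "q' p = (if p \<in> F then q p else r p)" for p
  show ?thesis
  proof (rule queriesI[where F = "F \<union> G" and s = s' and q = q'])
    fix x
    have "(\<Sum>p\<in>F \<union> G. s' p * e p (q' p) x)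
        = (\<Sum>p\<in>F. s' p * e p (q' p) x) + (\<Sum>p\<in>G. s' p * e p (q' p) x)"
      by (rule sum.union_disjoint[OF f(1) g(1) FG])
    also have "(\<Sum>p\<in>F. s' p * e p (q' p) x) = f x"
      unfolding f(5)[rule_format] by (rule sum.cong) (simp_all add: s'_def q'_def)
    also have "(\<Sum>p\<in>G. s' p * e p (q' p) x) = g x"
      unfolding g(5)[rule_format] using FG by (intro sum.cong) (auto simp: s'_def q'_def)
    finally show "f x + g x = (\<Sum>p\<in>F \<union> G. s' p * e p (q' p) x)" by (rule sym)
  next
    show "s' p = 1 \<or> s' p = -1" if "p \<in> F \<union> G" for p
      using that f(3) g(3) unfolding s'_def by (cases "p \<in> F") simp_all
    show "q' p \<in> U" if "p \<in> F \<union> G" for p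
      using that f(4) g(4) unfolding q'_def by (cases "p \<in> F") simp_all
    show "finite (F \<union> G)" using f(1) g(1) by simp
    show "F \<union> G \<subseteq> A \<union> B" using f(2) g(2) by blast
  qed
qed

lemma diff_query:
  assumes "f \<in> queries A" "g \<in> queries B" "A \<inter> B = {}"
  shows "(\<lambda>x. f x - g x) \<in> queries (A \<union> B)"
  using add_query[OF assms(1) uminus_query[OF assms(2)] assms(3)] by simp

lemma atom_sum_query:
  assumes "finite S" "c \<in> U"
  shows "(\<lambda>x. \<Sum>p\<in>S. e p c x) \<in> queries S"
  by (rule queriesI[where F = S and s = "\<lambda>_. 1" and q = "\<lambda>_. c"]) (simp_all add: assms)

text \<open>\<open>run C cs A X \<Phi>\<close>: knowing that the secret lies in \<open>X\<close>, an adaptive sequence of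
  \<open>length cs\<close> signed queries supported in \<open>A\<close> can narrow it down to a set satisfying \<open>\<Phi>\<close>. The
  relation \<open>C s\<close> restricts the differences of possible answers to a query of capacity \<open>s\<close>.\<close>

fun run :: "(nat \<Rightarrow> int \<Rightarrow> bool) \<Rightarrow> nat list \<Rightarrow> 'p set \<Rightarrow> 'x set \<Rightarrow> ('x set \<Rightarrow> bool) \<Rightarrow> bool" where
  "run C [] A X \<Phi> = \<Phi> X"
| "run C (s # cs) A X \<Phi> = (\<exists>f\<in>queries A. (\<forall>x\<in>X. \<forall>y\<in>X. C s (f x - f y)) \<and>
     (\<forall>a. run C cs A {x\<in>X. f x = a} \<Phi>))"

lemma runI:
  assumes "f \<in> queries A" "\<And>x y. x \<in> X \<Longrightarrow> y \<in> X \<Longrightarrow> C s (f x - f y)"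
    "\<And>a. run C cs A {x\<in>X. f x = a} \<Phi>"
  shows "run C (s # cs) A X \<Phi>"
  unfolding run.simps using assms by (intro bexI[of _ f] conjI ballI allI)

lemma runE:
  assumes "run C (s # cs) A X \<Phi>"
  obtains f where "f \<in> queries A" "\<And>x y. x \<in> X \<Longrightarrow> y \<in> X \<Longrightarrow> C s (f x - f y)"
    "\<And>a. run C cs A {x\<in>X. f x = a} \<Phi>"
proof -
  from assms obtain f where "f \<in> queries A" and
    "(\<forall>x\<in>X. \<forall>y\<in>X. C s (f x - f y)) \<and> (\<forall>a. run C cs A {x\<in>X. f x = a} \<Phi>)"
    unfolding run.simps by (elim bexE)
  then show thesis by (intro that[of f]) simp_all
qed

declare run.simps(2) [simp del]

lemma run_mono:
  assumes "hereditary \<Phi>" "run C cs A X \<Phi>" "Y \<subseteq> X"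
  shows "run C cs A Y \<Phi>"
  using assms(2,3)
proof (induction cs arbitrary: X Y)
  case Nil
  then show ?case using hereditaryD[OF assms(1), of X Y] by simp
next
  case (Cons s cs)
  from Cons.prems(1) show ?case
  proof (rule runE)
    fix f assume f: "f \<in> queries A" "\<And>x y. x \<in> X \<Longrightarrow> y \<in> X \<Longrightarrow> C s (f x - f y)"
      "\<And>a. run C cs A {x\<in>X. f x = a} \<Phi>"
    show ?thesis
    proof (rule runI[OF f(1)])
      show "run C cs A {x\<in>Y. f x = a} \<Phi>" for a
        by (rule Cons.IH[OF f(3)[of a]]) (use Cons.prems(2) in blast)
    qed (use f(2) Cons.prems(2) in blast)
  qed
qed

lemma run_support:
  assumes "run C cs A X \<Phi>" "A \<subseteq> B"
  shows "run C cs B X \<Phi>"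
  using assms(1)
proof (induction cs arbitrary: X)
  case (Cons s cs)
  from Cons.prems show ?case
  proof (rule runE)
    fix f assume f: "f \<in> queries A" "\<And>x y. x \<in> X \<Longrightarrow> y \<in> X \<Longrightarrow> C s (f x - f y)"
      "\<And>a. run C cs A {x\<in>X. f x = a} \<Phi>"
    have "f \<in> queries B" using f(1) queries_mono[OF assms(2)] by (rule rev_subsetD)
    then show ?thesis
      by (rule runI) (rule f(2), assumption+, rule Cons.IH, rule f(3))
  qed
qed simp

lemma run_imp:
  assumes "run C cs A X \<Phi>" "\<And>Y. Y \<subseteq> X \<Longrightarrow> \<Phi> Y \<Longrightarrow> \<Psi> Y"
  shows "run C cs A X \<Psi>"
  using assms
proof (induction cs arbitrary: X)
  case (Cons s cs)
  from Cons.prems(1) show ?case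
  proof (rule runE)
    fix f assume f: "f \<in> queries A" "\<And>x y. x \<in> X \<Longrightarrow> y \<in> X \<Longrightarrow> C s (f x - f y)"
      "\<And>a. run C cs A {x\<in>X. f x = a} \<Phi>"
    show ?thesis
    proof (rule runI[OF f(1)])
      show "run C cs A {x\<in>X. f x = a} \<Psi>" for a
        by (rule Cons.IH[OF f(3)]) (rule Cons.prems(2), auto)
    qed (rule f(2))
  qed
qed simp

lemma run_append:
  "run C cs A X (\<lambda>Y. run C ds A Y \<Phi>) \<Longrightarrow> run C (cs @ ds) A X \<Phi>"
proof (induction cs arbitrary: X)
  case (Cons s cs)
  from Cons.prems show ?case
    unfolding append_Cons
  proof (rule runE)
    fix f assume f: "f \<in> queries A" "\<And>x y. x \<in> X \<Longrightarrow> y \<in> X \<Longrightarrow> C s (f x - f y)"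
      "\<And>a. run C cs A {x\<in>X. f x = a} (\<lambda>Y. run C ds A Y \<Phi>)"
    show "run C (s # (cs @ ds)) A X \<Phi>"
      by (rule runI[OF f(1)]) (rule f(2), assumption+, rule Cons.IH, rule f(3))
  qed
qed simp

lemma run_seq:
  assumes "run C cs A X \<Phi>" "\<And>Y. Y \<subseteq> X \<Longrightarrow> \<Phi> Y \<Longrightarrow> run C ds A Y \<Psi>"
  shows "run C (cs @ ds) A X \<Psi>"
  by (rule run_append, rule run_imp[OF assms(1)], rule assms(2))

lemma run_skip:
  assumes "hereditary \<Phi>" "\<And>s. C s 0" "run C cs A X \<Phi>"
  shows "run C (s # cs) A X \<Phi>"
proof (rule runI[OF zero_query])
  show "run C cs A {x\<in>X. 0 = a} \<Phi>" for a
    by (rule run_mono[OF assms(1,3)]) blast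
qed (use assms(2) in simp)

lemma run_idle:
  assumes "hereditary \<Phi>" "\<And>s. C s 0" "\<Phi> X"
  shows "run C cs A X \<Phi>"
proof (induction cs)
  case (Cons s cs)
  show ?case by (rule run_skip[where \<Phi> = \<Phi>]) (use assms(1,2) Cons in blast)+
qed (simp add: assms(3))

lemma run_pad:
  assumes "hereditary \<Phi>" "\<And>s. C s 0" "run C cs A X \<Phi>"
  shows "run C (cs @ ds) A X \<Phi>"
  by (rule run_seq[OF assms(3)], rule run_idle[where \<Phi> = \<Phi>]) (simp_all add: assms(1,2))

text \<open>The two strategies run one after the other, so their supports may overlap. Heredity of
  \<open>\<Psi>\<close> lets the second start from the smaller set left by the first, and heredity
  of \<open>\<Phi>\<close> preserves the first goal meanwhile.\<close>

lemma run_conj: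
  assumes "run C cs A X \<Phi>" "run C ds B X \<Psi>" "hereditary \<Phi>" "hereditary \<Psi>"
  shows "run C (cs @ ds) (A \<union> B) X (\<lambda>Y. \<Phi> Y \<and> \<Psi> Y)"
proof (rule run_seq[where \<Phi> = \<Phi>])
  show "run C cs (A \<union> B) X \<Phi>" by (rule run_support[OF assms(1)]) auto
next
  fix Y assume Y: "Y \<subseteq> X" "\<Phi> Y"
  have "run C ds (A \<union> B) Y \<Psi>"
    by (rule run_mono[OF assms(4) run_support[OF assms(2)] Y(1)]) auto
  then show "run C ds (A \<union> B) Y (\<lambda>Y. \<Phi> Y \<and> \<Psi> Y)"
    by (rule run_imp) (intro conjI hereditaryD[OF assms(3) Y(2)], simp_all)
qed

lemma run_weaken:
  assumes "list_all2 (\<lambda>s s'. \<forall>f\<in>queries A. \<forall>x y. C s (f x - f y) \<longrightarrow> C' s' (f x - f y)) cs cs'"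
    "run C cs A X \<Phi>"
  shows "run C' cs' A X \<Phi>"
  using assms
proof (induction cs arbitrary: cs' X)
  case Nil
  then show ?case by simp
next
  case (Cons s cs)
  from Cons.prems(1) obtain s' ds where cs': "cs' = s' # ds"
    "\<forall>f\<in>queries A. \<forall>x y. C s (f x - f y) \<longrightarrow> C' s' (f x - f y)"
    "list_all2 (\<lambda>s s'. \<forall>f\<in>queries A. \<forall>x y. C s (f x - f y) \<longrightarrow> C' s' (f x - f y)) cs ds"
    unfolding list_all2_Cons1 by blast
  from Cons.prems(2) show ?case
  proof (rule runE)
    fix f assume f: "f \<in> queries A" "\<And>x y. x \<in> X \<Longrightarrow> y \<in> X \<Longrightarrow> C s (f x - f y)"
      "\<And>a. run C cs A {x\<in>X. f x = a} \<Phi>"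
    show ?thesis unfolding cs'(1)
    proof (rule runI[OF f(1)])
      show "run C' ds A {x\<in>X. f x = a} \<Phi>" for a
        by (rule Cons.IH[OF cs'(3) f(3)])
    qed (use f(1,2) cs'(2) in blast)
  qed
qed

end

section \<open>Running two strategies together\<close>

text \<open>Hosts and guests: the answer to a host of capacity \<open>s\<close> is known modulo
  \<open>2 ^ s\<close> in advance, and the possible answers to a guest of capacity \<open>s\<close>
  differ by less than \<open>2 ^ s\<close>. The sum of a host and a guest thus reveals both.\<close>

definition dvd_cap :: "nat \<Rightarrow> int \<Rightarrow> bool" where "dvd_cap s d \<longleftrightarrow> 2 ^ s dvd d"

definition small_cap :: "nat \<Rightarrow> int \<Rightarrow> bool" where "small_cap s d \<longleftrightarrow> \<bar>d\<bar> < 2 ^ s"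

lemma dvd_cap_zero [simp]: "dvd_cap s 0"
  by (simp add: dvd_cap_def)

lemma small_cap_zero [simp]: "small_cap s 0"
  by (simp add: small_cap_def)

lemma dvd_small_eq_0: "dvd_cap s d \<Longrightarrow> small_cap s d \<Longrightarrow> d = 0"
  unfolding dvd_cap_def small_cap_def using zdvd_not_zless[of "\<bar>d\<bar>" "2 ^ s"] by fastforce

text \<open>If the answers to \<open>f\<close> and \<open>g\<close> are known modulo \<open>2\<^sup>s\<close>, then \<open>f - g + h\<close> reveals \<open>h\<close>, which
  ranges over fewer than \<open>2\<^sup>s\<close> values, and hence \<open>f - g\<close>; afterwards \<open>f + g = (f - g) + 2 g\<close>
  is known modulo \<open>2\<^sup>s\<^sup>+\<^sup>1\<close>.\<close>

fun weave :: "nat list \<Rightarrow> nat list" where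
  "weave [] = []"
| "weave (s # cs) = 0 # Suc s # weave cs"

text \<open>The same pairing without a third query \<open>h\<close> keeps the capacity of the first row.\<close>

fun double :: "nat list \<Rightarrow> nat list" where
  "double [] = []"
| "double (s # cs) = s # Suc s # double cs"

text \<open>The ruler sequence: entry \<open>i\<close>, counted from 1, is the exponent of 2 in
  \<open>i\<close>. A capacity \<open>s < n\<close> thus occurs \<open>2 ^ (n - 1 - s)\<close> times
  in \<open>ruler n\<close>.\<close>

primrec ruler :: "nat \<Rightarrow> nat list" where
  "ruler 0 = []"
| "ruler (Suc n) = ruler n @ n # ruler n"

lemma length_ruler: "length (ruler n) = 2 ^ n - 1"
  by (induction n) (auto simp: mult_2)

lemma weave_append: "weave (cs @ ds) = weave cs @ weave ds"
  by (induction cs rule: weave.induct) auto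

text \<open>Odd indices have exponent 0, and doubling an index raises its exponent by one; this is
  what \<open>weave\<close> does. The final 0 belongs to the index
  \<open>2 ^ (n + 1) - 1\<close>.\<close>

lemma weave_ruler: "weave (ruler n) @ [0] = ruler (Suc n)"
proof (induction n)
  case (Suc n)
  have "weave (ruler (Suc n)) @ [0] = (weave (ruler n) @ [0]) @ Suc n # (weave (ruler n) @ [0])"
    by (simp add: weave_append)
  also have "\<dots> = ruler (Suc n) @ Suc n # ruler (Suc n)"
    by (simp only: Suc)
  finally show ?case by simp
qed simp

lemma det_const: "det f {x\<in>X. f x = a}"
  by (simp add: det_def)

context atoms
begin

lemma run_weave:
  assumes "run dvd_cap cs A X \<Phi>" "run dvd_cap cs B X \<Psi>" "run small_cap cs D X \<Theta>"
    and disj: "A \<inter> B = {}" "A \<inter> D = {}" "B \<inter> D = {}"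
    and her: "hereditary \<Phi>" "hereditary \<Psi>" "hereditary \<Theta>"
  shows "run dvd_cap (weave cs) (A \<union> B \<union> D) X (\<lambda>Y. \<Phi> Y \<and> \<Psi> Y \<and> \<Theta> Y)"
  using assms(1-3)
proof (induction cs arbitrary: X)
  case (Cons s cs)
  from Cons.prems(1) show ?case
  proof (rule runE)
    fix f assume f: "f \<in> queries A" "\<And>x y. x \<in> X \<Longrightarrow> y \<in> X \<Longrightarrow> dvd_cap s (f x - f y)"
      "\<And>a. run dvd_cap cs A {x\<in>X. f x = a} \<Phi>"
    from Cons.prems(2) show ?thesis
    proof (rule runE)
      fix g assume g: "g \<in> queries B" "\<And>x y. x \<in> X \<Longrightarrow> y \<in> X \<Longrightarrow> dvd_cap s (g x - g y)"
        "\<And>a. run dvd_cap cs B {x\<in>X. g x = a} \<Psi>"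
      from Cons.prems(3) show ?thesis
      proof (rule runE)
        fix h assume h: "h \<in> queries D" "\<And>x y. x \<in> X \<Longrightarrow> y \<in> X \<Longrightarrow> small_cap s (h x - h y)"
          "\<And>a. run small_cap cs D {x\<in>X. h x = a} \<Theta>"
        let ?d = "\<lambda>x. (f x - g x) + h x" and ?s = "\<lambda>x. f x + g x"
        have "(\<lambda>x. f x - g x) \<in> queries (A \<union> B)" by (rule diff_query[OF f(1) g(1) disj(1)])
        then have dq: "?d \<in> queries (A \<union> B \<union> D)"
          by (rule add_query[OF _ h(1)]) (use disj in blast)
        have sq: "?s \<in> queries (A \<union> B \<union> D)"
          by (rule subsetD[OF queries_mono add_query[OF f(1) g(1) disj(1)]]) simp
        have h_eq: "h x = h y" if "x \<in> X" "y \<in> X" "?d x = ?d y" for x y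
        proof -
          have "h x - h y = - (f x - f y) + (g x - g y)" using that(3) by simp
          moreover have "2 ^ s dvd - (f x - f y) + (g x - g y)"
            by (rule dvd_add, subst dvd_minus_iff)
              (use f(2)[OF that(1,2)] g(2)[OF that(1,2)] in \<open>simp_all add: dvd_cap_def\<close>)
          ultimately have "dvd_cap s (h x - h y)" by (simp add: dvd_cap_def)
          from dvd_small_eq_0[OF this h(2)[OF that(1,2)]] show ?thesis by simp
        qed
        show ?thesis unfolding weave.simps
        proof (rule runI[OF dq])
          show "dvd_cap 0 (?d x - ?d y)" for x y by (simp add: dvd_cap_def)
        next
          fix a
          let ?X = "{x\<in>X. ?d x = a}"
          show "run dvd_cap (Suc s # weave cs) (A \<union> B \<union> D) ?X (\<lambda>Y. \<Phi> Y \<and> \<Psi> Y \<and> \<Theta> Y)"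
          proof (rule runI[OF sq])
            fix x y assume xy: "x \<in> ?X" "y \<in> ?X"
            then have "h x = h y" using h_eq[of x y] by simp
            then have eq: "?s x - ?s y = 2 * (g x - g y)" using xy by simp
            have "2 ^ s dvd g x - g y" using g(2)[of x y] xy by (simp add: dvd_cap_def)
            then show "dvd_cap (Suc s) (?s x - ?s y)" unfolding eq dvd_cap_def power_Suc by (rule mult_dvd_mono[OF dvd_refl])
          next
            fix b
            let ?Y = "{x\<in>?X. ?s x = b}"
            show "run dvd_cap (weave cs) (A \<union> B \<union> D) ?Y (\<lambda>Y. \<Phi> Y \<and> \<Psi> Y \<and> \<Theta> Y)"
            proof (cases "?Y = {}")
              case False
              then obtain z where z: "z \<in> ?Y" by blast
              have eq: "h x = h z \<and> f x = f z \<and> g x = g z" if "x \<in> ?Y" for x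
              proof -
                have "h x = h z" using h_eq[of x z] that z by simp
                then show ?thesis using that z by simp
              qed
              show ?thesis
              proof (rule Cons.IH)
                show "run dvd_cap cs A ?Y \<Phi>"
                  by (rule run_mono[OF her(1) f(3)[of "f z"]]) (use eq in blast)
                show "run dvd_cap cs B ?Y \<Psi>"
                  by (rule run_mono[OF her(2) g(3)[of "g z"]]) (use eq in blast)
                show "run small_cap cs D ?Y \<Theta>"
                  by (rule run_mono[OF her(3) h(3)[of "h z"]]) (use eq in blast)
              qed
            next
              \<comment> \<open>No secret gives this pair of answers, so there is no
                \<open>z\<close> to select the branches; the branches of answer 0 serve, restricted
                to the empty set.\<close>
              case True
              show ?thesis unfolding True
              proof (rule Cons.IH)
                show "run dvd_cap cs A {} \<Phi>"
                  by (rule run_mono[OF her(1) f(3)[of 0]]) blast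
                show "run dvd_cap cs B {} \<Psi>"
                  by (rule run_mono[OF her(2) g(3)[of 0]]) blast
                show "run small_cap cs D {} \<Theta>"
                  by (rule run_mono[OF her(3) h(3)[of 0]]) blast
              qed
            qed
          qed
        qed
      qed
    qed
  qed
qed simp

lemma run_ruler_weave:
  assumes "run dvd_cap (ruler n) A X \<Phi>" "run dvd_cap (ruler n) B X \<Psi>" "run small_cap (ruler n) D X \<Theta>"
    and disj: "A \<inter> B = {}" "A \<inter> D = {}" "B \<inter> D = {}"
    and her: "hereditary \<Phi>" "hereditary \<Psi>" "hereditary \<Theta>"
  shows "run dvd_cap (ruler (Suc n)) (A \<union> B \<union> D) X (\<lambda>Y. \<Phi> Y \<and> \<Psi> Y \<and> \<Theta> Y)"
  unfolding weave_ruler[symmetric]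
  by (rule run_pad[OF _ _ run_weave[OF assms]]) (intro hereditary_conj her, simp)

lemma run_double:
  assumes "run dvd_cap cs A X \<Phi>" "run dvd_cap cs B X \<Psi>" "A \<inter> B = {}"
    and her: "hereditary \<Phi>" "hereditary \<Psi>"
  shows "run dvd_cap (double cs) (A \<union> B) X (\<lambda>Y. \<Phi> Y \<and> \<Psi> Y)"
  using assms(1,2)
proof (induction cs arbitrary: X)
  case (Cons s cs)
  from Cons.prems(1) show ?case
  proof (rule runE)
    fix f assume f: "f \<in> queries A" "\<And>x y. x \<in> X \<Longrightarrow> y \<in> X \<Longrightarrow> dvd_cap s (f x - f y)"
      "\<And>a. run dvd_cap cs A {x\<in>X. f x = a} \<Phi>"
    from Cons.prems(2) show ?thesis
    proof (rule runE)
      fix g assume g: "g \<in> queries B" "\<And>x y. x \<in> X \<Longrightarrow> y \<in> X \<Longrightarrow> dvd_cap s (g x - g y)"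
        "\<And>a. run dvd_cap cs B {x\<in>X. g x = a} \<Psi>"
      let ?d = "\<lambda>x. f x - g x" and ?s = "\<lambda>x. f x + g x"
      have dq: "?d \<in> queries (A \<union> B)" by (rule diff_query[OF f(1) g(1) assms(3)])
      have sq: "?s \<in> queries (A \<union> B)" by (rule add_query[OF f(1) g(1) assms(3)])
      show ?thesis unfolding double.simps
      proof (rule runI[OF dq])
        fix x y assume xy: "x \<in> X" "y \<in> X"
        have eq: "?d x - ?d y = (f x - f y) - (g x - g y)" by simp
        show "dvd_cap s (?d x - ?d y)"
          unfolding eq dvd_cap_def
          by (rule dvd_diff[OF f(2)[OF xy, unfolded dvd_cap_def] g(2)[OF xy, unfolded dvd_cap_def]])
      next
        fix a
        let ?X = "{x\<in>X. ?d x = a}"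
        show "run dvd_cap (Suc s # double cs) (A \<union> B) ?X (\<lambda>Y. \<Phi> Y \<and> \<Psi> Y)"
        proof (rule runI[OF sq])
          fix x y assume xy: "x \<in> ?X" "y \<in> ?X"
          then have eq: "?s x - ?s y = 2 * (g x - g y)" by simp
          have "2 ^ s dvd g x - g y" using g(2)[of x y] xy by (simp add: dvd_cap_def)
          then show "dvd_cap (Suc s) (?s x - ?s y)" unfolding eq dvd_cap_def power_Suc by (rule mult_dvd_mono[OF dvd_refl])
        next
          fix b
          let ?Y = "{x\<in>?X. ?s x = b}"
          have eq: "2 * f x = a + b \<and> 2 * g x = b - a" if "x \<in> ?Y" for x
            using that by auto
          \<comment> \<open>Difference and sum yield \<open>f x\<close> and \<open>g x\<close>
            explicitly, which also covers an empty \<open>?Y\<close>.\<close>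
          have eq': "f x = (a + b) div 2 \<and> g x = (b - a) div 2" if "x \<in> ?Y" for x
            using eq[OF that] by auto
          show "run dvd_cap (double cs) (A \<union> B) ?Y (\<lambda>Y. \<Phi> Y \<and> \<Psi> Y)"
          proof (rule Cons.IH)
            show "run dvd_cap cs A ?Y \<Phi>"
              by (rule run_mono[OF her(1) f(3)[of "(a + b) div 2"]]) (use eq' in blast)
            show "run dvd_cap cs B ?Y \<Psi>"
              by (rule run_mono[OF her(2) g(3)[of "(b - a) div 2"]]) (use eq' in blast)
          qed
        qed
      qed
    qed
  qed
qed simp

text \<open>The guest \<open>h\<close> is read off modulo \<open>2 ^ s\<close>, and \<open>f\<close>
  follows by subtraction. This uses up the capacity: nothing remains known in advance about the
  sums, whence the zeros.\<close>

lemma run_piggyback: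
  assumes "run dvd_cap cs A X \<Phi>" "run small_cap cs D X \<Theta>" "A \<inter> D = {}"
    and her: "hereditary \<Phi>" "hereditary \<Theta>"
  shows "run dvd_cap (replicate (length cs) 0) (A \<union> D) X (\<lambda>Y. \<Phi> Y \<and> \<Theta> Y)"
  using assms(1,2)
proof (induction cs arbitrary: X)
  case (Cons s cs)
  from Cons.prems(1) show ?case
  proof (rule runE)
    fix f assume f: "f \<in> queries A" "\<And>x y. x \<in> X \<Longrightarrow> y \<in> X \<Longrightarrow> dvd_cap s (f x - f y)"
      "\<And>a. run dvd_cap cs A {x\<in>X. f x = a} \<Phi>"
    from Cons.prems(2) show ?thesis
    proof (rule runE)
      fix h assume h: "h \<in> queries D" "\<And>x y. x \<in> X \<Longrightarrow> y \<in> X \<Longrightarrow> small_cap s (h x - h y)"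
        "\<And>a. run small_cap cs D {x\<in>X. h x = a} \<Theta>"
      let ?s = "\<lambda>x. f x + h x"
      have sq: "?s \<in> queries (A \<union> D)" by (rule add_query[OF f(1) h(1) assms(3)])
      have h_eq: "h x = h y" if "x \<in> X" "y \<in> X" "?s x = ?s y" for x y
      proof -
        have "h x - h y = - (f x - f y)" using that(3) by simp
        moreover have "2 ^ s dvd - (f x - f y)"
          by (subst dvd_minus_iff) (use f(2)[OF that(1,2)] in \<open>simp add: dvd_cap_def\<close>)
        ultimately have "dvd_cap s (h x - h y)" by (simp add: dvd_cap_def)
        from dvd_small_eq_0[OF this h(2)[OF that(1,2)]] show ?thesis by simp
      qed
      show ?thesis unfolding length_Cons replicate_Suc
      proof (rule runI[OF sq])
        show "dvd_cap 0 (?s x - ?s y)" for x y by (simp add: dvd_cap_def)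
      next
        fix a
        let ?Y = "{x\<in>X. ?s x = a}"
        show "run dvd_cap (replicate (length cs) 0) (A \<union> D) ?Y (\<lambda>Y. \<Phi> Y \<and> \<Theta> Y)"
        proof (cases "?Y = {}")
          case False
          then obtain z where z: "z \<in> ?Y" by blast
          have eq: "h x = h z \<and> f x = f z" if "x \<in> ?Y" for x
          proof -
            have "h x = h z" using h_eq[of x z] that z by simp
            then show ?thesis using that z by simp
          qed
          show ?thesis
          proof (rule Cons.IH)
            show "run dvd_cap cs A ?Y \<Phi>"
              by (rule run_mono[OF her(1) f(3)[of "f z"]]) (use eq in blast)
            show "run small_cap cs D ?Y \<Theta>"
              by (rule run_mono[OF her(2) h(3)[of "h z"]]) (use eq in blast)
          qed
        next
          case True
          show ?thesis unfolding True
          proof (rule Cons.IH)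
            show "run dvd_cap cs A {} \<Phi>"
              by (rule run_mono[OF her(1) f(3)[of 0]]) blast
            show "run small_cap cs D {} \<Theta>"
              by (rule run_mono[OF her(2) h(3)[of 0]]) blast
          qed
        qed
      qed
    qed
  qed
qed simp

lemma run_single:
  assumes "f \<in> queries A" "\<And>x y. x \<in> X \<Longrightarrow> y \<in> X \<Longrightarrow> C s (f x - f y)"
  shows "run C [s] A X (det f)"
  by (rule runI[OF assms(1)]) (simp_all add: assms(2) det_const)

text \<open>A packing of Kraft type: splitting the total range leaves two collections for the two
  halves of the ruler and at most one count \<open>z\<close>, which fits the middle entry. At
  \<open>n = 0\<close> all ranges vanish, so everything is known already.\<close>

lemma run_small_ruler:
  fixes r :: "'i \<Rightarrow> nat"
  assumes "finite I" "sum r I < 2 ^ n" "\<And>i. i \<in> I \<Longrightarrow> f i \<in> queries A"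
    "\<And>i x y. i \<in> I \<Longrightarrow> x \<in> X \<Longrightarrow> y \<in> X \<Longrightarrow> \<bar>f i x - f i y\<bar> \<le> int (r i)"
  shows "run small_cap (ruler (Suc n)) A X (\<lambda>Y. \<forall>i\<in>I. det (f i) Y)"
  using assms
proof (induction n arbitrary: I)
  case 0
  then have "r i = 0" if "i \<in> I" for i using that by simp
  then have "det (f i) X" if "i \<in> I" for i
    unfolding det_def
  proof (intro ballI)
    fix x y assume "x \<in> X" "y \<in> X"
    from 0(4)[OF that this] \<open>i \<in> I \<Longrightarrow> r i = 0\<close>[OF that] show "f i x = f i y" by simp
  qed
  then show ?case by (intro run_idle hereditary_ball hereditary_det) simp_all
next
  case (Suc n)
  obtain I1 I2 Z where I: "I = I1 \<union> I2 \<union> Z" "sum r I1 < 2 ^ n" "sum r I2 < 2 ^ n"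
     "Z = {} \<or> (\<exists>z. Z = {z})"
    using split_weights[of I r "2 ^ n"] Suc.prems(1,2) by (metis power_Suc)
  have fin: "finite I1" "finite I2" using Suc.prems(1) I(1) by auto
  have R1: "run small_cap (ruler (Suc n)) A X (\<lambda>Y. \<forall>i\<in>I1. det (f i) Y)"
    by (rule Suc.IH[OF fin(1) I(2)]) (use Suc.prems(3,4) I(1) in auto)
  have R2: "run small_cap (ruler (Suc n)) A X (\<lambda>Y. \<forall>i\<in>I2. det (f i) Y)"
    by (rule Suc.IH[OF fin(2) I(3)]) (use Suc.prems(3,4) I(1) in auto)
  have RZ: "run small_cap [Suc n] A X (\<lambda>Y. \<forall>i\<in>Z. det (f i) Y)"
    using I(4)
  proof
    assume "Z = {}"
    then show ?thesis by (intro run_idle hereditary_ball hereditary_det) simp_all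
  next
    assume "\<exists>z. Z = {z}"
    then obtain z where z: "Z = {z}" "z \<in> I" using I(1) by blast
    have "r z \<le> sum r I" using Suc.prems(1) z(2) by (simp add: member_le_sum)
    then have "int (r z) < 2 ^ Suc n"
      using Suc.prems(2) by (metis le_less_trans of_nat_less_iff of_nat_numeral of_nat_power)
    then have "run small_cap [Suc n] A X (det (f z))"
      unfolding small_cap_def
      by (intro run_single Suc.prems(3) z(2)) (rule le_less_trans[OF Suc.prems(4)[OF z(2)]], assumption+)
    then show ?thesis using z(1) by simp
  qed
  have "run small_cap ([Suc n] @ ruler (Suc n)) (A \<union> A) X
     (\<lambda>Y. (\<forall>i\<in>Z. det (f i) Y) \<and> (\<forall>i\<in>I2. det (f i) Y))"
    by (rule run_conj[OF RZ R2]) (intro hereditary_ball hereditary_det)+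
  from run_conj[OF R1 this]
  have "run small_cap (ruler (Suc n) @ ([Suc n] @ ruler (Suc n))) (A \<union> (A \<union> A)) X
     (\<lambda>Y. (\<forall>i\<in>I1. det (f i) Y) \<and> (\<forall>i\<in>Z. det (f i) Y) \<and> (\<forall>i\<in>I2. det (f i) Y))"
    by (simp add: hereditary_ball hereditary_conj hereditary_det)
  then have "run small_cap (ruler (Suc n) @ ([Suc n] @ ruler (Suc n))) A X
     (\<lambda>Y. (\<forall>i\<in>I1. det (f i) Y) \<and> (\<forall>i\<in>Z. det (f i) Y) \<and> (\<forall>i\<in>I2. det (f i) Y))"
    by simp
  then have "run small_cap (ruler (Suc n) @ ([Suc n] @ ruler (Suc n))) A X
     (\<lambda>Y. (\<forall>i\<in>I. det (f i) Y))"
    by (rule run_imp) (use I(1) in blast)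
  then show ?case by simp
qed

text \<open>Two consecutive units of \<open>2 ^ n - 1\<close> queries; the middle query of the
  longer ruler idles.\<close>

lemma run_ruler_seq:
  assumes "run dvd_cap (ruler n) A X \<Phi>" "\<And>Y. Y \<subseteq> X \<Longrightarrow> \<Phi> Y \<Longrightarrow> run dvd_cap (ruler n) A Y \<Psi>"
    "hereditary \<Psi>"
  shows "run dvd_cap (ruler (Suc n)) A X \<Psi>"
  unfolding ruler.simps
proof (rule run_seq[OF assms(1)])
  fix Y assume "Y \<subseteq> X" "\<Phi> Y"
  then show "run dvd_cap (n # ruler n) A Y \<Psi>"
    by (intro run_skip assms(2,3)) simp_all
qed

end

section \<open>The pipeline\<close>

text \<open>\<open>w p\<close> bounds the total of all colours at \<open>p\<close>: it is 1 for
  black pegs and the number of occurring colours for a block. The latter is only known after some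
  queries, hence the restriction to secrets in \<open>X0\<close>.\<close>

locale weighted_atoms = atoms e U
  for e :: "'p \<Rightarrow> 'c \<Rightarrow> 'x \<Rightarrow> int" and U :: "'c set" +
  fixes w :: "'p \<Rightarrow> nat" and X0 :: "'x set"
  assumes finite_U: "finite U"
    and atom_nonneg: "x \<in> X0 \<Longrightarrow> c \<in> U \<Longrightarrow> 0 \<le> e p c x"
    and atom_weight: "x \<in> X0 \<Longrightarrow> (\<Sum>c\<in>U. e p c x) \<le> int (w p)"
begin

definition cnt :: "'c \<Rightarrow> 'p set \<Rightarrow> 'x \<Rightarrow> int" where
  "cnt c S x = (\<Sum>p\<in>S. e p c x)"

definition counted :: "'p set \<Rightarrow> 'x set \<Rightarrow> bool" where
  "counted S X \<longleftrightarrow> (\<forall>c\<in>U. det (cnt c S) X)"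

definition solved :: "'p set \<Rightarrow> 'x set \<Rightarrow> bool" where
  "solved S X \<longleftrightarrow> (\<forall>p\<in>S. \<forall>c\<in>U. det (e p c) X)"

text \<open>A job for level \<open>j\<close>: its size matches the query budget of the level, and
  its known totals bound the ranges of all further counts inside it.\<close>

definition ready :: "nat \<Rightarrow> 'x set \<Rightarrow> 'p set \<Rightarrow> bool" where
  "ready j X S \<longleftrightarrow> finite S \<and> sum w S < 4 ^ j \<and> counted S X"

lemma hereditary_counted: "hereditary (counted S)"
  unfolding counted_def[abs_def] by (intro hereditary_ball hereditary_det)

lemma hereditary_solved: "hereditary (solved S)"
  unfolding solved_def[abs_def] by (intro hereditary_ball hereditary_det)

lemma ready_subset: "ready j X S \<Longrightarrow> Y \<subseteq> X \<Longrightarrow> ready j Y S"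
  unfolding ready_def using hereditaryD[OF hereditary_counted] by blast

lemma counted_empty [simp]: "counted {} X"
  by (simp add: counted_def cnt_def det_def)

lemma ready_empty [simp]: "ready j X {}"
  by (simp add: ready_def)

lemma solved_empty [simp]: "solved {} X"
  by (simp add: solved_def)

lemma solved_mono: "solved S X \<Longrightarrow> T \<subseteq> S \<Longrightarrow> solved T X"
  unfolding solved_def by blast

lemma solved_Un: "solved S X \<Longrightarrow> solved T X \<Longrightarrow> solved (S \<union> T) X"
  unfolding solved_def by blast

lemma solved_singleton: "counted {p} X \<longleftrightarrow> solved {p} X"
  by (simp add: solved_def counted_def cnt_def[abs_def])

text \<open>Nonnegative terms whose sum is at most 0 vanish. This settles the jobs of size below
  \<open>4 ^ 0\<close> at the bottom of the pipeline.\<close>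

lemma solved_weight_0:
  assumes "finite S" "sum w S = 0" "X \<subseteq> X0"
  shows "solved S X"
  unfolding solved_def det_def
proof (intro ballI)
  fix p c x y assume p: "p \<in> S" and c: "c \<in> U" and xy: "x \<in> X" "y \<in> X"
  have 0: "e p c z = 0" if "z \<in> X" for z
  proof -
    have z: "z \<in> X0" using that assms(3) by blast
    have "w p = 0" using assms p by simp
    then have "(\<Sum>c\<in>U. e p c z) \<le> 0" using atom_weight[OF z, of p] by simp
    moreover have "e p c z \<le> (\<Sum>c\<in>U. e p c z)"
      by (rule member_le_sum[OF c _ finite_U]) (rule atom_nonneg[OF z], blast)
    ultimately show ?thesis using atom_nonneg[OF z c, of p] by linarith
  qed
  show "e p c x = e p c y" using 0 xy by simp
qed

lemma cnt_nonneg: "x \<in> X0 \<Longrightarrow> c \<in> U \<Longrightarrow> 0 \<le> cnt c S x"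
  unfolding cnt_def by (intro sum_nonneg atom_nonneg)

lemma cnt_mono:
  assumes "x \<in> X0" "c \<in> U" "S \<subseteq> T" "finite T"
  shows "cnt c S x \<le> cnt c T x"
  unfolding cnt_def by (rule sum_mono2[OF assms(4,3)]) (rule atom_nonneg[OF assms(1,2)])

lemma sum_cnt_le:
  assumes "x \<in> X0"
  shows "(\<Sum>c\<in>U. cnt c S x) \<le> int (sum w S)"
proof -
  have "(\<Sum>c\<in>U. cnt c S x) = (\<Sum>p\<in>S. \<Sum>c\<in>U. e p c x)"
    unfolding cnt_def by (rule sum.swap)
  also have "\<dots> \<le> (\<Sum>p\<in>S. int (w p))" by (intro sum_mono atom_weight assms)
  finally show ?thesis by simp
qed

lemma cnt_query: "finite S \<Longrightarrow> c \<in> U \<Longrightarrow> cnt c S \<in> queries S"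
  using atom_sum_query[of S c] by (simp add: cnt_def[abs_def])

text \<open>A known total \<open>cnt c J\<close> bounds the range of the count of \<open>c\<close> on every part of \<open>J\<close>, and
  these bounds sum to at most the weight of \<open>J\<close>.\<close>

lemma run_counts:
  assumes J: "finite J" "counted J X" "X \<subseteq> X0"
    and S: "finite \<S>" "\<And>S. S \<in> \<S> \<Longrightarrow> S \<subseteq> J"
    and bound: "card \<S> * sum w J < 2 ^ n"
  shows "run small_cap (ruler (Suc n)) J X (\<lambda>Y. \<forall>S\<in>\<S>. counted S Y)"
proof -
  obtain R :: "'c \<Rightarrow> nat" where R: "\<And>c x. c \<in> U \<Longrightarrow> x \<in> X \<Longrightarrow> cnt c J x = int (R c)"
    "sum R U \<le> sum w J"
  proof (cases "X = {}")
    case True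
    then show ?thesis by (intro that[of "\<lambda>_. 0"]) simp_all
  next
    case False
    then obtain z where z: "z \<in> X" by blast
    then have z0: "z \<in> X0" using J(3) by blast
    show ?thesis
    proof (rule that[of "\<lambda>c. nat (cnt c J z)"])
      fix c x assume c: "c \<in> U" and x: "x \<in> X"
      have "cnt c J x = cnt c J z" using J(2) c x z unfolding counted_def det_def by blast
      then show "cnt c J x = int (nat (cnt c J z))" using cnt_nonneg[OF z0 c] by simp
    next
      have "int (\<Sum>c\<in>U. nat (cnt c J z)) = (\<Sum>c\<in>U. cnt c J z)"
        unfolding of_nat_sum by (rule sum.cong) (use cnt_nonneg[OF z0] in simp_all)
      also have "\<dots> \<le> int (sum w J)" by (rule sum_cnt_le[OF z0])
      finally show "(\<Sum>c\<in>U. nat (cnt c J z)) \<le> sum w J" by (simp only: of_nat_le_iff)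
    qed
  qed
  have "run small_cap (ruler (Suc n)) J X
      (\<lambda>Y. \<forall>i\<in>U \<times> \<S>. det (case i of (c, S) \<Rightarrow> cnt c S) Y)"
  proof (rule run_small_ruler[where r = "\<lambda>(c, S). R c"])
    show "finite (U \<times> \<S>)" using finite_U S(1) by simp
    have "(\<Sum>(c, S)\<in>U \<times> \<S>. R c) = (\<Sum>c\<in>U. \<Sum>S\<in>\<S>. R c)"
      by (rule sum.cartesian_product[symmetric])
    also have "\<dots> = card \<S> * sum R U" by (simp add: sum_distrib_left)
    also have "\<dots> \<le> card \<S> * sum w J" using R(2) by (intro mult_le_mono2)
    finally show "(\<Sum>i\<in>U \<times> \<S>. case i of (c, S) \<Rightarrow> R c) < 2 ^ n" using bound by linarith
  next
    fix i assume i: "i \<in> U \<times> \<S>"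
    obtain c S where cS: "i = (c, S)" "c \<in> U" "S \<in> \<S>" "S \<subseteq> J" "finite S"
      using i S(2) J(1) finite_subset[OF _ J(1)] by (cases i) auto
    have "cnt c S \<in> queries J"
      by (rule subsetD[OF queries_mono[OF cS(4)] cnt_query[OF cS(5,2)]])
    then show "(case i of (c, S) \<Rightarrow> cnt c S) \<in> queries J" using cS(1) by simp
    fix x y assume xy: "x \<in> X" "y \<in> X"
    have "0 \<le> cnt c S z \<and> cnt c S z \<le> int (R c)" if "z \<in> X" for z
    proof -
      have z: "z \<in> X0" using that J(3) by blast
      show ?thesis
        using cnt_nonneg[OF z cS(2), of S] cnt_mono[OF z cS(2,4) J(1)] R(1)[OF cS(2) that] by simp
    qed
    from this[OF xy(1)] this[OF xy(2)]
    show "\<bar>(case i of (c, S) \<Rightarrow> cnt c S) x - (case i of (c, S) \<Rightarrow> cnt c S) y\<bar>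
        \<le> int (case i of (c, S) \<Rightarrow> R c)"
      unfolding cS(1) prod.case by linarith
  qed
  then show ?thesis
    by (rule run_imp) (auto simp: counted_def)
qed

text \<open>Splitting by weight leaves over at most three single positions, which are solved as soon as
  they are counted.\<close>

lemma run_split:
  assumes J: "ready (Suc j) X J" "X \<subseteq> X0"
  obtains A B C D where "A \<union> B \<union> C \<union> D \<subseteq> J"
    "A \<inter> B = {}" "A \<inter> C = {}" "A \<inter> D = {}" "B \<inter> C = {}" "B \<inter> D = {}" "C \<inter> D = {}"
    "run small_cap (ruler (2 * j + 6)) J X (\<lambda>Y. ready j Y A \<and> ready j Y B \<and> ready j Y C \<and> ready j Y D
       \<and> solved (J - (A \<union> B \<union> C \<union> D)) Y)"
proof -
  have fin: "finite J" and lt: "sum w J < 4 ^ Suc j" and cJ: "counted J X"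
    using J(1) by (auto simp: ready_def)
  have "sum w J < 2 * (2 * 4 ^ j)" using lt by simp
  from split_weights[OF fin this] obtain I1 I2 Z where I: "J = I1 \<union> I2 \<union> Z" "I1 \<inter> I2 = {}"
    "I1 \<inter> Z = {}" "I2 \<inter> Z = {}" "sum w I1 < 2 * 4 ^ j" "sum w I2 < 2 * 4 ^ j"
    "Z = {} \<or> (\<exists>z. Z = {z})" by blast
  have fin12: "finite I1" "finite I2" using fin I(1) by auto
  from split_weights[OF fin12(1) I(5)] obtain A B Z1 where AB: "I1 = A \<union> B \<union> Z1" "A \<inter> B = {}"
    "A \<inter> Z1 = {}" "B \<inter> Z1 = {}" "sum w A < 4 ^ j" "sum w B < 4 ^ j" "Z1 = {} \<or> (\<exists>z. Z1 = {z})" by blast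
  from split_weights[OF fin12(2) I(6)] obtain C D Z2 where CD: "I2 = C \<union> D \<union> Z2" "C \<inter> D = {}"
    "C \<inter> Z2 = {}" "D \<inter> Z2 = {}" "sum w C < 4 ^ j" "sum w D < 4 ^ j" "Z2 = {} \<or> (\<exists>z. Z2 = {z})" by blast
  define \<S> where "\<S> = {A, B, C, D, Z, Z1, Z2}"
  \<comment> \<open>Four quarters and three leftovers are seven sets. Rounding 7 up to 8 turns the
    bound into \<open>8 * 4 ^ Suc j = 2 ^ (2 * j + 5)\<close>, and \<open>run_counts\<close> raises
    the exponent by one: this is the 6 in \<open>ruler (2 * j + 6)\<close>.\<close>
  have "card \<S> \<le> 7" unfolding \<S>_def using card_length[of "[A, B, C, D, Z, Z1, Z2]"] by simp
  then have "card \<S> * sum w J \<le> 7 * sum w J" by (rule mult_le_mono1)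
  also have "\<dots> < 8 * 4 ^ Suc j" using lt by (simp add: less_imp_le)
  also have "\<dots> = 2 ^ (2 * j + 5)"
    by (simp add: power_add power_mult)
  finally have bound: "card \<S> * sum w J < 2 ^ (2 * j + 5)" .
  have R: "run small_cap (ruler (Suc (2 * j + 5))) J X (\<lambda>Y. \<forall>S\<in>\<S>. counted S Y)"
    by (rule run_counts[OF fin cJ J(2) _ _ bound]) (use I(1) AB(1) CD(1) in \<open>auto simp: \<S>_def\<close>)
  have triv: "solved T Y" if "counted T Y" "T = {} \<or> (\<exists>z. T = {z})" for T Y
    using that solved_singleton by auto
  show thesis
  proof (rule that[of A B C D])
    have "run small_cap (ruler (Suc (2 * j + 5))) J X (\<lambda>Y. ready j Y A \<and> ready j Y B \<and> ready j Y C \<and> ready j Y D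
       \<and> solved (J - (A \<union> B \<union> C \<union> D)) Y)"
      using R
    proof (rule run_imp)
      fix Y assume Y: "\<forall>S\<in>\<S>. counted S Y"
      have "solved (Z \<union> (Z1 \<union> Z2)) Y"
        by (intro solved_Un triv I(7) AB(7) CD(7)) (use Y in \<open>simp_all add: \<S>_def\<close>)
      then have "solved (J - (A \<union> B \<union> C \<union> D)) Y"
        by (rule solved_mono) (use I(1) AB(1) CD(1) in blast)
      moreover have "finite A" "finite B" "finite C" "finite D" using fin12 AB(1) CD(1) by auto
      ultimately show "ready j Y A \<and> ready j Y B \<and> ready j Y C \<and> ready j Y D
       \<and> solved (J - (A \<union> B \<union> C \<union> D)) Y"
        using Y AB(5,6) CD(5,6) by (simp add: ready_def \<S>_def)
    qed
    then show "run small_cap (ruler (2 * j + 6)) J X (\<lambda>Y. ready j Y A \<and> ready j Y B \<and> ready j Y C \<and> ready j Y D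
       \<and> solved (J - (A \<union> B \<union> C \<union> D)) Y)" by (simp add: eval_nat_numeral)
  qed (use I(1,2) AB(1,2) CD(1,2) in blast)+
qed

end

context weighted_atoms
begin

text \<open>A pipeline of level \<open>j + 1\<close> holds the four quarters of the job it received last and two
  pipelines of level \<open>j\<close>, each of which is next fed two of these quarters (its \<open>lane\<close>). The flag
  \<open>t\<close> counts how often in a row it has been fed the empty job; after two such steps it is empty.\<close>

definition lane :: "('x set \<Rightarrow> 'p set \<Rightarrow> bool) \<Rightarrow> nat \<Rightarrow> nat \<Rightarrow> 'x set \<Rightarrow> 'p set \<Rightarrow> bool" where
  "lane P t j X L \<longleftrightarrow> (\<exists>A C V. L = A \<union> C \<union> V \<and> A \<inter> C = {} \<and> A \<inter> V = {} \<and> C \<inter> V = {} \<and>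
     ready j X A \<and> ready j X C \<and> (1 \<le> t \<longrightarrow> A = {} \<and> C = {}) \<and> P X V)"

primrec pipe :: "nat \<Rightarrow> nat \<Rightarrow> 'x set \<Rightarrow> 'p set \<Rightarrow> bool" where
  "pipe 0 t X V \<longleftrightarrow> V = {}"
| "pipe (Suc j) t X V \<longleftrightarrow> (2 \<le> t \<longrightarrow> V = {}) \<and>
     (\<exists>L1 L2. V = L1 \<union> L2 \<and> L1 \<inter> L2 = {} \<and> lane (pipe j 0) t j X L1 \<and> lane (pipe j 0) t j X L2)"

lemma laneI:
  assumes "A \<inter> C = {}" "A \<inter> V = {}" "C \<inter> V = {}" "ready j X A" "ready j X C"
    "1 \<le> t \<Longrightarrow> A = {} \<and> C = {}" "P X V"
  shows "lane P t j X (A \<union> C \<union> V)"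
  unfolding lane_def using assms by (intro exI[of _ A] exI[of _ C] exI[of _ V]) simp

lemma lane_mono:
  assumes "lane P t j X L" "t' \<le> t" "Y \<subseteq> X" "\<And>V. P X V \<Longrightarrow> P' Y V"
  shows "lane P' t' j Y L"
proof -
  from assms(1) obtain A C V where *: "L = A \<union> C \<union> V" "A \<inter> C = {}" "A \<inter> V = {}" "C \<inter> V = {}"
     "ready j X A" "ready j X C" "1 \<le> t \<longrightarrow> A = {} \<and> C = {}" "P X V"
    unfolding lane_def by blast
  show ?thesis unfolding *(1)
    by (rule laneI[OF *(2-4)])
      (use assms(2-4) *(5-8) ready_subset in \<open>auto simp del: Un_iff\<close>)
qed

lemma pipe_2: "2 \<le> t \<Longrightarrow> pipe j t X V \<Longrightarrow> V = {}"
  by (cases j) simp_all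

lemma pipe_empty: "pipe j t X {}"
proof (induction j arbitrary: t)
  case (Suc j)
  have "lane (pipe j 0) t j X ({} \<union> {} \<union> {})"
    by (rule laneI) (simp_all add: Suc)
  then have "lane (pipe j 0) t j X {}" by simp
  then show ?case by (simp only: pipe.simps) blast
qed simp

lemma pipe_mono:
  assumes "pipe j t X V" "t' \<le> t" "Y \<subseteq> X"
  shows "pipe j t' Y V"
  using assms(1,2)
proof (induction j arbitrary: t t' V)
  case (Suc j)
  have "lane (pipe j 0) t' j Y L" if "lane (pipe j 0) t j X L" for L
    by (rule lane_mono[OF that Suc.prems(2) assms(3)]) (rule Suc.IH, assumption, simp)
  moreover have "2 \<le> t' \<longrightarrow> V = {}" using Suc.prems by auto
  ultimately show ?case using Suc.prems(1) by (simp only: pipe.simps) blast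
qed simp

lemma pipe_decrease: "pipe j t X V \<Longrightarrow> t' \<le> t \<Longrightarrow> pipe j t' X V"
  by (rule pipe_mono[OF _ _ subset_refl])

lemma pipe_subset: "pipe j t X V \<Longrightarrow> Y \<subseteq> X \<Longrightarrow> pipe j t Y V"
  by (rule pipe_mono[OF _ order_refl])

text \<open>\<open>V'\<close> is what is still inside the pipeline; the rest of \<open>W\<close> has
  come out solved.\<close>

definition advanced :: "nat \<Rightarrow> nat \<Rightarrow> 'p set \<Rightarrow> 'x set \<Rightarrow> bool" where
  "advanced j t W Y \<longleftrightarrow> (\<exists>V'\<subseteq>W. pipe j t Y V' \<and> solved (W - V') Y)"

lemma hereditary_advanced: "hereditary (advanced j t W)"
  unfolding advanced_def
  by (rule hereditaryI) (meson pipe_subset hereditaryD[OF hereditary_solved])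

text \<open>One unit of level \<open>j + 1\<close> leaves time for two units of level
  \<open>j\<close>, fed with \<open>A\<close> and then \<open>C\<close>. If both are empty, the
  lower pipeline has received nothing twice and is flushed; hence two empty units suffice on every
  level. The assumption \<open>step\<close> is the induction hypothesis of
  \<open>pipe_step\<close>.\<close>

lemma lane_step:
  assumes step: "\<And>t X V J. pipe j t X V \<Longrightarrow> ready j X J \<Longrightarrow> J \<inter> V = {} \<Longrightarrow> X \<subseteq> X0 \<Longrightarrow>
      run dvd_cap (ruler (2 * j + 5)) (V \<union> J) X (advanced j (if J = {} then Suc t else 0) (V \<union> J))"
    and L: "lane (pipe j 0) t j X L" "X \<subseteq> X0"
  shows "run dvd_cap (ruler (2 * j + 6)) L X (advanced j (if 1 \<le> t then 2 else 0) L)"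
proof -
  from L(1) obtain A C V where ACV: "L = A \<union> C \<union> V" "A \<inter> C = {}" "A \<inter> V = {}" "C \<inter> V = {}"
     "ready j X A" "ready j X C" "1 \<le> t \<longrightarrow> A = {} \<and> C = {}" "pipe j 0 X V"
    unfolding lane_def by blast
  define e1 :: nat where "e1 = (if A = {} then Suc 0 else 0)"
  have R1: "run dvd_cap (ruler (2 * j + 5)) L X (advanced j e1 (V \<union> A))"
    by (rule run_support[OF step[OF ACV(8,5,3) L(2), folded e1_def]]) (use ACV(1) in blast)
  have "run dvd_cap (ruler (Suc (2 * j + 5))) L X (advanced j (if 1 \<le> t then 2 else 0) L)"
  proof (rule run_ruler_seq[OF R1 _ hereditary_advanced])
    fix Y assume Y: "Y \<subseteq> X" "advanced j e1 (V \<union> A) Y"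
    then obtain V1 where V1: "V1 \<subseteq> V \<union> A" "pipe j e1 Y V1" "solved (V \<union> A - V1) Y"
      unfolding advanced_def by blast
    define e2 where "e2 = (if C = {} then Suc e1 else 0)"
    have R2: "run dvd_cap (ruler (2 * j + 5)) (V1 \<union> C) Y (advanced j e2 (V1 \<union> C))"
      unfolding e2_def
      by (rule step[OF V1(2) ready_subset[OF ACV(6) Y(1)]]) (use ACV(2,4) V1(1) L(2) Y(1) in blast)+
    have "run dvd_cap (ruler (2 * j + 5)) L Y (advanced j e2 (V1 \<union> C))"
      by (rule run_support[OF R2]) (use ACV(1) V1(1) in blast)
    then show "run dvd_cap (ruler (2 * j + 5)) L Y (advanced j (if 1 \<le> t then 2 else 0) L)"
    proof (rule run_imp)
      fix Y' assume Y': "Y' \<subseteq> Y" "advanced j e2 (V1 \<union> C) Y'"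
      then obtain V2 where V2: "V2 \<subseteq> V1 \<union> C" "pipe j e2 Y' V2" "solved (V1 \<union> C - V2) Y'"
        unfolding advanced_def by blast
      \<comment> \<open>If \<open>1 \<le> t\<close>, both quarters are empty and have raised the
        flag from 0 to 2; otherwise only flag 0 is claimed.\<close>
      have "(if 1 \<le> t then 2 else 0) \<le> e2" using ACV(7) by (simp add: e1_def e2_def)
      then have "pipe j (if 1 \<le> t then 2 else 0) Y' V2" by (rule pipe_decrease[OF V2(2)])
      moreover have "solved (L - V2) Y'"
      proof (rule solved_mono)
        show "solved ((V \<union> A - V1) \<union> (V1 \<union> C - V2)) Y'"
          by (rule solved_Un[OF hereditaryD[OF hereditary_solved V1(3) Y'(1)] V2(3)])
      qed (use ACV(1) in blast)
      moreover have "V2 \<subseteq> L" using V2(1) V1(1) ACV(1) by blast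
      ultimately show "advanced j (if 1 \<le> t then 2 else 0) L Y'"
        unfolding advanced_def by blast
    qed
  qed
  then show ?thesis by (simp add: eval_nat_numeral)
qed

text \<open>The two lanes and the splitting of \<open>J\<close> play the roles of \<open>f\<close>,
  \<open>g\<close> and \<open>h\<close> in \<open>weave\<close>, each with budget
  \<open>ruler (2 * j + 6)\<close>. Weaving adds one to the index, giving
  \<open>2 * j + 7 = 2 * Suc j + 5\<close>, so that the cost of a unit grows like the job size, by a
  factor of about 4 per level.\<close>

lemma pipe_step:
  assumes "pipe j t X V" "ready j X J" "J \<inter> V = {}" "X \<subseteq> X0"
  shows "run dvd_cap (ruler (2 * j + 5)) (V \<union> J) X (advanced j (if J = {} then Suc t else 0) (V \<union> J))"
  using assms
proof (induction j arbitrary: t X V J)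
  case 0
  then have J: "finite J" "sum w J = 0" "V = {}" by (auto simp: ready_def)
  have "advanced 0 (if J = {} then Suc t else 0) (V \<union> J) X"
    unfolding advanced_def using solved_weight_0[OF J(1,2) 0(4)] J(3) by auto
  then show ?case by (intro run_idle hereditary_advanced) simp_all
next
  case (Suc j)
  from Suc.prems(1) obtain L1 L2 where L: "V = L1 \<union> L2" "L1 \<inter> L2 = {}" "lane (pipe j 0) t j X L1"
      "lane (pipe j 0) t j X L2"
    by (simp only: pipe.simps) blast
  have R: "run dvd_cap (ruler (2 * j + 6)) L X (advanced j (if 1 \<le> t then 2 else 0) L)"
    if "lane (pipe j 0) t j X L" for L
    by (rule lane_step[OF _ that Suc.prems(4)]) (rule Suc.IH)
  obtain A B C D where S: "A \<union> B \<union> C \<union> D \<subseteq> J"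
    "A \<inter> B = {}" "A \<inter> C = {}" "A \<inter> D = {}" "B \<inter> C = {}" "B \<inter> D = {}" "C \<inter> D = {}"
    "run small_cap (ruler (2 * j + 6)) J X (\<lambda>Y. ready j Y A \<and> ready j Y B \<and> ready j Y C \<and> ready j Y D
       \<and> solved (J - (A \<union> B \<union> C \<union> D)) Y)"
    by (rule run_split[OF Suc.prems(2,4)])
  define t' where "t' = (if J = {} then Suc t else 0)"
  let ?t = "if 1 \<le> t then 2 else (0::nat)"
  have "run dvd_cap (ruler (Suc (2 * j + 6))) (L1 \<union> L2 \<union> J) X
     (\<lambda>Y. advanced j ?t L1 Y \<and> advanced j ?t L2 Y \<and>
       (ready j Y A \<and> ready j Y B \<and> ready j Y C \<and> ready j Y D \<and> solved (J - (A \<union> B \<union> C \<union> D)) Y))"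
  proof (rule run_ruler_weave[OF R[OF L(3)] R[OF L(4)] S(8)])
    show "hereditary (\<lambda>Y. ready j Y A \<and> ready j Y B \<and> ready j Y C \<and> ready j Y D
       \<and> solved (J - (A \<union> B \<union> C \<union> D)) Y)"
      by (rule hereditaryI) (meson ready_subset hereditaryD[OF hereditary_solved])
  qed (use L(1,2) Suc.prems(3) in \<open>auto intro: hereditary_advanced\<close>)
  then have "run dvd_cap (ruler (Suc (2 * j + 6))) (L1 \<union> L2 \<union> J) X (advanced (Suc j) t' (V \<union> J))"
  proof (rule run_imp, elim conjE)
    fix Y assume Y: "Y \<subseteq> X" "advanced j ?t L1 Y" "advanced j ?t L2 Y"
      and rd: "ready j Y A" "ready j Y B" "ready j Y C" "ready j Y D"
      and sJ: "solved (J - (A \<union> B \<union> C \<union> D)) Y"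
    obtain V1 where V1: "V1 \<subseteq> L1" "pipe j ?t Y V1" "solved (L1 - V1) Y"
      using Y(2) unfolding advanced_def by blast
    obtain V2 where V2: "V2 \<subseteq> L2" "pipe j ?t Y V2" "solved (L2 - V2) Y"
      using Y(3) unfolding advanced_def by blast
    have J_t': "J = {}" if "1 \<le> t'" using that by (simp add: t'_def split: if_splits)
    have empty: "A = {} \<and> C = {}" "B = {} \<and> D = {}" if "1 \<le> t'"
      using J_t'[OF that] S(1) by blast+
    let ?V = "(A \<union> C \<union> V1) \<union> (B \<union> D \<union> V2)"
    have "lane (pipe j 0) t' j Y (A \<union> C \<union> V1)"
      by (rule laneI[OF S(3) _ _ rd(1,3)])
        (use V1(1) L(1) S(1) Suc.prems(3) empty(1) pipe_decrease[OF V1(2)] in auto)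
    moreover have "lane (pipe j 0) t' j Y (B \<union> D \<union> V2)"
      by (rule laneI[OF S(6) _ _ rd(2,4)])
        (use V2(1) L(1) S(1) Suc.prems(3) empty(2) pipe_decrease[OF V2(2)] in auto)
    moreover have "(A \<union> C \<union> V1) \<inter> (B \<union> D \<union> V2) = {}"
    proof -
      have "J \<inter> L1 = {}" "J \<inter> L2 = {}" using Suc.prems(3) L(1) by auto
      then have "(A \<union> C) \<inter> V2 = {}" "V1 \<inter> (B \<union> D) = {}" "V1 \<inter> V2 = {}"
        using S(1) V1(1) V2(1) L(2) by auto
      moreover have "(A \<union> C) \<inter> (B \<union> D) = {}" using S(2,4,5,7) by auto
      ultimately show ?thesis by auto
    qed
    \<comment> \<open>\<open>2 \<le> t'\<close> means that \<open>J\<close> is empty and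
      \<open>1 \<le> t\<close>, so the job before was empty as well: this unit flushes both lanes
      and puts nothing new into them.\<close>
    moreover have "?V = {}" if "2 \<le> t'"
    proof -
      have "1 \<le> t" using that by (simp add: t'_def split: if_splits)
      then have "V1 = {}" "V2 = {}" using pipe_2[of ?t] V1(2) V2(2) by auto
      then show ?thesis using empty that by auto
    qed
    ultimately have "pipe (Suc j) t' Y ?V"
      by (simp only: pipe.simps) blast
    moreover have "solved (V \<union> J - ?V) Y"
      by (rule solved_mono[OF solved_Un[OF solved_Un[OF V1(3) V2(3)] sJ]]) (use L(1) in blast)
    moreover have "?V \<subseteq> V \<union> J" using V1(1) V2(1) L(1) S(1) by blast
    ultimately show "advanced (Suc j) t' (V \<union> J) Y" unfolding advanced_def by blast
  qed
  then show ?case by (simp add: L(1) t'_def eval_nat_numeral)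
qed

text \<open>Feeding \<open>S\<close> and then two empty jobs empties the pipeline. These three units
  of \<open>ruler (2 * j + 5)\<close> are padded to four, which make up
  \<open>ruler (2 * j + 7)\<close>.\<close>

theorem run_solve:
  assumes "finite S" "sum w S < 4 ^ j" "counted S X" "X \<subseteq> X0"
  shows "run dvd_cap (ruler (2 * j + 7)) S X (solved S)"
proof -
  have feed: "run dvd_cap (ruler (2 * j + 5)) S Y (advanced j (Suc t) S)"
    if Y: "Y \<subseteq> X" "advanced j t S Y" for t Y
  proof -
    obtain V where V: "V \<subseteq> S" "pipe j t Y V" "solved (S - V) Y"
      using Y(2) unfolding advanced_def by blast
    have "Y \<subseteq> X0" using Y(1) assms(4) by simp
    from pipe_step[OF V(2) ready_empty _ this]
    have "run dvd_cap (ruler (2 * j + 5)) V Y (advanced j (Suc t) V)" by simp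
    from run_support[OF this V(1)]
    show ?thesis
    proof (rule run_imp)
      fix Y' assume Y': "Y' \<subseteq> Y" "advanced j (Suc t) V Y'"
      then obtain V' where V': "V' \<subseteq> V" "pipe j (Suc t) Y' V'" "solved (V - V') Y'"
        unfolding advanced_def by blast
      have "solved (S - V') Y'"
        by (rule solved_mono[OF solved_Un[OF hereditaryD[OF hereditary_solved V(3) Y'(1)] V'(3)]]) blast
      then show "advanced j (Suc t) S Y'" unfolding advanced_def using V'(1,2) V(1) by blast
    qed
  qed
  have "run dvd_cap (ruler (2 * j + 5)) ({} \<union> S) X (advanced j (if S = {} then Suc 0 else 0) ({} \<union> S))"
    by (rule pipe_step[OF pipe_empty]) (use assms in \<open>simp_all add: ready_def\<close>)
  then have "run dvd_cap (ruler (2 * j + 5)) S X (advanced j (if S = {} then Suc 0 else 0) S)" by simp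
  then have "run dvd_cap (ruler (2 * j + 5)) S X (advanced j 0 S)"
    by (rule run_imp) (use pipe_decrease[of j _ _ _ 0] in \<open>unfold advanced_def, blast\<close>)
  then have 1: "run dvd_cap (ruler (Suc (2 * j + 5))) S X (advanced j 1 S)"
    by (rule run_ruler_seq) (use feed[of _ 0] hereditary_advanced in simp_all)
  have 2: "run dvd_cap (ruler (Suc (2 * j + 5))) S Y (advanced j 2 S)" if "Y \<subseteq> X" "advanced j 1 S Y" for Y
  proof (rule run_ruler_seq[OF feed[OF that]])
    fix Y' assume "Y' \<subseteq> Y" "advanced j (Suc 1) S Y'"
    then show "run dvd_cap (ruler (2 * j + 5)) S Y' (advanced j 2 S)"
      by (intro run_idle hereditary_advanced) (simp_all add: eval_nat_numeral)
  qed (rule hereditary_advanced)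
  have "run dvd_cap (ruler (Suc (Suc (2 * j + 5)))) S X (advanced j 2 S)"
    by (rule run_ruler_seq[OF 1 2 hereditary_advanced])
  then have "run dvd_cap (ruler (Suc (Suc (2 * j + 5)))) S X (solved S)"
  proof (rule run_imp)
    fix Y assume "advanced j 2 S Y"
    then obtain V where "pipe j 2 Y V" "solved (S - V) Y" unfolding advanced_def by blast
    then show "solved S Y" using pipe_2[of 2 j Y V] by simp
  qed
  then show ?thesis by (simp add: eval_nat_numeral)
qed

end

section \<open>Many strategies in parallel\<close>

lemma length_double_iter: "length ((double ^^ l) cs) = 2 ^ l * length cs"
proof (induction l)
  case (Suc l)
  have "length (double ds) = 2 * length ds" for ds by (induction ds rule: double.induct) auto
  then show ?case using Suc by simp
qed simp

text \<open>Started on zeros, each entry is the number of ones in an \<open>l\<close>-bit string, so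
  the entries average \<open>l / 2\<close>; the factor 2 avoids the division.\<close>

lemma sum_list_double_iter: "2 * sum_list ((double ^^ l) (replicate n 0)) = l * (2 ^ l * n)"
proof (induction l)
  case (Suc l)
  have "sum_list (double ds) = 2 * sum_list ds + length ds" for ds
    by (induction ds rule: double.induct) auto
  then show ?case using Suc length_double_iter[of l "replicate n 0"] by (simp add: algebra_simps)
qed simp

lemma double_iter_le: "s \<in> set ((double ^^ l) (replicate n 0)) \<Longrightarrow> s \<le> l"
proof (induction l arbitrary: s)
  case (Suc l)
  have "s \<in> set (double ds) \<Longrightarrow> s \<in> set ds \<or> s \<in> Suc ` set ds" for ds
    by (induction ds rule: double.induct) auto
  then show ?case using Suc by (fastforce simp: image_iff)
qed simp

text \<open>A bound of Markov type: entries of at least \<open>b\<close> contribute at most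
  \<open>l\<close> each, the others at most \<open>b\<close>.\<close>

lemma sum_list_le_filter:
  fixes cs :: "nat list"
  shows "(\<And>s. s \<in> set cs \<Longrightarrow> s \<le> l) \<Longrightarrow>
     sum_list cs \<le> l * length (filter (\<lambda>s. b \<le> s) cs) + b * length cs"
proof (induction cs)
  case (Cons s cs)
  have "sum_list cs \<le> l * length (filter (\<lambda>s. b \<le> s) cs) + b * length cs"
    using Cons by simp
  moreover have "s \<le> l" using Cons.prems by simp
  ultimately show ?case by (simp add: algebra_simps)
qed simp

text \<open>Capacities in \<open>double ^^ 4b\<close> average \<open>2b\<close> and never exceed \<open>4b\<close>.\<close>

lemma quarter_of_double_iter:
  assumes "b \<ge> 1"
  shows "2 ^ (4 * b) * n \<le> 4 * length (filter (\<lambda>s. b \<le> s) ((double ^^ (4 * b)) (replicate n 0)))"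
    (is "?L \<le> 4 * ?p")
proof -
  have "sum_list ((double ^^ (4 * b)) (replicate n 0)) \<le> 4 * b * ?p + b * ?L"
    using sum_list_le_filter[of "(double ^^ (4 * b)) (replicate n 0)" "4 * b" b] double_iter_le
    by (simp add: length_double_iter)
  then have "2 * sum_list ((double ^^ (4 * b)) (replicate n 0)) \<le> 2 * (4 * b * ?p + b * ?L)"
    by (rule mult_le_mono2)
  then have "4 * b * ?L \<le> 2 * (4 * b * ?p + b * ?L)"
    by (simp only: sum_list_double_iter)
  then have "b * (2 * ?L) \<le> b * (8 * ?p)" by (simp add: algebra_simps)
  then have "2 * ?L \<le> 8 * ?p" using assms by (simp only: mult_le_cancel1)
  then show ?thesis by linarith
qed

lemma four_power: "b \<ge> 1 \<Longrightarrow> (4::nat) * 2 ^ (4 * b - 2) = 2 ^ (4 * b)"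
proof -
  assume "b \<ge> 1"
  then have "4 * b = 2 + (4 * b - 2)" by simp
  then have "(2::nat) ^ (4 * b) = 2 ^ (2 + (4 * b - 2))" by (rule arg_cong)
  then show ?thesis by (simp only: power_add) simp
qed

text \<open>How many strategies of length \<open>t\<close> fit into
  \<open>t * 2 ^ (4 * b * s)\<close> queries: at each further depth, \<open>2 ^ (4 * b)\<close>
  blocks of the previous depth are combined by \<open>double\<close>, and the quarter of the queries
  whose capacity reaches \<open>b\<close> hosts \<open>2 ^ (4 * b - 2) * 2 ^ (4 * b * s)\<close>
  more strategies one after another.\<close>

primrec par_size :: "nat \<Rightarrow> nat \<Rightarrow> nat" where
  "par_size b 0 = 0"
| "par_size b (Suc s) = 2 ^ (4 * b) * par_size b s + 2 ^ (4 * b - 2) * 2 ^ (4 * b * s)"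

lemma par_size_eq: "b \<ge> 1 \<Longrightarrow> 4 * par_size b s = s * 2 ^ (4 * b * s)"
proof (induction s)
  case (Suc s)
  have "4 * par_size b (Suc s) = 2 ^ (4 * b) * (4 * par_size b s) + (4 * 2 ^ (4 * b - 2)) * 2 ^ (4 * b * s)"
    by simp
  also have "\<dots> = 2 ^ (4 * b) * (s * 2 ^ (4 * b * s)) + 2 ^ (4 * b) * 2 ^ (4 * b * s)"
    by (simp only: Suc.IH[OF Suc.prems] four_power[OF Suc.prems])
  also have "\<dots> = Suc s * (2 ^ (4 * b) * 2 ^ (4 * b * s))"
    by simp
  also have "2 ^ (4 * b) * 2 ^ (4 * b * s) = (2::nat) ^ (4 * b * Suc s)"
    by (simp only: power_add[symmetric] mult_Suc_right)
  finally show ?case .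
qed simp

context atoms
begin

lemma run_double_iter:
  fixes A :: "nat \<Rightarrow> 'p set"
  assumes "\<And>i. i < 2 ^ l \<Longrightarrow> run dvd_cap cs (A i) X (\<Phi> i)" "\<And>i. i < 2 ^ l \<Longrightarrow> hereditary (\<Phi> i)"
    "disjoint_family_on A {..<2 ^ l}"
  shows "run dvd_cap ((double ^^ l) cs) (\<Union>i<2 ^ l. A i) X (\<lambda>Y. \<forall>i<2 ^ l. \<Phi> i Y)"
  using assms
proof (induction l arbitrary: A \<Phi>)
  case 0
  then show ?case by (simp add: lessThan_Suc)
next
  case (Suc l)
  let ?B = "\<lambda>i. A (2 ^ l + i)" and ?\<Psi> = "\<lambda>i. \<Phi> (2 ^ l + i)"
  have lt: "(2::nat) ^ Suc l = 2 ^ l + 2 ^ l" by simp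
  have R1: "run dvd_cap ((double ^^ l) cs) (\<Union>i<2 ^ l. A i) X (\<lambda>Y. \<forall>i<2 ^ l. \<Phi> i Y)"
    by (rule Suc.IH) (use Suc.prems lt in \<open>auto simp: disjoint_family_on_def\<close>)
  have R2: "run dvd_cap ((double ^^ l) cs) (\<Union>i<2 ^ l. ?B i) X (\<lambda>Y. \<forall>i<2 ^ l. ?\<Psi> i Y)"
  proof (rule Suc.IH)
    show "disjoint_family_on ?B {..<2 ^ l}"
      using Suc.prems(3) unfolding disjoint_family_on_def lt by simp
  qed (use Suc.prems lt in auto)
  have split: "i < 2 ^ Suc l \<longleftrightarrow> i < 2 ^ l \<or> (\<exists>j<2 ^ l. i = 2 ^ l + j)" for i :: nat
    by (auto simp: lt intro: le_Suc_ex[OF leI, THEN exE])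
  have dj: "A i \<inter> A (2 ^ l + j) = {}" if "i < 2 ^ l" "j < 2 ^ l" for i j
    using Suc.prems(3) that unfolding disjoint_family_on_def lt by simp
  have "run dvd_cap (double ((double ^^ l) cs)) ((\<Union>i<2 ^ l. A i) \<union> (\<Union>i<2 ^ l. ?B i)) X
     (\<lambda>Y. (\<forall>i<2 ^ l. \<Phi> i Y) \<and> (\<forall>i<2 ^ l. ?\<Psi> i Y))"
  proof (rule run_double[OF R1 R2])
    show "(\<Union>i<2 ^ l. A i) \<inter> (\<Union>i<2 ^ l. ?B i) = {}" using dj by auto
    show "hereditary (\<lambda>Y. \<forall>i<2 ^ l. \<Phi> i Y)" "hereditary (\<lambda>Y. \<forall>i<2 ^ l. ?\<Psi> i Y)"
      by (rule hereditary_all_less, use Suc.prems(2) lt in simp)+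
  qed
  moreover have "(\<Union>i<2 ^ l. A i) \<union> (\<Union>i<2 ^ l. ?B i) = (\<Union>i<2 ^ Suc l. A i)"
    using split by auto
  moreover have "((\<forall>i<2 ^ l. \<Phi> i Y) \<and> (\<forall>i<2 ^ l. ?\<Psi> i Y)) = (\<forall>i<2 ^ Suc l. \<Phi> i Y)" for Y
    using split by auto
  ultimately show ?case by simp
qed

text \<open>Guests board greedily: each query of capacity at least \<open>b\<close> carries the next
  one while any are left, and the other queries idle.\<close>

lemma run_host:
  assumes "run small_cap (replicate m b) D X \<Phi>" "hereditary \<Phi>"
    "m \<le> length (filter (\<lambda>s. b \<le> s) cs)"
  shows "run small_cap cs D X \<Phi>"
  using assms(1,3)
proof (induction cs arbitrary: m X)
  case Nil
  then show ?case by simp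
next
  case (Cons s cs)
  show ?case
  proof (cases "b \<le> s \<and> m > 0")
    case True
    then obtain m' where m: "m = Suc m'" using gr0_implies_Suc by blast
    have "run small_cap (b # replicate m' b) D X \<Phi>" using Cons.prems(1) by (simp add: m)
    then show ?thesis
    proof (rule runE)
      fix f assume f: "f \<in> queries D" "\<And>x y. x \<in> X \<Longrightarrow> y \<in> X \<Longrightarrow> small_cap b (f x - f y)"
        "\<And>a. run small_cap (replicate m' b) D {x\<in>X. f x = a} \<Phi>"
      have le: "(2::int) ^ b \<le> 2 ^ s" using True by (simp add: power_increasing)
      show ?thesis
      proof (rule runI[OF f(1)])
        show "run small_cap cs D {x\<in>X. f x = a} \<Phi>" for a
          by (rule Cons.IH[OF f(3)]) (use Cons.prems(2) True m in simp)
        show "small_cap s (f x - f y)" if "x \<in> X" "y \<in> X" for x y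
          using f(2)[OF that] le unfolding small_cap_def by linarith
      qed
    qed
  next
    case False
    have "run small_cap cs D X \<Phi>"
      by (rule Cons.IH[OF Cons.prems(1)]) (use Cons.prems(2) False in \<open>auto split: if_splits\<close>)
    then show ?thesis by (intro run_skip assms(2)) simp_all
  qed
qed

lemma run_many:
  assumes "\<And>i. i < m \<Longrightarrow> run C (replicate t b) (A i) X (\<Phi> i)" "\<And>i. i < m \<Longrightarrow> hereditary (\<Phi> i)"
  shows "run C (replicate (m * t) b) (\<Union>i<m. A i) X (\<lambda>Y. \<forall>i<m. \<Phi> i Y)"
  using assms
proof (induction m)
  case (Suc m)
  have R: "run C (replicate (m * t) b) (\<Union>i<m. A i) X (\<lambda>Y. \<forall>i<m. \<Phi> i Y)"
    by (rule Suc.IH) (use Suc.prems in auto)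
  have her: "hereditary (\<lambda>Y. \<forall>i<m. \<Phi> i Y)"
    by (rule hereditary_all_less) (use Suc.prems(2) in simp)
  have "run C (replicate t b @ replicate (m * t) b) (A m \<union> (\<Union>i<m. A i)) X (\<lambda>Y. \<Phi> m Y \<and> (\<forall>i<m. \<Phi> i Y))"
    by (rule run_conj[OF _ R _ her]) (use Suc.prems in auto)
  moreover have "(\<Phi> m Y \<and> (\<forall>i<m. \<Phi> i Y)) = (\<forall>i<Suc m. \<Phi> i Y)" for Y
    by (auto simp: less_Suc_eq)
  ultimately show ?case by (simp add: lessThan_Suc replicate_add)
qed simp

text \<open>On a narrow set every query is a guest of capacity \<open>b\<close>, so a strategy there
  can be hosted whatever it asks.\<close>

definition narrow :: "nat \<Rightarrow> 'p set \<Rightarrow> bool" where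
  "narrow b A \<longleftrightarrow> (\<forall>f\<in>queries A. \<forall>x y. small_cap b (f x - f y))"

lemma run_parallel_block:
  assumes b: "b \<ge> 1"
    and "\<And>i. i < par_size b s \<Longrightarrow> run dvd_cap (replicate t 0) (A i) X (\<Phi> i)"
    "\<And>i. i < par_size b s \<Longrightarrow> narrow b (A i)" "\<And>i. i < par_size b s \<Longrightarrow> hereditary (\<Phi> i)"
    "disjoint_family_on A {..<par_size b s}"
  shows "run dvd_cap (replicate (t * 2 ^ (4 * b * s)) 0) (\<Union>i<par_size b s. A i) X
    (\<lambda>Y. \<forall>i<par_size b s. \<Phi> i Y)"
  using assms(2-)
proof (induction s arbitrary: A \<Phi>)
  case 0
  show ?case by (rule run_idle) (simp_all add: hereditary_const)
next
  case (Suc s)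
  define u where "u = par_size b s"
  define K :: nat where "K = 2 ^ (4 * b)"
  define m :: nat where "m = 2 ^ (4 * b - 2) * 2 ^ (4 * b * s)"
  have size: "par_size b (Suc s) = K * u + m" by (simp add: u_def K_def m_def)
  have idx: "g * u + i < K * u" if "g < K" "i < u" for g i
  proof -
    have "g * u + i < Suc g * u" using that by simp
    also have "\<dots> \<le> K * u" using that by (intro mult_le_mono1) simp
    finally show ?thesis .
  qed
  have inj: "g = h \<and> i = j" if "g * u + i = h * u + j" "i < u" "j < u" for g h i j
  proof -
    have "g = h" using arg_cong[OF that(1), of "\<lambda>n. n div u"] that(2,3) by simp
    then show ?thesis using that(1) by simp
  qed
  have disj: "A i \<inter> A j = {}" if "i < K * u + m" "j < K * u + m" "i \<noteq> j" for i j
    using Suc.prems(4) that unfolding size disjoint_family_on_def by simp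
  let ?cs = "replicate (t * 2 ^ (4 * b * s)) (0::nat)"
  define A1 where "A1 g = (\<Union>i<u. A (g * u + i))" for g
  define \<Phi>1 where "\<Phi>1 g = (\<lambda>Y. \<forall>i<u. \<Phi> (g * u + i) Y)" for g
  have "run dvd_cap ?cs (A1 g) X (\<Phi>1 g)" if g: "g < K" for g
    unfolding A1_def \<Phi>1_def u_def
  proof (rule Suc.IH; fold u_def)
    show "disjoint_family_on (\<lambda>i. A (g * u + i)) {..<u}"
      unfolding disjoint_family_on_def using disj idx[OF g] by (metis add_left_cancel lessThan_iff trans_less_add1)
  qed (use idx[OF g] Suc.prems(1-3) size in \<open>simp_all add: trans_less_add1\<close>)
  moreover have her1: "hereditary (\<Phi>1 g)" if g: "g < K" for g
    unfolding \<Phi>1_def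
    by (rule hereditary_all_less) (use idx[OF g] Suc.prems(3) size in \<open>simp add: trans_less_add1\<close>)
  moreover have "disjoint_family_on A1 {..<K}"
    unfolding disjoint_family_on_def
  proof (intro ballI impI)
    fix g h assume gh: "g \<in> {..<K}" "h \<in> {..<K}" "g \<noteq> h"
    have "A (g * u + i) \<inter> A (h * u + j) = {}" if "i < u" "j < u" for i j
      using disj[of "g * u + i" "h * u + j"] idx[of g i] idx[of h j] gh inj[of g i h j] that
      by fastforce
    then show "A1 g \<inter> A1 h = {}" unfolding A1_def by blast
  qed
  ultimately have R1: "run dvd_cap ((double ^^ (4 * b)) ?cs) (\<Union>g<K. A1 g) X (\<lambda>Y. \<forall>g<K. \<Phi>1 g Y)"
    unfolding K_def by (intro run_double_iter)
  have "run small_cap (replicate t b) (A (K * u + i)) X (\<Phi> (K * u + i))" if "i < m" for i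
    by (rule run_weaken[OF _ Suc.prems(1)])
      (use Suc.prems(2)[of "K * u + i"] that size in \<open>auto simp: list_all2_conv_all_nth narrow_def\<close>)
  then have "run small_cap (replicate (m * t) b) (\<Union>i<m. A (K * u + i)) X (\<lambda>Y. \<forall>i<m. \<Phi> (K * u + i) Y)"
    by (rule run_many) (use Suc.prems(3) size in simp_all)
  moreover have her2: "hereditary (\<lambda>Y. \<forall>i<m. \<Phi> (K * u + i) Y)"
    by (rule hereditary_all_less) (use Suc.prems(3) size in simp)
  moreover have "m * t \<le> length (filter (\<lambda>s. b \<le> s) ((double ^^ (4 * b)) ?cs))"
  proof -
    \<comment> \<open>The guests take exactly a quarter of all queries, the share that
      \<open>quarter_of_double_iter\<close> guarantees.\<close>
    have "4 * (m * t) = 2 ^ (4 * b) * (t * 2 ^ (4 * b * s))"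
      unfolding four_power[OF b, symmetric] m_def by (simp add: algebra_simps)
    also have "\<dots> \<le> 4 * length (filter (\<lambda>s. b \<le> s) ((double ^^ (4 * b)) ?cs))"
      by (rule quarter_of_double_iter[OF b])
    finally show ?thesis by simp
  qed
  ultimately have R2: "run small_cap ((double ^^ (4 * b)) ?cs) (\<Union>i<m. A (K * u + i)) X
      (\<lambda>Y. \<forall>i<m. \<Phi> (K * u + i) Y)"
    by (rule run_host)
  have dA: "(\<Union>g<K. A1 g) \<inter> (\<Union>i<m. A (K * u + i)) = {}"
  proof -
    have "A (g * u + i) \<inter> A (K * u + j) = {}" if "g < K" "i < u" "j < m" for g i j
      using disj[of "g * u + i" "K * u + j"] idx[OF that(1,2)] that(3) by simp
    then show ?thesis unfolding A1_def by blast
  qed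
  have split: "i < K * u + m \<longleftrightarrow> (\<exists>g<K. \<exists>j<u. i = g * u + j) \<or> (\<exists>j<m. i = K * u + j)" for i
  proof
    assume i: "i < K * u + m"
    show "(\<exists>g<K. \<exists>j<u. i = g * u + j) \<or> (\<exists>j<m. i = K * u + j)"
    proof (cases "i < K * u")
      case True
      then have "u > 0" by (cases u) auto
      then have "i div u < K" "i mod u < u" "i = i div u * u + i mod u"
        using True by (auto simp: less_mult_imp_div_less)
      then show ?thesis by blast
    next
      case False
      then have "i = K * u + (i - K * u)" "i - K * u < m" using i by auto
      then show ?thesis by blast
    qed
  qed (use idx in \<open>auto intro: trans_less_add1\<close>)
  have "run dvd_cap (replicate (length ((double ^^ (4 * b)) ?cs)) 0)
     ((\<Union>g<K. A1 g) \<union> (\<Union>i<m. A (K * u + i))) X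
     (\<lambda>Y. (\<forall>g<K. \<Phi>1 g Y) \<and> (\<forall>i<m. \<Phi> (K * u + i) Y))"
    by (rule run_piggyback[OF R1 R2 dA hereditary_all_less her2]) (rule her1)
  moreover have "(\<Union>g<K. A1 g) \<union> (\<Union>i<m. A (K * u + i)) = (\<Union>i<K * u + m. A i)"
    unfolding A1_def using split by (auto 0 4)
  moreover have "((\<forall>g<K. \<Phi>1 g Y) \<and> (\<forall>i<m. \<Phi> (K * u + i) Y)) = (\<forall>i<K * u + m. \<Phi> i Y)" for Y
    unfolding \<Phi>1_def using split by (auto 0 4)
  moreover have "length ((double ^^ (4 * b)) ?cs) = t * 2 ^ (4 * b * Suc s)"
    by (simp only: length_double_iter length_replicate power_add mult_Suc_right mult.left_commute)
  ultimately show ?case unfolding size by simp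
qed

text \<open>Blocks of \<open>par_size b s\<close> strategies run in sequence; the last one, which is
  the \<open>+ 1\<close>, is filled up with empty strategies.\<close>

lemma run_parallel:
  assumes b: "b \<ge> 1" and s: "s \<ge> 1"
    and procs: "\<And>i. i < N \<Longrightarrow> run dvd_cap (replicate t 0) (A i) X (\<Phi> i)"
    "\<And>i. i < N \<Longrightarrow> narrow b (A i)" "\<And>i. i < N \<Longrightarrow> hereditary (\<Phi> i)"
    "disjoint_family_on A {..<N}"
  shows "run dvd_cap (replicate ((N div par_size b s + 1) * (t * 2 ^ (4 * b * s))) 0)
    (\<Union>i<N. A i) X (\<lambda>Y. \<forall>i<N. \<Phi> i Y)"
proof -
  define u where "u = par_size b s"
  have "4 * u > 0" using par_size_eq[OF b, of s] s by (simp add: u_def)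
  then have u: "u > 0" by simp
  define A' where "A' i = (if i < N then A i else {})" for i
  define \<Phi>' where "\<Phi>' i = (if i < N then \<Phi> i else (\<lambda>_. True))" for i
  define q where "q = N div u + 1"
  have nar: "narrow b {}"
  proof -
    have "f x = 0" if "f \<in> queries {}" for f x
      using that by (elim queriesE) simp
    then show ?thesis unfolding narrow_def by (metis diff_self small_cap_zero)
  qed
  have her: "hereditary (\<Phi>' i)" for i using procs(3) by (simp add: \<Phi>'_def hereditary_const)
  have "run dvd_cap (replicate (q * (t * 2 ^ (4 * b * s))) 0) (\<Union>g<q. \<Union>i<u. A' (g * u + i)) X
     (\<lambda>Y. \<forall>g<q. \<forall>i<u. \<Phi>' (g * u + i) Y)"
  proof (rule run_many)
    fix g assume "g < q"
    show "run dvd_cap (replicate (t * 2 ^ (4 * b * s)) 0) (\<Union>i<u. A' (g * u + i)) X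
       (\<lambda>Y. \<forall>i<u. \<Phi>' (g * u + i) Y)"
      unfolding u_def
    proof (rule run_parallel_block[OF b]; fold u_def)
      show "run dvd_cap (replicate t 0) (A' (g * u + i)) X (\<Phi>' (g * u + i))" for i
        using procs(1) by (auto simp: A'_def \<Phi>'_def intro: run_idle hereditary_const)
      show "narrow b (A' (g * u + i))" for i using procs(2) nar by (simp add: A'_def)
      show "disjoint_family_on (\<lambda>i. A' (g * u + i)) {..<u}"
        using procs(4) unfolding disjoint_family_on_def A'_def by simp
    qed (rule her)
    show "hereditary (\<lambda>Y. \<forall>i<u. \<Phi>' (g * u + i) Y)"
      by (rule hereditary_all_less) (rule her)
  qed
  then have R: "run dvd_cap (replicate (q * (t * 2 ^ (4 * b * s))) 0) (\<Union>i<N. A i) X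
     (\<lambda>Y. \<forall>g<q. \<forall>i<u. \<Phi>' (g * u + i) Y)"
    by (rule run_support) (auto simp: A'_def split: if_splits)
  show ?thesis
    unfolding u_def[symmetric] q_def[symmetric]
    using R
  proof (rule run_imp)
    fix Y assume Y: "\<forall>g<q. \<forall>i<u. \<Phi>' (g * u + i) Y"
    show "\<forall>i<N. \<Phi> i Y"
    proof (intro allI impI)
      fix i assume i: "i < N"
      have "i div u < q" using i u by (simp add: q_def div_le_mono less_Suc_eq_le)
      moreover have "i mod u < u" using u by simp
      ultimately have "\<Phi>' (i div u * u + i mod u) Y" using Y by blast
      then show "\<Phi> i Y" using i by (simp add: \<Phi>'_def)
    qed
  qed
qed

end

section \<open>The choice of the depth and the logarithmic saving\<close>

lemma half_le_ln_2: "1 / 2 \<le> ln (2::real)"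
  using ln_le_minus_one[of "1 / 2 :: real"] by (simp add: ln_div)

lemma list_all2_replicate_zero:
  "list_all2 (\<lambda>s s'. \<forall>f\<in>F. \<forall>x y. dvd_cap s (f x - f y) \<longrightarrow> dvd_cap s' (f x - f y)) cs
     (replicate (length cs) 0)"
  by (auto simp: list_all2_conv_all_nth dvd_cap_def)

context atoms
begin

lemma run_forget:
  assumes "run dvd_cap cs A X \<Phi>"
  shows "run dvd_cap (replicate (length cs) 0) A X \<Phi>"
  by (rule run_weaken[OF list_all2_replicate_zero assms])

text \<open>A depth \<open>s\<close> of about \<open>L / (8 * b)\<close> keeps
  \<open>R = 2 ^ (4 * b * s)\<close> below \<open>sqrt N\<close>, so the additional block is cheap
  (at most \<open>4 * b * N / L\<close>), while the full blocks cost at most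
  \<open>4 * N / s\<close>, that is \<open>64 * b * N / L\<close>, all up to the factor
  \<open>t\<close>. Hence the 68.\<close>

lemma run_parallel_log:
  assumes N: "N \<ge> 2" and b: "b \<ge> 1"
    and procs: "\<And>i. i < N \<Longrightarrow> run dvd_cap (replicate t 0) (A i) X (\<Phi> i)"
    "\<And>i. i < N \<Longrightarrow> narrow b (A i)" "\<And>i. i < N \<Longrightarrow> hereditary (\<Phi> i)"
    "disjoint_family_on A {..<N}"
  obtains T where "real T \<le> 68 * real t * real b * (real N / ln (real N))"
    "run dvd_cap (replicate T 0) (\<Union>i<N. A i) X (\<lambda>Y. \<forall>i<N. \<Phi> i Y)"
proof -
  define L where "L = log 2 (real N)"
  note ln2 = half_le_ln_2 ln_2_less_1
  have lnN: "ln (real N) > 0" using N by simp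
  have L_ln: "ln (real N) \<le> L"
  proof -
    have "ln (real N) * ln 2 \<le> ln (real N)" using ln2 lnN by simp
    then show ?thesis unfolding L_def log_def using ln2 by (simp add: pos_le_divide_eq)
  qed
  have L0: "L > 0" using L_ln lnN by linarith
  have goal: "x \<le> 68 * real t * real b * (real N / ln (real N))"
    if "x \<le> 68 * real t * real b * (real N / L)" for x
  proof -
    have "real N / L \<le> real N / ln (real N)"
      by (rule divide_left_mono) (use L_ln lnN L0 in simp_all)
    then have "68 * real t * real b * (real N / L) \<le> 68 * real t * real b * (real N / ln (real N))"
      by (rule mult_left_mono) simp
    then show ?thesis using that by linarith
  qed
  define s where "s = nat \<lfloor>L / (8 * real b)\<rfloor>"
  show thesis
  proof (cases "s = 0")
    \<comment> \<open>Here \<open>N\<close> is so small compared with \<open>b\<close> that running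
      the strategies one after another stays within the bound.\<close>
    case True
    then have "L / (8 * real b) < 1" by (simp add: s_def)
    then have "L < 8 * real b" using b by (simp add: field_simps)
    then have "1 \<le> 68 * real b / L" using L0 by (simp add: field_simps)
    then have "real (N * t) * 1 \<le> real (N * t) * (68 * real b / L)" by (rule mult_left_mono) simp
    then have "real (N * t) \<le> 68 * real t * real b * (real N / L)" by (simp add: algebra_simps)
    then show thesis
      using run_many[of N dvd_cap t 0 A X \<Phi>] procs(1,3) by (intro that[of "N * t"] goal) auto
  next
    case False
    then have s1: "s \<ge> 1" by simp
    have rs: "real s \<le> L / (8 * real b)" "L / (8 * real b) < real s + 1"
      using False by (auto simp: s_def)
    define R :: nat where "R = 2 ^ (4 * b * s)"
    define u where "u = par_size b s"
    have u: "4 * u = s * R" unfolding u_def R_def by (rule par_size_eq[OF b])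
    have R0: "R > 0" by (simp add: R_def)
    then have u0: "u > 0" using u s1 by (metis bot_nat_0.not_eq_extremum mult_is_0 not_one_le_zero)
    have "real R = 2 powr (4 * real b * real s)"
      unfolding R_def by (simp add: powr_realpow[symmetric])
    also have "\<dots> \<le> 2 powr (L / 2)"
      using rs(1) b by (intro powr_mono) (simp_all add: field_simps)
    also have "\<dots> = sqrt (real N)"
      using N by (simp add: L_def powr_half_sqrt[symmetric] powr_powr[symmetric] flip: powr_powr)
        (simp add: powr_def log_def)
    finally have RN: "real R \<le> sqrt (real N)" .
    have "L \<le> 4 * sqrt (real N)"
    proof -
      have "ln (real N) = 2 * ln (sqrt (real N))" using N by (simp add: ln_sqrt)
      also have "\<dots> \<le> 2 * sqrt (real N)" using N by (simp add: ln_bound)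
      also have "\<dots> \<le> 4 * sqrt (real N) * ln 2" using ln2(1) mult_left_mono[OF ln2(1), of "4 * sqrt (real N)"] by simp
      finally show ?thesis unfolding L_def log_def using ln2 by (simp add: pos_divide_le_eq)
    qed
    then have "sqrt (real N) * L \<le> sqrt (real N) * (4 * sqrt (real N))"
      by (rule mult_left_mono) simp
    also have "\<dots> = 4 * (sqrt (real N) * sqrt (real N))" by (simp only: mult.left_commute)
    also have "\<dots> = 4 * real N" by simp
    finally have "sqrt (real N) \<le> 4 * (real N / L)" using L0 by (simp add: pos_le_divide_eq)
    then have "real R \<le> 1 * (4 * (real N / L))" using RN by linarith
    also have "\<dots> \<le> real b * (4 * (real N / L))"
      by (rule mult_right_mono) (use b L0 in simp_all)
    finally have R4: "real R \<le> 4 * (real b * (real N / L))" by (simp only: mult.left_commute)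
    have "L \<le> 16 * real b * real s"
    proof -
      have "L / (8 * real b) \<le> 2 * real s" using rs(2) s1 by simp
      then show ?thesis using b by (simp add: field_simps)
    qed
    then have s_inv: "1 / real s \<le> 16 * real b / L" using s1 L0 by (simp add: field_simps)
    have "real (N div u) * real R \<le> (real N / real u) * real R"
      by (rule mult_right_mono) (use real_of_nat_div[of N u] of_nat_div_le_of_nat[of N u] in \<open>simp_all\<close>)
    also have "\<dots> = 4 * real N * (1 / real s)"
    proof -
      have "4 * real u = real s * real R" using u by (metis of_nat_mult of_nat_numeral)
      then show ?thesis using u0 s1 R0 by (simp add: field_simps)
    qed
    also have "\<dots> \<le> 4 * real N * (16 * real b / L)"
      by (rule mult_left_mono[OF s_inv]) simp
    also have "\<dots> = 64 * (real b * (real N / L))" by simp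
    finally have *: "real (N div u) * real R \<le> 64 * (real b * (real N / L))" .
    have "x + r \<le> 68 * y" if "x \<le> 64 * y" "r \<le> 4 * y" for x r y :: real
      using that by linarith
    from this[OF * R4]
    have "real (N div u) * real R + real R \<le> 68 * (real b * (real N / L))" .
    then have "real t * (real (N div u) * real R + real R) \<le> real t * (68 * (real b * (real N / L)))"
      by (rule mult_left_mono) simp
    also have "\<dots> = 68 * real t * real b * (real N / L)" by simp
    finally have "real ((N div u + 1) * (t * R)) \<le> 68 * real t * real b * (real N / L)"
      by (simp add: algebra_simps)
    then show thesis
      using run_parallel[OF b s1 procs] unfolding u_def R_def by (intro that goal)
  qed
qed

lemma narrow_card:
  assumes "\<And>p c x. c \<in> U \<Longrightarrow> \<bar>e p c x\<bar> \<le> 1" "finite A" "2 * card A < 2 ^ b"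
  shows "narrow b A"
  unfolding narrow_def
proof (intro ballI allI)
  fix f x y assume f: "f \<in> queries A"
  have "\<bar>f z\<bar> \<le> int (card A)" for z
  proof -
    obtain F s q where F: "finite F" "F \<subseteq> A" "\<forall>p\<in>F. s p = 1 \<or> s p = -1"
      "\<forall>p\<in>F. q p \<in> U" "\<forall>x. f x = (\<Sum>p\<in>F. s p * e p (q p) x)"
      by (rule queriesE[OF f]) (rule that, assumption+)
    have "\<bar>f z\<bar> \<le> (\<Sum>p\<in>F. \<bar>s p * e p (q p) z\<bar>)" using F(5) by (simp add: sum_abs)
    also have "\<dots> \<le> (\<Sum>p\<in>F. 1)"
    proof (rule sum_mono)
      fix p assume p: "p \<in> F"
      have "\<bar>s p\<bar> = 1" using F(3) p by auto
      then show "\<bar>s p * e p (q p) z\<bar> \<le> 1" using assms(1)[of "q p" p z] F(4) p by (simp add: abs_mult)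
    qed
    also have "\<dots> \<le> int (card A)" using card_mono[OF assms(2) F(2)] by simp
    finally show ?thesis .
  qed
  from this[of x] this[of y] have "\<bar>f x - f y\<bar> \<le> int (2 * card A)" by simp
  also have "\<dots> < 2 ^ b" using assms(3) by (metis of_nat_less_iff of_nat_numeral of_nat_power)
  finally show "small_cap b (f x - f y)" by (simp add: small_cap_def)
qed

end

section \<open>Strategies for Codebreaker\<close>

text \<open>The counterpart of \<open>run\<close> for real queries: a game tree over the sets of
  remaining secrets.\<close>

fun game :: "nat \<Rightarrow> nat \<Rightarrow> nat \<Rightarrow> word set \<Rightarrow> (word set \<Rightarrow> bool) \<Rightarrow> bool" where
  "game n k 0 X \<Phi> = \<Phi> X"
| "game n k (Suc t) X \<Phi> = (\<exists>q\<in>words n k. \<forall>a. game n k t {x\<in>X. answer n x q = a} \<Phi>)"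

lemma game_mono:
  assumes "hereditary \<Phi>" "game n k t X \<Phi>" "Y \<subseteq> X"
  shows "game n k t Y \<Phi>"
  using assms(2,3)
proof (induction t arbitrary: X Y)
  case 0
  then show ?case using hereditaryD[OF assms(1)] by simp
next
  case (Suc t)
  from Suc.prems(1) obtain q where q: "q \<in> words n k" "\<And>a. game n k t {x\<in>X. answer n x q = a} \<Phi>"
    by auto
  have "game n k t {x\<in>Y. answer n x q = a} \<Phi>" for a
    by (rule Suc.IH[OF q(2)[of a]]) (use Suc.prems(2) in blast)
  then show ?case using q(1) by auto
qed

lemma game_seq:
  assumes "game n k t X \<Phi>" "\<And>Y. Y \<subseteq> X \<Longrightarrow> \<Phi> Y \<Longrightarrow> game n k u Y \<Psi>"
  shows "game n k (t + u) X \<Psi>"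
  using assms
proof (induction t arbitrary: X)
  case (Suc t)
  from Suc.prems(1) obtain q where q: "q \<in> words n k" "\<And>a. game n k t {x\<in>X. answer n x q = a} \<Phi>"
    by auto
  have "game n k (t + u) {x\<in>X. answer n x q = a} \<Psi>" for a
    by (rule Suc.IH[OF q(2)]) (rule Suc.prems(2), auto)
  then show ?case using q(1) by auto
qed simp

lemma game_imp:
  assumes "game n k t X \<Phi>" "\<And>Y. Y \<subseteq> X \<Longrightarrow> \<Phi> Y \<Longrightarrow> \<Psi> Y"
  shows "game n k t X \<Psi>"
  using game_seq[OF assms(1), of 0 \<Psi>] assms(2) by simp

lemma words_nonempty: "k \<ge> 1 \<Longrightarrow> words n k \<noteq> {}"
  by (simp add: words_def PiE_eq_empty_iff)

lemma game_more:
  assumes "hereditary \<Phi>" "k \<ge> 1" "game n k t X \<Phi>" "t \<le> u"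
  shows "game n k u X \<Phi>"
proof -
  have idle: "game n k d Y \<Phi>" if "\<Phi> Y" for d Y
    using that
  proof (induction d arbitrary: Y)
    case (Suc d)
    obtain q where "q \<in> words n k" using words_nonempty[OF assms(2)] by blast
    moreover have "game n k d {x\<in>Y. answer n x q = a} \<Phi>" for a
      by (rule Suc.IH[OF hereditaryD[OF assms(1) Suc.prems]]) blast
    ultimately show ?case by auto
  qed simp
  have "game n k (t + (u - t)) X \<Phi>"
    using assms(3) by (rule game_seq) (rule idle)
  then show ?thesis using assms(4) by simp
qed

lemma consistent_snoc:
  "consistent n k (h @ [(q, a)]) = {x \<in> consistent n k h. answer n x q = a}"
  by (auto simp: consistent_def)

text \<open>A good move depends on the remaining candidates and the number of queries left. The
  history determines both, so choosing a good move for each history turns the game tree into a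
  strategy.\<close>

lemma min_queries_le:
  assumes "k \<ge> 1" "game n k T (words n k) (det (\<lambda>x. x))"
  shows "min_queries n k \<le> T"
proof -
  define P where "P h q \<longleftrightarrow> q \<in> words n k \<and>
     (\<forall>a. game n k (T - Suc (length h)) {x \<in> consistent n k h. answer n x q = a} (det (\<lambda>x. x)))" for h q
  obtain w where w: "w \<in> words n k" using words_nonempty[OF assms(1)] by blast
  \<comment> \<open>Histories off the play may have no good move; a strategy must respond to them
    too, by the arbitrary word \<open>w\<close>.\<close>
  define s where "s h = (if \<exists>q. P h q then SOME q. P h q else w)" for h
  have sP: "P h (s h)" if "P h q" for h q
    using that someI[of "P h" q] by (auto simp: s_def)
  have strat: "s \<in> strategies n k"
    unfolding strategies_def
  proof (intro CollectI allI)
    fix h show "s h \<in> words n k"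
    proof (cases "\<exists>q. P h q")
      case True
      then have "P h (s h)" using sP by blast
      then show ?thesis by (simp add: P_def)
    qed (simp add: s_def w)
  qed
  have inv: "game n k (T - t) (consistent n k (play n s x t)) (det (\<lambda>x. x))" if "t \<le> T" for x t
    using that
  proof (induction t)
    case 0
    then show ?case using assms(2) by (simp add: consistent_def)
  next
    case (Suc t)
    let ?h = "play n s x t"
    have "game n k (Suc (T - Suc t)) (consistent n k ?h) (det (\<lambda>x. x))"
      using Suc by (simp add: Suc_diff_Suc)
    then obtain q where "P ?h q" unfolding P_def by auto
    then have "P ?h (s ?h)" by (rule sP)
    then have "game n k (T - Suc t) {y \<in> consistent n k ?h. answer n y (s ?h) = answer n x (s ?h)} (det (\<lambda>x. x))"
      unfolding P_def length_play by blast
    then show ?case by (simp add: Let_def consistent_snoc)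
  qed
  have "solves_within n k s T"
    unfolding solves_within_def
  proof
    fix x assume x: "x \<in> words n k"
    have "det (\<lambda>x. x) (consistent n k (play n s x T))" using inv[of T x] by simp
    moreover have "x \<in> consistent n k (play n s x T)"
      using x by (auto simp: consistent_def set_play)
    ultimately have "consistent n k (play n s x T) = {x}" by (auto simp: det_def)
    then show "\<exists>t\<le>T. consistent n k (play n s x t) = {x}" by blast
  qed
  then show ?thesis unfolding min_queries_def using strat by (intro Least_le) blast
qed

text \<open>A signed query becomes two real ones, because it is a difference of two peg counts. The
  premise \<open>sim\<close> asks only that the two answers determine \<open>f\<close> on
  \<open>X\<close>, which lets the simulation rely on what is already known.\<close>

lemma game_of_run:
  fixes e :: "'p \<Rightarrow> 'c \<Rightarrow> word \<Rightarrow> int"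
  assumes "atoms.run e U C cs A X \<Phi>" "hereditary \<Phi>"
    and sim: "\<And>f. f \<in> atoms.queries e U A \<Longrightarrow> \<exists>q\<in>words n k. \<exists>q'\<in>words n k. \<forall>x\<in>X. \<forall>y\<in>X.
       answer n x q = answer n y q \<longrightarrow> answer n x q' = answer n y q' \<longrightarrow> f x = f y"
  shows "game n k (2 * length cs) X \<Phi>"
  using assms(1,3)
proof (induction cs arbitrary: X)
  case Nil
  then show ?case by (simp add: atoms.run.simps)
next
  case (Cons s cs)
  from Cons.prems(1) show ?case
  proof (rule atoms.runE)
    fix f assume f: "f \<in> atoms.queries e U A"
      "\<And>a. atoms.run e U C cs A {x\<in>X. f x = a} \<Phi>"
    from Cons.prems(2)[OF f(1)] obtain q q' where q: "q \<in> words n k" "q' \<in> words n k"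
      "\<forall>x\<in>X. \<forall>y\<in>X. answer n x q = answer n y q \<longrightarrow> answer n x q' = answer n y q' \<longrightarrow> f x = f y"
      by blast
    have "game n k (2 * length cs) {x \<in> {x\<in>X. answer n x q = a}. answer n x q' = a'} \<Phi>" (is "game n k _ ?Y \<Phi>")
      for a a'
    proof -
      \<comment> \<open>The two answers fix the value of \<open>f\<close>; an impossible pair of
        answers leaves \<open>?Y\<close> empty, and then 0 will do.\<close>
      obtain v where v: "?Y \<subseteq> {x\<in>X. f x = v}"
      proof (cases "?Y = {}")
        case False
        then obtain z where z: "z \<in> ?Y" by blast
        have "f x = f z" if "x \<in> ?Y" for x
        proof -
          have "x \<in> X" "z \<in> X" "answer n x q = answer n z q" "answer n x q' = answer n z q'"
            using that z by auto
          then show ?thesis using q(3) by blast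
        qed
        then show thesis by (intro that[of "f z"]) blast
      qed (rule that[of 0], blast)
      have "game n k (2 * length cs) {x\<in>X. f x = v} \<Phi>"
        by (rule Cons.IH[OF f(2)]) (use Cons.prems(2) in blast)
      then show ?thesis by (rule game_mono[OF assms(2) _ v])
    qed
    then have "game n k (Suc (Suc (2 * length cs))) X \<Phi>"
      unfolding game.simps using q(1,2) by blast
    then show ?thesis by simp
  qed
qed

section \<open>Black pegs\<close>

lemma bp_sum: "int (bp n x q) = (\<Sum>i\<in>{1..n}. of_bool (x i = q i))"
proof -
  have "(\<Sum>i\<in>{1..n}. of_bool (x i = q i) :: int) = (\<Sum>i | i \<in> {1..n} \<and> x i = q i. 1)"
    unfolding of_bool_def by (rule sum.inter_filter[symmetric]) simp
  then show ?thesis by (simp add: bp_def)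
qed

definition black :: "nat \<Rightarrow> nat \<Rightarrow> word \<Rightarrow> int" where
  "black i c x = of_bool (x i = c)"

text \<open>The effect of replacing the filler 1 by \<open>c\<close> at position \<open>i\<close>.
  It can be negative, so this is used as an instance of \<open>atoms\<close> but not of
  \<open>weighted_atoms\<close>.\<close>

definition relative_black :: "nat \<Rightarrow> nat \<Rightarrow> word \<Rightarrow> int" where
  "relative_black i c x = of_bool (x i = c) - of_bool (x i = 1)"

interpretation black: weighted_atoms black "{1..k}" "\<lambda>_. 1" UNIV for k
proof
  show "(\<Sum>c\<in>{1..k}. black p c x) \<le> int 1" for p x
  proof -
    have "(\<Sum>c\<in>{1..k}. black p c x) = (\<Sum>c\<in>{1..k}. if c = x p then 1 else 0)"
      unfolding black_def of_bool_def by (rule sum.cong) auto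
    then show ?thesis by (simp add: sum.delta)
  qed
qed (simp_all add: black_def)

definition ones_known :: "nat \<Rightarrow> word set \<Rightarrow> bool" where
  "ones_known n X \<longleftrightarrow> (\<forall>i\<in>{1..n}. det (\<lambda>x. x i = 1) X)"

lemma hereditary_ones_known: "hereditary (ones_known n)"
  unfolding ones_known_def[abs_def] by (intro hereditary_ball hereditary_det)

text \<open>A signed partial query is the difference of two full queries that agree, having the filler
  colour 1, wherever the partial query is silent.\<close>

lemma simulate_relative_black:
  assumes "f \<in> atoms.queries relative_black {1..k} A" "A \<subseteq> {1..n}" "k \<ge> 1"
  obtains q q' where "q \<in> words n k" "q' \<in> words n k" "\<And>x. f x = int (bp n x q) - int (bp n x q')"
proof -
  obtain F s q where F: "finite F" "F \<subseteq> A" "\<forall>p\<in>F. s p = 1 \<or> s p = -1"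
    "\<forall>p\<in>F. q p \<in> {1..k}" "\<forall>x. f x = (\<Sum>p\<in>F. s p * relative_black p (q p) x)"
    by (rule atoms.queriesE[OF assms(1)]) (rule that, assumption+)
  have Fn: "F \<subseteq> {1..n}" using F(2) assms(2) by blast
  \<comment> \<open>\<open>w 1\<close> carries the colours of the positive positions and
    \<open>w (-1)\<close> those of the negative ones; where both show the filler, they
    cancel.\<close>
  define w where "w v = (\<lambda>i\<in>{1..n}. if i \<in> F \<and> s i = v then q i else 1)" for v :: int
  have "w v \<in> words n k" for v
    unfolding words_def w_def restrict_PiE_iff using F(4) assms(3) by auto
  moreover have "f x = int (bp n x (w 1)) - int (bp n x (w (-1)))" for x
  proof -
    have "f x = (\<Sum>i\<in>F. of_bool (x i = w 1 i) - of_bool (x i = w (-1) i))"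
      unfolding F(5)[rule_format]
    proof (rule sum.cong)
      fix i assume i: "i \<in> F"
      then have "i \<in> {1..n}" "s i = 1 \<or> s i = -1" using Fn F(3) by auto
      then show "s i * relative_black i (q i) x = of_bool (x i = w 1 i) - of_bool (x i = w (-1) i)"
        using i by (auto simp: w_def relative_black_def)
    qed simp
    also have "\<dots> = (\<Sum>i\<in>{1..n}. of_bool (x i = w 1 i) - of_bool (x i = w (-1) i))"
      by (rule sum.mono_neutral_left) (use Fn in \<open>auto simp: w_def\<close>)
    finally show ?thesis by (simp add: bp_sum sum_subtractf)
  qed
  ultimately show thesis by (intro that[of "w 1" "w (-1)"])
qed

text \<open>The correction from \<open>g\<close> to \<open>f\<close> is a signed count of places of
  colour 1, and these places are the same for all secrets in \<open>X\<close>.\<close>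

lemma simulate_black:
  assumes f: "f \<in> atoms.queries black {1..k} A" and A: "A \<subseteq> {1..n}" and k: "k \<ge> 1"
    and X: "ones_known n X"
  shows "\<exists>q\<in>words n k. \<exists>q'\<in>words n k. \<forall>x\<in>X. \<forall>y\<in>X.
    answer n x q = answer n y q \<longrightarrow> answer n x q' = answer n y q' \<longrightarrow> f x = f y"
proof -
  obtain F s q where F: "finite F" "F \<subseteq> A" "\<forall>p\<in>F. s p = 1 \<or> s p = -1"
    "\<forall>p\<in>F. q p \<in> {1..k}" "\<forall>x. f x = (\<Sum>p\<in>F. s p * black p (q p) x)"
    by (rule atoms.queriesE[OF f]) (rule that, assumption+)
  define g where "g x = (\<Sum>p\<in>F. s p * relative_black p (q p) x)" for x
  have "g \<in> atoms.queries relative_black {1..k} A"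
    by (rule atoms.queriesI[where F = F and s = s and q = q]) (use F in \<open>simp_all add: g_def\<close>)
  then obtain w w' where w: "w \<in> words n k" "w' \<in> words n k" "\<And>x. g x = int (bp n x w) - int (bp n x w')"
    using simulate_relative_black[OF _ A k] by metis
  have diff: "f x - g x = (\<Sum>p\<in>F. s p * of_bool (x p = 1))" for x
    unfolding F(5)[rule_format] g_def sum_subtractf[symmetric]
    by (rule sum.cong) (simp_all add: black_def relative_black_def algebra_simps)
  have "f x = f y" if "x \<in> X" "y \<in> X" "answer n x w = answer n y w" "answer n x w' = answer n y w'" for x y
  proof -
    have "f x - g x = f y - g y"
      unfolding diff
    proof (rule sum.cong)
      fix p assume "p \<in> F"
      then have "p \<in> {1..n}" using F(2) A by blast
      then have "(x p = 1) = (y p = 1)" using X that(1,2) unfolding ones_known_def det_def by blast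
      then show "s p * of_bool (x p = 1) = s p * of_bool (y p = 1)" by simp
    qed simp
    moreover have "g x = g y" using that(3,4) by (simp add: w(3) answer_def)
    ultimately show ?thesis by simp
  qed
  then show ?thesis using w(1,2) by blast
qed

lemma game_black:
  assumes "black.run k C cs {1..n} X \<Phi>" "hereditary \<Phi>" "ones_known n X" "k \<ge> 1"
  shows "game n k (2 * length cs) X \<Phi>"
  by (rule game_of_run[OF assms(1,2)]) (rule simulate_black[OF _ subset_refl assms(4,3)])

lemma solved_black_det:
  assumes "black.solved k {1..n} X" "X \<subseteq> words n k"
  shows "det (\<lambda>x. x) X"
  unfolding det_def
proof (intro ballI)
  fix x y assume xy: "x \<in> X" "y \<in> X"
  then have w: "x \<in> words n k" "y \<in> words n k" using assms(2) by auto
  show "x = y"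
  proof (rule PiE_ext[OF w[unfolded words_def]])
    fix i assume i: "i \<in> {1..n}"
    have "x i \<in> {1..k}" using w(1) i by (auto simp: words_def)
    then have "black i (x i) x = black i (x i) y"
      using assms(1) i xy unfolding black.solved_def det_def by blast
    then show "x i = y i" by (simp add: black_def)
  qed
qed

section \<open>From colour counts to the codeword\<close>

lemma constant_word: "c \<in> {1..k} \<Longrightarrow> (\<lambda>i\<in>{1..n}. c) \<in> words n k"
  by (auto simp: words_def)

lemma bp_constant: "int (bp n x (\<lambda>i\<in>{1..n}. c)) = black.cnt c {1..n} x"
  unfolding bp_sum black.cnt_def black_def by (rule sum.cong) simp_all

lemma game_counts:
  assumes "finite D" "D \<subseteq> {1..k}"
  shows "game n k (card D) X (\<lambda>Y. \<forall>c\<in>D. det (black.cnt c {1..n}) Y)"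
  using assms
proof (induction D arbitrary: X)
  case empty
  then show ?case by simp
next
  case (insert c D)
  let ?q = "\<lambda>i\<in>{1..n}. c"
  have "game n k (card D) {x\<in>X. answer n x ?q = a} (\<lambda>Y. \<forall>c\<in>insert c D. det (black.cnt c {1..n}) Y)" for a
  proof (rule game_imp[OF insert.IH])
    fix Y assume Y: "Y \<subseteq> {x\<in>X. answer n x ?q = a}" "\<forall>c\<in>D. det (black.cnt c {1..n}) Y"
    have "det (black.cnt c {1..n}) Y"
      unfolding det_def bp_constant[symmetric]
    proof (intro ballI)
      fix x y assume "x \<in> Y" "y \<in> Y"
      then have "answer n x ?q = answer n y ?q" using Y(1) by auto
      then show "int (bp n x ?q) = int (bp n y ?q)" by (simp add: answer_def)
    qed
    then show "\<forall>c\<in>insert c D. det (black.cnt c {1..n}) Y" using Y(2) by blast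
  qed (use insert.prems in auto)
  moreover have "?q \<in> words n k" using insert.prems by (intro constant_word) auto
  ultimately have "game n k (Suc (card D)) X (\<lambda>Y. \<forall>c\<in>insert c D. det (black.cnt c {1..n}) Y)"
    unfolding game.simps by blast
  then show ?case using insert.hyps by simp
qed

lemma power4_bracket:
  fixes m :: nat
  assumes "m \<ge> 1"
  obtains j :: nat where "m < 4 ^ j" "4 ^ j \<le> 4 * m"
proof -
  define j where "j = (LEAST j. m < 4 ^ j)"
  have "m < 4 ^ m" by (induction m) auto
  then have 1: "m < 4 ^ j" unfolding j_def by (rule LeastI)
  then have "j \<noteq> 0" using assms by (cases j) auto
  then obtain i where i: "j = Suc i" using not0_implies_Suc by blast
  have "\<not> m < 4 ^ i" using not_less_Least[of i "\<lambda>j. m < 4 ^ j"] i unfolding j_def by simp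
  then show thesis using 1 i by (intro that[of j]) auto
qed

lemma length_ruler_le:
  assumes "(4::nat) ^ j \<le> 4 * m"
  shows "length (ruler (2 * j + 7)) \<le> 512 * m"
proof -
  have "(2::nat) ^ (2 * j + 7) = 128 * 4 ^ j" by (simp add: power_add power_mult)
  then show ?thesis using assms by (simp add: length_ruler)
qed

text \<open>The white answers play no role once the colours of the secret are known to lie in a set
  of at most \<open>n\<close> colours.\<close>

lemma game_known_colours:
  assumes n: "n \<ge> 1" and k: "k \<ge> 1" and X: "X \<subseteq> words n k" "ones_known n X"
    and D: "D \<subseteq> {1..k}" "card D \<le> n" "\<And>x. x \<in> X \<Longrightarrow> x ` {1..n} \<subseteq> D"
  shows "game n k (1025 * n) X (det (\<lambda>x. x))"
proof -
  obtain j where j: "n < 4 ^ j" "4 ^ j \<le> 4 * n" by (rule power4_bracket[OF n])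
  have fin: "finite D" using D(1) finite_subset by blast
  have "game n k (card D + 2 * length (ruler (2 * j + 7))) X (det (\<lambda>x. x))"
    using game_counts[OF fin D(1)]
  proof (rule game_seq)
    fix Y assume Y: "Y \<subseteq> X" "\<forall>c\<in>D. det (black.cnt c {1..n}) Y"
    have "det (black.cnt c {1..n}) Y" if "c \<notin> D" for c
    proof -
      have "black.cnt c {1..n} x = 0" if "x \<in> Y" for x
        unfolding black.cnt_def black_def
        using D(3)[of x] that Y(1) \<open>c \<notin> D\<close> by (intro sum.neutral) auto
      then show ?thesis by (simp add: det_def)
    qed
    then have cY: "black.counted k {1..n} Y" using Y(2) unfolding black.counted_def by blast
    have "black.run k dvd_cap (ruler (2 * j + 7)) {1..n} Y (black.solved k {1..n})"
      by (rule black.run_solve) (use j cY in simp_all)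
    then have "game n k (2 * length (ruler (2 * j + 7))) Y (black.solved k {1..n})"
      by (rule game_black[OF _ black.hereditary_solved hereditaryD[OF hereditary_ones_known X(2) Y(1)] k])
    then show "game n k (2 * length (ruler (2 * j + 7))) Y (det (\<lambda>x. x))"
      by (rule game_imp) (rule solved_black_det, use X(1) Y(1) in auto)
  qed
  \<comment> \<open>\<open>1025 = 1 + 2 * 512\<close>: at most \<open>n\<close> constant queries,
    and two real queries for each of at most \<open>512 * n\<close> signed ones.\<close>
  moreover have "card D + 2 * length (ruler (2 * j + 7)) \<le> 1025 * n"
    using length_ruler_le[OF j(2)] D(2) by linarith
  ultimately show ?thesis by (rule game_more[OF hereditary_det k])
qed

text \<open>At a single position, \<open>relative_black\<close> with colour 2 is -1 exactly if the
  colour is 1. This gives \<open>n\<close> strategies of one query each, whose answers differ by at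
  most 2, so \<open>b = 2\<close> and the constant is \<open>2 * 68 * 2 = 272\<close>.\<close>

lemma game_ones:
  assumes n: "n \<ge> 2" and k: "k \<ge> 2"
  obtains T where "real T \<le> 272 * (real n / ln (real n))" "game n k T X (ones_known n)"
proof -
  let ?A = "\<lambda>i::nat. {Suc i}"
  obtain T where T: "real T \<le> 68 * real 1 * real 2 * (real n / ln (real n))"
    "atoms.run relative_black {1..k} dvd_cap (replicate T 0) (\<Union>i<n. ?A i) X
       (\<lambda>Y. \<forall>i<n. det (relative_black (Suc i) 2) Y)"
  proof (rule atoms.run_parallel_log[where e = relative_black and U = "{1..k}" and N = n and b = 2
        and t = 1 and A = ?A and X = X and \<Phi> = "\<lambda>i. det (relative_black (Suc i) 2)"])
    fix i
    have "relative_black (Suc i) 2 \<in> atoms.queries relative_black {1..k} {Suc i}"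
      using atoms.atom_sum_query[of "{Suc i}" 2 "{1..k}" relative_black] k by simp
    then have "atoms.run relative_black {1..k} dvd_cap [0] {Suc i} X (det (relative_black (Suc i) 2))"
      by (rule atoms.run_single) (simp add: dvd_cap_def)
    then show "atoms.run relative_black {1..k} dvd_cap (replicate 1 0) {Suc i} X (det (relative_black (Suc i) 2))"
      by simp
    show "atoms.narrow relative_black {1..k} 2 {Suc i}"
      by (rule atoms.narrow_card) (simp_all add: relative_black_def)
    show "disjoint_family_on ?A {..<n}" by (auto simp: disjoint_family_on_def)
  qed (use n in \<open>auto intro: hereditary_det\<close>)
  have sub: "(\<Union>i<n. ?A i) \<subseteq> {1..n}" by auto
  have "game n k (2 * length (replicate T (0::nat))) X (\<lambda>Y. \<forall>i<n. det (relative_black (Suc i) 2) Y)"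
  proof (rule game_of_run[OF T(2)])
    show "hereditary (\<lambda>Y. \<forall>i<n. det (relative_black (Suc i) 2) Y)"
      by (intro hereditary_all_less hereditary_det)
    fix f assume "f \<in> atoms.queries relative_black {1..k} (\<Union>i<n. ?A i)"
    then obtain q q' where q: "q \<in> words n k" "q' \<in> words n k" "\<And>x. f x = int (bp n x q) - int (bp n x q')"
      using simulate_relative_black[OF _ sub, of f k] k by (metis Suc_leD numeral_2_eq_2 One_nat_def)
    then show "\<exists>q\<in>words n k. \<exists>q'\<in>words n k. \<forall>x\<in>X. \<forall>y\<in>X.
        answer n x q = answer n y q \<longrightarrow> answer n x q' = answer n y q' \<longrightarrow> f x = f y"
      by (intro bexI[of _ q] bexI[of _ q'] ballI impI) (simp_all add: answer_def)
  qed
  then have "game n k (2 * T) X (\<lambda>Y. \<forall>i<n. det (relative_black (Suc i) 2) Y)"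
    by simp
  then have "game n k (2 * T) X (ones_known n)"
  proof (rule game_imp)
    fix Y assume Y: "\<forall>i<n. det (relative_black (Suc i) 2) Y"
    show "ones_known n Y"
      unfolding ones_known_def
    proof
      fix i assume i: "i \<in> {1..n}"
      then obtain i' where i': "i = Suc i'" "i' < n" by (cases i) auto
      have iff: "x i = 1 \<longleftrightarrow> relative_black i 2 x = -1" for x
        by (auto simp: relative_black_def of_bool_def)
      show "det (\<lambda>x. x i = 1) Y"
        unfolding iff using Y i' unfolding det_def by metis
    qed
  qed
  moreover have "real (2 * T) \<le> 272 * (real n / ln (real n))" using T(1) by simp
  ultimately show thesis by (intro that)
qed

text \<open>Counting \<open>k\<close> colours and running the pipeline take at most
  \<open>k + 512 * k\<close> queries. Capacities are reset to 0, the form in which the parallel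
  scheme accepts strategies.\<close>

lemma run_black_group:
  assumes S: "finite S" "card S \<le> k" and k: "k \<ge> 1"
  obtains t where "t \<le> 513 * k" "black.run k dvd_cap (replicate t 0) S X (black.solved k S)"
proof -
  obtain j where j: "k < 4 ^ j" "4 ^ j \<le> 4 * k" by (rule power4_bracket[OF k])
  have "black.run k dvd_cap (replicate (k * 1) 0) (\<Union>c<k. S) X (\<lambda>Y. \<forall>c<k. det (black.cnt (Suc c) S) Y)"
  proof (rule black.run_many)
    fix c assume "c < k"
    then have "black.cnt (Suc c) S \<in> black.queries k S" by (intro black.cnt_query S) simp
    then have "black.run k dvd_cap [0] S X (det (black.cnt (Suc c) S))"
      by (rule black.run_single) (simp add: dvd_cap_def)
    then show "black.run k dvd_cap (replicate 1 0) S X (det (black.cnt (Suc c) S))" by simp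
  qed (rule hereditary_det)
  then have "black.run k dvd_cap (replicate k 0) S X (\<lambda>Y. \<forall>c<k. det (black.cnt (Suc c) S) Y)"
    using k by (simp add: lessThan_empty_iff)
  then have "black.run k dvd_cap (replicate k 0) S X (black.counted k S)"
  proof (rule black.run_imp)
    fix Y assume Y: "\<forall>c<k. det (black.cnt (Suc c) S) Y"
    show "black.counted k S Y"
      unfolding black.counted_def
    proof
      fix c assume "c \<in> {1..k}"
      then obtain c' where "c = Suc c'" "c' < k" by (cases c) auto
      then show "det (black.cnt c S) Y" using Y by simp
    qed
  qed
  then have "black.run k dvd_cap (replicate k 0 @ replicate (length (ruler (2 * j + 7))) 0) S X (black.solved k S)"
  proof (rule black.run_seq)
    fix Y assume "black.counted k S Y"
    then have "black.run k dvd_cap (ruler (2 * j + 7)) S Y (black.solved k S)"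
      by (intro black.run_solve) (use S j in simp_all)
    then show "black.run k dvd_cap (replicate (length (ruler (2 * j + 7))) 0) S Y (black.solved k S)"
      by (rule black.run_forget)
  qed
  then show thesis
    unfolding replicate_add[symmetric]
    by (intro that[of "k + length (ruler (2 * j + 7))"]) (use length_ruler_le[OF j(2)] in simp_all)
qed

text \<open>Answers to a signed query on \<open>k\<close> positions differ by at most
  \<open>2 * k\<close>. The least \<open>b\<close> with \<open>2 * k < 2 ^ b\<close> exceeds
  \<open>log 2 (2 * k)\<close> by at most one.\<close>

lemma log_bits:
  fixes k :: nat
  assumes "k \<ge> 2"
  obtains b :: nat where "b \<ge> 1" "2 * k < 2 ^ b" "real b \<le> 6 * ln (real k)"
proof -
  define b where "b = (LEAST b. 2 * k < 2 ^ b)"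
  have "2 * k < 2 ^ (2 * k)" by (rule less_exp)
  then have 1: "2 * k < 2 ^ b" unfolding b_def by (rule LeastI)
  then obtain i where i: "b = Suc i" using assms by (cases b) auto
  have "\<not> 2 * k < 2 ^ i" using not_less_Least[of i "\<lambda>b. 2 * k < 2 ^ b"] i unfolding b_def by simp
  then have "(2::real) ^ i \<le> 2 * real k"
    by (metis not_le of_nat_le_iff of_nat_mult of_nat_numeral of_nat_power)
  then have "ln ((2::real) ^ i) \<le> ln (2 * real k)" using assms by (subst ln_le_cancel_iff) auto
  then have le: "real i * ln 2 \<le> ln 2 + ln (real k)" using assms by (simp add: ln_mult ln_realpow)
  note ln2 = half_le_ln_2
  have lnk: "ln 2 \<le> ln (real k)" using assms by simp
  have "real b * ln 2 \<le> 3 * ln (real k)" using le lnk i by (simp add: algebra_simps)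
  moreover have "real b * (1 / 2) \<le> real b * ln 2" using ln2 by (rule mult_left_mono) simp
  ultimately have "real b \<le> 6 * ln (real k)" by linarith
  then show thesis using 1 i by (intro that[of b]) simp_all
qed

text \<open>The groups have strategies of length \<open>513 * k\<close> and answers of
  \<open>b = O(log k)\<close> bits. There are at least \<open>n / k \<ge> sqrt n\<close> groups, so
  the logarithm of their number is at least half of \<open>ln n\<close>. The constant is
  \<open>2 * 68 * 513 * 6 * 4\<close>.\<close>

lemma game_few_colours:
  assumes n: "n \<ge> 2" and k: "k \<ge> 2" and kn: "k * k \<le> n" and X: "X \<subseteq> words n k" "ones_known n X"
  obtains T where "real T \<le> 1674432 * (real n * (ln (real k) / ln (real n)))" "game n k T X (det (\<lambda>x. x))"
proof -
  define N where "N = n div k + 1"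
  define A where "A i = {p \<in> {1..n}. (p - 1) div k = i}" for i
  have k0: "k > 0" using k by simp
  have un: "(\<Union>i<N. A i) = {1..n}"
  proof -
    have "(p - 1) div k < N" if "p \<in> {1..n}" for p
      unfolding N_def using div_le_mono[of "p - 1" n k] that by (auto simp: less_Suc_eq_le)
    then show ?thesis by (auto simp: A_def)
  qed
  have finA: "finite (A i)" "card (A i) \<le> k" for i
  proof -
    show "finite (A i)" by (simp add: A_def)
    have "A i \<subseteq> {i * k + 1..i * k + k}"
    proof
      fix p assume "p \<in> A i"
      then have "p \<ge> 1" "(p - 1) div k * k = i * k" by (auto simp: A_def)
      then show "p \<in> {i * k + 1..i * k + k}"
        using dividend_less_div_times[OF k0, of "p - 1"] div_times_less_eq_dividend[of "p - 1" k]
        by (simp del: One_nat_def div_times_less_eq_dividend) linarith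
    qed
    then have "card (A i) \<le> card {i * k + 1..i * k + k}" by (intro card_mono) simp
    then show "card (A i) \<le> k" by simp
  qed
  have "\<exists>t\<le>513 * k. black.run k dvd_cap (replicate t 0) (A i) X (black.solved k (A i))" for i
    by (rule run_black_group[OF finA, of i X]) (use k in auto)
  then obtain t where t: "\<And>i. t i \<le> 513 * k"
    "\<And>i. black.run k dvd_cap (replicate (t i) 0) (A i) X (black.solved k (A i))" by metis
  have R: "black.run k dvd_cap (replicate (513 * k) 0) (A i) X (black.solved k (A i))" for i
  proof -
    have "black.run k dvd_cap (replicate (t i) 0 @ replicate (513 * k - t i) 0) (A i) X (black.solved k (A i))"
      by (rule black.run_pad[OF black.hereditary_solved]) (use t in simp_all)
    then show ?thesis using t unfolding replicate_add[symmetric] by simp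
  qed
  obtain b where b: "b \<ge> 1" "2 * k < 2 ^ b" "real b \<le> 6 * ln (real k)" by (rule log_bits[OF k])
  have N2: "N \<ge> 2" using kn k div_le_mono[OF kn, of k] by (simp add: N_def)
  obtain T where T: "real T \<le> 68 * real (513 * k) * real b * (real N / ln (real N))"
    "black.run k dvd_cap (replicate T 0) (\<Union>i<N. A i) X (\<lambda>Y. \<forall>i<N. black.solved k (A i) Y)"
  proof (rule black.run_parallel_log[OF N2 b(1), where t = "513 * k" and A = A and X = X
        and \<Phi> = "\<lambda>i. black.solved k (A i)"])
    show "black.narrow k b (A i)" for i
      by (rule black.narrow_card[OF _ finA(1)]) (use finA(2)[of i] b(2) in \<open>auto simp: black_def\<close>)
    show "disjoint_family_on A {..<N}"
      unfolding disjoint_family_on_def A_def by blast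
  qed (rule that R black.hereditary_solved, assumption+ | rule R black.hereditary_solved)+
  have "black.run k dvd_cap (replicate T 0) {1..n} X (black.solved k {1..n})"
    using T(2) unfolding un
  proof (rule black.run_imp)
    fix Y assume "\<forall>i<N. black.solved k (A i) Y"
    then show "black.solved k {1..n} Y" unfolding un[symmetric] black.solved_def by blast
  qed
  then have "game n k (2 * length (replicate T (0::nat))) X (black.solved k {1..n})"
    by (rule game_black[OF _ black.hereditary_solved X(2)]) (use k in simp)
  then have "game n k (2 * T) X (black.solved k {1..n})" by simp
  then have "game n k (2 * T) X (det (\<lambda>x. x))"
    by (rule game_imp) (rule solved_black_det, use X(1) in auto)
  moreover have "real (2 * T) \<le> 1674432 * (real n * (ln (real k) / ln (real n)))"
  proof -
    have lnk: "ln (real k) > 0" and lnn: "ln (real n) > 0" using n k by simp_all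
    have "real (k * k) \<le> real n" using kn by (simp only: of_nat_le_iff)
    then have kk: "real k * real k \<le> real n" by simp
    then have "ln (real k * real k) \<le> ln (real n)" using k n by (subst ln_le_cancel_iff) auto
    then have half: "2 * ln (real k) \<le> ln (real n)" using k by (simp add: ln_mult)
    have Nu: "real N \<le> 2 * (real n / real k)"
    proof -
      have "real (n div k) \<le> real n / real k" by (rule of_nat_div_le_of_nat)
      moreover have "1 \<le> real n / real k"
      proof -
        have "real k * 1 \<le> real k * real k" using k by (intro mult_left_mono) auto
        then have "real k \<le> real n" using kk by linarith
        then show ?thesis using k by (simp add: pos_le_divide_eq)
      qed
      ultimately show ?thesis by (simp add: N_def)
    qed
    have Nl: "real n / real k \<le> real N"
    proof -
      have "n < k * N" unfolding N_def using k0 by (metis add.commute dividend_less_times_div mult_Suc_right plus_1_eq_Suc)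
      then have "real n < real (k * N)" by (simp only: of_nat_less_iff)
      then show ?thesis using k by (simp add: pos_divide_le_eq mult.commute)
    qed
    have "ln (real n / real k) \<le> ln (real N)" using Nl n k N2 by (subst ln_le_cancel_iff) auto
    then have lnN: "ln (real n) / 2 \<le> ln (real N)" using half n k by (simp add: ln_div)
    have "real N / ln (real N) \<le> (2 * (real n / real k)) / (ln (real n) / 2)"
      by (rule frac_le) (use Nu lnN lnn in auto)
    then have Q: "real N / ln (real N) \<le> 4 * (real n / real k) / ln (real n)" by simp
    have "real T \<le> 68 * real (513 * k) * real b * (real N / ln (real N))" by (rule T(1))
    also have "\<dots> \<le> 68 * real (513 * k) * (6 * ln (real k)) * (4 * (real n / real k) / ln (real n))"
      by (rule mult_mono[OF mult_left_mono[OF b(3)] Q]) (use lnk N2 in auto)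
    also have "\<dots> = 837216 * (real n * (ln (real k) / ln (real n)))"
      using k by (simp add: field_simps)
    finally show ?thesis by simp
  qed
  ultimately show thesis by (intro that)
qed

section \<open>White pegs and many colours\<close>

lemma matches_le:
  assumes "x \<in> words n k" "\<sigma> permutes {1..n}"
  shows "card {i \<in> {1..n}. x i = q (\<sigma> i)} \<le>
    (\<Sum>c\<in>{1..k}. min (card {i \<in> {1..n}. x i = c}) (card {i \<in> {1..n}. q i = c}))"
proof -
  let ?P = "\<lambda>c. {i \<in> {1..n}. x i = c \<and> q (\<sigma> i) = c}"
  have "x i \<in> {1..k}" if "i \<in> {1..n}" for i
    using assms(1) that unfolding words_def by (rule PiE_mem)
  then have "{i \<in> {1..n}. x i = q (\<sigma> i)} \<subseteq> (\<Union>c\<in>{1..k}. ?P c)"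
    by fastforce
  then have "card {i \<in> {1..n}. x i = q (\<sigma> i)} \<le> card (\<Union>c\<in>{1..k}. ?P c)"
    by (rule card_mono[rotated]) simp
  also have "\<dots> \<le> (\<Sum>c\<in>{1..k}. card (?P c))" by (rule card_UN_le) simp
  also have "\<dots> \<le> (\<Sum>c\<in>{1..k}. min (card {i \<in> {1..n}. x i = c}) (card {i \<in> {1..n}. q i = c}))"
  proof (rule sum_mono)
    fix c
    have "card (?P c) \<le> card {i \<in> {1..n}. x i = c}" by (rule card_mono) auto
    moreover have "card (?P c) \<le> card {i \<in> {1..n}. q i = c}"
    proof (rule card_inj_on_le)
      show "inj_on \<sigma> (?P c)" using permutes_inj_on[OF assms(2)] .
      show "\<sigma> ` ?P c \<subseteq> {i \<in> {1..n}. q i = c}" using permutes_in_image[OF assms(2)] by auto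
    qed simp
    ultimately show "card (?P c) \<le> min (card {i \<in> {1..n}. x i = c}) (card {i \<in> {1..n}. q i = c})"
      by simp
  qed
  finally show ?thesis .
qed

text \<open>For each colour, as many occurrences in \<open>x\<close> and \<open>q\<close> as
  possible are paired up. The pairing extends to a permutation because equally many positions remain
  free on both sides.\<close>

lemma matches_attained:
  fixes x q :: word
  shows "\<exists>\<sigma>. \<sigma> permutes {1..n} \<and>
    (\<Sum>c\<in>{1..k}. min (card {i \<in> {1..n}. x i = c}) (card {i \<in> {1..n}. q i = c}))
      \<le> card {i \<in> {1..n}. x i = q (\<sigma> i)}"
proof -
  let ?X = "\<lambda>c. {i \<in> {1..n}. x i = c}" and ?Y = "\<lambda>c. {i \<in> {1..n}. q i = c}"
  have "\<exists>P Q h. P \<subseteq> ?X c \<and> Q \<subseteq> ?Y c \<and> card P = min (card (?X c)) (card (?Y c)) \<and> bij_betw h P Q" for c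
  proof -
    obtain P where P: "P \<subseteq> ?X c" "card P = min (card (?X c)) (card (?Y c))" "finite P"
      using obtain_subset_with_card_n[of "min (card (?X c)) (card (?Y c))" "?X c"] by auto
    obtain Q where Q: "Q \<subseteq> ?Y c" "card Q = min (card (?X c)) (card (?Y c))" "finite Q"
      using obtain_subset_with_card_n[of "min (card (?X c)) (card (?Y c))" "?Y c"] by auto
    obtain h where "bij_betw h P Q" using finite_same_card_bij[OF P(3) Q(3)] P(2) Q(2) by auto
    then show ?thesis using P Q by blast
  qed
  then have "\<forall>c. \<exists>P Q h. P \<subseteq> ?X c \<and> Q \<subseteq> ?Y c \<and> card P = min (card (?X c)) (card (?Y c)) \<and> bij_betw h P Q"
    by (rule allI)
  then have "\<exists>P Q h. \<forall>c. P c \<subseteq> ?X c \<and> Q c \<subseteq> ?Y c \<and> card (P c) = min (card (?X c)) (card (?Y c)) \<and>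
      bij_betw (h c) (P c) (Q c)"
    by (simp only: choice_iff)
  then obtain P Q h where *: "\<forall>c. P c \<subseteq> ?X c \<and> Q c \<subseteq> ?Y c \<and> card (P c) = min (card (?X c)) (card (?Y c)) \<and>
      bij_betw (h c) (P c) (Q c)"
    by (elim exE)
  have PQ: "P c \<subseteq> ?X c" "Q c \<subseteq> ?Y c" "card (P c) = min (card (?X c)) (card (?Y c))"
    "bij_betw (h c) (P c) (Q c)" for c
    using spec[OF *, of c] by simp_all
  define PP where "PP = (\<Union>c\<in>{1..k}. P c)"
  define QQ where "QQ = (\<Union>c\<in>{1..k}. Q c)"
  define f where "f i = h (x i) i" for i
  have "bij_betw f (P c) (Q c)" for c
    using PQ(4)[of c] by (rule bij_betw_cong[THEN iffD1, rotated]) (use PQ(1)[of c] in \<open>auto simp: f_def\<close>)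
  moreover have "disjoint_family_on Q {1..k}"
    unfolding disjoint_family_on_def using PQ(2) by blast
  ultimately have f: "bij_betw f PP QQ"
    unfolding PP_def QQ_def by (intro bij_betw_UNION_disjoint)
  have "P c \<subseteq> {1..n}" "Q c \<subseteq> {1..n}" for c using PQ(1,2)[of c] by blast+
  then have sub: "PP \<subseteq> {1..n}" "QQ \<subseteq> {1..n}" unfolding PP_def QQ_def UN_subset_iff by blast+
  have fin: "finite PP" "finite QQ"
    using finite_subset[OF sub(1) finite_atLeastAtMost] finite_subset[OF sub(2) finite_atLeastAtMost] .
  have "card ({1..n} - PP) = card ({1..n} - QQ)"
    using bij_betw_same_card[OF f] sub fin by (simp add: card_Diff_subset)
  then obtain g where g: "bij_betw g ({1..n} - PP) ({1..n} - QQ)"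
    using finite_same_card_bij[of "{1..n} - PP" "{1..n} - QQ"] by auto
  define \<sigma> where "\<sigma> i = (if i \<in> PP then f i else if i \<in> {1..n} then g i else i)" for i
  have 1: "bij_betw \<sigma> PP QQ"
    using f by (rule bij_betw_cong[THEN iffD1, rotated]) (simp add: \<sigma>_def)
  have 2: "bij_betw \<sigma> ({1..n} - PP) ({1..n} - QQ)"
    using g by (rule bij_betw_cong[THEN iffD1, rotated]) (simp add: \<sigma>_def)
  have "bij_betw \<sigma> (PP \<union> ({1..n} - PP)) (QQ \<union> ({1..n} - QQ))"
    by (rule bij_betw_combine[OF 1 2]) auto
  then have "bij_betw \<sigma> {1..n} {1..n}" using sub by (simp add: Un_absorb1)
  then have perm: "\<sigma> permutes {1..n}"
    by (rule bij_imp_permutes) (use sub in \<open>auto simp: \<sigma>_def\<close>)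
  have "PP \<subseteq> {i \<in> {1..n}. x i = q (\<sigma> i)}"
  proof
    fix i assume i: "i \<in> PP"
    then obtain c where c: "i \<in> P c" unfolding PP_def by blast
    have xi: "x i = c" "i \<in> {1..n}" using subsetD[OF PQ(1)[of c] c] by auto
    have "\<sigma> i = h c i" using i xi by (simp add: \<sigma>_def f_def)
    then have "\<sigma> i \<in> Q c" using bij_betwE[OF PQ(4)[of c]] c by simp
    then have "q (\<sigma> i) = c" using subsetD[OF PQ(2)[of c], of "\<sigma> i"] by simp
    then show "i \<in> {i \<in> {1..n}. x i = q (\<sigma> i)}" using xi by simp
  qed
  then have "card PP \<le> card {i \<in> {1..n}. x i = q (\<sigma> i)}" by (rule card_mono[rotated]) simp
  moreover have "card PP = (\<Sum>c\<in>{1..k}. card (P c))"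
    unfolding PP_def
  proof (rule card_UN_disjoint)
    show "\<forall>i\<in>{1..k}. finite (P i)" by (intro ballI finite_subset[OF PQ(1)]) simp
    have "P i \<inter> P j = {}" if "i \<noteq> j" for i j
      using PQ(1)[of i] PQ(1)[of j] that by blast
    then show "\<forall>i\<in>{1..k}. \<forall>j\<in>{1..k}. i \<noteq> j \<longrightarrow> P i \<inter> P j = {}" by simp
  qed simp
  ultimately show ?thesis using perm unfolding PQ(3) by (intro exI[of _ \<sigma>]) simp
qed

lemma answer_total:
  assumes "x \<in> words n k"
  shows "fst (answer n x q) + snd (answer n x q) =
    (\<Sum>c\<in>{1..k}. min (card {i \<in> {1..n}. x i = c}) (card {i \<in> {1..n}. q i = c}))"
    (is "_ = ?S")
proof -
  let ?M = "{card {i \<in> {1..n}. x i = q (\<sigma> i)} | \<sigma>. \<sigma> permutes {1..n}}"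
  have "?M = (\<lambda>\<sigma>. card {i \<in> {1..n}. x i = q (\<sigma> i)}) ` {\<sigma>. \<sigma> permutes {1..n}}" by auto
  then have fin: "finite ?M" by (simp add: finite_permutations)
  have bp: "bp n x q \<in> ?M"
    unfolding bp_def by (intro CollectI exI[of _ id] conjI permutes_id) simp
  have "Max ?M = ?S"
  proof (rule antisym)
    show "Max ?M \<le> ?S"
    proof (rule Max.boundedI[OF fin])
      show "?M \<noteq> {}" using bp by blast
      fix m assume "m \<in> ?M"
      then show "m \<le> ?S"
      proof (elim CollectE exE conjE)
        fix \<sigma> assume "m = card {i \<in> {1..n}. x i = q (\<sigma> i)}" "\<sigma> permutes {1..n}"
        then show ?thesis using matches_le[OF assms, of \<sigma> q] by simp
      qed
    qed
    from matches_attained[where n = n and k = k and x = x and q = q] show "?S \<le> Max ?M"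
    proof (elim exE conjE)
      fix \<sigma> assume \<sigma>: "\<sigma> permutes {1..n}" "?S \<le> card {i \<in> {1..n}. x i = q (\<sigma> i)}"
      have "card {i \<in> {1..n}. x i = q (\<sigma> i)} \<in> ?M" using \<sigma>(1) by (intro CollectI exI[of _ \<sigma>] conjI refl)
      from Max_ge[OF fin this] show ?thesis using \<sigma>(2) by (rule le_trans[rotated])
    qed
  qed
  moreover have "bp n x q \<le> Max ?M" by (rule Max_ge[OF fin bp])
  ultimately show ?thesis by (simp add: answer_def wp_def)
qed

section \<open>Finding the colours that occur in the secret\<close>

definition colours :: "nat \<Rightarrow> word \<Rightarrow> nat set" where
  "colours n x = x ` {1..n}"

lemma finite_colours [simp]: "finite (colours n x)"
  by (simp add: colours_def)

lemma card_colours_le: "card (colours n x) \<le> n"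
  unfolding colours_def using card_image_le[of "{1..n}" x] by simp

lemma colours_subset: "x \<in> words n k \<Longrightarrow> colours n x \<subseteq> {1..k}"
  by (auto simp: words_def colours_def)

text \<open>Each colour of \<open>C\<close> is placed once, so it adds 1 or 0 to the total of pegs;
  all other positions show the filler 1, which \<open>C\<close> avoids.\<close>

lemma colour_set_query:
  assumes C: "C \<subseteq> {2..k}" "card C \<le> n" and k: "k \<ge> 1"
  obtains q where "q \<in> words n k" "\<And>x. x \<in> words n k \<Longrightarrow>
    fst (answer n x q) + snd (answer n x q) =
      card (C \<inter> colours n x) + min (card {i \<in> {1..n}. x i = 1}) (n - card C)"
proof -
  have fin: "finite C" using C(1) finite_subset by blast
  obtain h where h: "bij_betw h {1..card C} C" using ex_bij_betw_nat_finite_1[OF fin] by blast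
  define q where "q = (\<lambda>i\<in>{1..n}. if i \<le> card C then h i else 1)"
  have hC: "h i \<in> C" if "1 \<le> i" "i \<le> card C" for i using bij_betwE[OF h] that by auto
  have "q \<in> words n k"
    unfolding words_def q_def restrict_PiE_iff using hC C(1) k by force
  moreover have "fst (answer n x q) + snd (answer n x q) =
      card (C \<inter> colours n x) + min (card {i \<in> {1..n}. x i = 1}) (n - card C)"
    if x: "x \<in> words n k" for x
  proof -
    have 1: "{i \<in> {1..n}. q i = 1} = {card C + 1..n}"
      using hC C(1) by (force simp: q_def)
    have c: "min (card {i \<in> {1..n}. x i = c}) (card {i \<in> {1..n}. q i = c}) = of_bool (c \<in> C \<inter> colours n x)"
      if "c \<in> {2..k}" for c
    proof (cases "c \<in> C")
      case True
      then obtain i where i: "i \<in> {1..card C}" "h i = c" using h by (metis bij_betw_iff_bijections)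
      have "card {i \<in> {1..n}. q i = c} = 1"
      proof -
        have uniq: "j = i" if "j \<in> {1..card C}" "h j = c" for j
          using h i that by (metis bij_betw_def inj_on_def)
        have "j = i" if j: "j \<in> {1..n}" "q j = c" for j
        proof -
          have "j \<le> card C" using j \<open>c \<in> {2..k}\<close> by (simp add: q_def split: if_splits)
          then show ?thesis using j by (intro uniq) (simp_all add: q_def)
        qed
        moreover have "i \<in> {1..n}" "q i = c" using i C(2) by (simp_all add: q_def)
        ultimately have "{i \<in> {1..n}. q i = c} = {i}" by blast
        then show ?thesis by simp
      qed
      moreover have "card {i \<in> {1..n}. x i = c} \<ge> 1 \<longleftrightarrow> c \<in> colours n x"
      proof -
        have "card {i \<in> {1..n}. x i = c} \<ge> 1 \<longleftrightarrow> {i \<in> {1..n}. x i = c} \<noteq> {}"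
          using card_gt_0_iff[of "{i \<in> {1..n}. x i = c}"] by (simp add: Suc_le_eq)
        moreover have "{i \<in> {1..n}. x i = c} \<noteq> {} \<longleftrightarrow> c \<in> colours n x"
          unfolding colours_def by blast
        ultimately show ?thesis by blast
      qed
      moreover have "min m l = of_bool (c \<in> C \<inter> colours n x)"
        if "l = 1" "1 \<le> m \<longleftrightarrow> c \<in> colours n x" for l m :: nat
        using that True by (cases "c \<in> colours n x") simp_all
      ultimately show ?thesis by blast
    next
      case False
      have "q i \<noteq> c" if "i \<in> {1..n}" for i
        using hC[of i] that \<open>c \<in> {2..k}\<close> False by (auto simp: q_def)
      then have "{i \<in> {1..n}. q i = c} = {}" by blast
      then have 0: "card {i \<in> {1..n}. q i = c} = 0" by (simp only: card.empty)
      show ?thesis unfolding 0 using False by simp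
    qed
    have "{1..k} = insert 1 {2..k}" using k by auto
    then have "fst (answer n x q) + snd (answer n x q) =
       min (card {i \<in> {1..n}. x i = 1}) (card {i \<in> {1..n}. q i = 1}) +
       (\<Sum>c\<in>{2..k}. min (card {i \<in> {1..n}. x i = c}) (card {i \<in> {1..n}. q i = c}))"
      unfolding answer_total[OF x] by simp
    also have "(\<Sum>c\<in>{2..k}. min (card {i \<in> {1..n}. x i = c}) (card {i \<in> {1..n}. q i = c}))
        = (\<Sum>c\<in>{2..k}. of_bool (c \<in> C \<inter> colours n x))"
      by (rule sum.cong[OF refl c])
    also have "\<dots> = card ({2..k} \<inter> (C \<inter> colours n x))"
      by (simp add: of_bool_def sum.If_cases Int_def)
    also have "{2..k} \<inter> (C \<inter> colours n x) = C \<inter> colours n x" using C(1) by auto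
    finally show ?thesis unfolding 1 by simp
  qed
  ultimately show thesis by (rule that)
qed

text \<open>The colours from 2 on are cut into blocks of length \<open>n\<close>; colour 1 is the filler. Block \<open>j\<close> plays
  the role of a position and the index \<open>c\<close> within a block that of a colour, so that a position may
  now have several colours.\<close>

definition block :: "nat \<Rightarrow> nat \<Rightarrow> nat set" where
  "block n j = {2 + j * n..<2 + (j + 1) * n}"

definition white :: "nat \<Rightarrow> nat \<Rightarrow> nat \<Rightarrow> word \<Rightarrow> int" where
  "white n j c x = of_bool (2 + j * n + c \<in> colours n x)"

lemma sum_of_bool_inj:
  assumes "finite G" "inj_on g G"
  shows "(\<Sum>a\<in>G. of_bool (g a \<in> S) :: int) = int (card (g ` G \<inter> S))"
proof -
  have "(\<Sum>a\<in>G. of_bool (g a \<in> S) :: int) = (\<Sum>a | a \<in> G \<and> g a \<in> S. 1)"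
    unfolding of_bool_def by (rule sum.inter_filter[symmetric, OF assms(1)])
  also have "\<dots> = int (card {a \<in> G. g a \<in> S})" by simp
  also have "card {a \<in> G. g a \<in> S} = card (g ` {a \<in> G. g a \<in> S})"
    by (rule card_image[symmetric]) (rule inj_on_subset[OF assms(2)], blast)
  also have "g ` {a \<in> G. g a \<in> S} = g ` G \<inter> S" by blast
  finally show ?thesis .
qed

lemma sum_white: "(\<Sum>c\<in>{..<n}. white n j c x) = int (card (block n j \<inter> colours n x))"
proof -
  have img: "(\<lambda>c. 2 + j * n + c) ` {..<n} = block n j"
  proof -
    have "c \<in> (\<lambda>c. 2 + j * n + c) ` {..<n}" if "c \<in> block n j" for c
      using that by (intro image_eqI[of _ _ "c - (2 + j * n)"]) (auto simp: block_def)
    moreover have "2 + j * n + c \<in> block n j" if "c < n" for c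
      using that by (simp add: block_def)
    ultimately show ?thesis by auto
  qed
  show ?thesis
    unfolding white_def img[symmetric] by (rule sum_of_bool_inj) (simp_all add: inj_on_def)
qed

lemma cnt_card: "black.cnt c {1..n} x = int (card {i \<in> {1..n}. x i = c})"
proof -
  have "{i \<in> {1..n}. x i = (\<lambda>i\<in>{1..n}. c) i} = {i \<in> {1..n}. x i = c}" by (rule Collect_cong) auto
  then show ?thesis unfolding bp_constant[symmetric] bp_def by (simp only:)
qed

lemma det_ones_count:
  assumes "det (black.cnt 1 {1..n}) X" "x \<in> X" "y \<in> X"
  shows "card {i \<in> {1..n}. x i = 1} = card {i \<in> {1..n}. y i = 1}"
proof -
  have "black.cnt 1 {1..n} x = black.cnt 1 {1..n} y" using assms unfolding det_def by blast
  then show ?thesis unfolding cnt_card by (simp only: of_nat_eq_iff)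
qed

text \<open>With the number of 1s in the secret fixed, the filler contributes the same to all totals
  and cancels.\<close>

lemma colour_set_known:
  assumes C: "C \<subseteq> {2..k}" "card C \<le> n" and k: "k \<ge> 1"
    and X: "X \<subseteq> words n k" "det (black.cnt 1 {1..n}) X"
  obtains q where "q \<in> words n k" "\<And>x y. x \<in> X \<Longrightarrow> y \<in> X \<Longrightarrow> answer n x q = answer n y q \<Longrightarrow>
    card (C \<inter> colours n x) = card (C \<inter> colours n y)"
proof -
  obtain q where q: "q \<in> words n k" "\<And>x. x \<in> words n k \<Longrightarrow>
    fst (answer n x q) + snd (answer n x q) =
      card (C \<inter> colours n x) + min (card {i \<in> {1..n}. x i = 1}) (n - card C)"
    by (rule colour_set_query[OF C k]) (rule that, assumption+)
  show thesis
  proof (rule that[OF q(1)])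
    fix x y assume xy: "x \<in> X" "y \<in> X" "answer n x q = answer n y q"
    have w: "x \<in> words n k" "y \<in> words n k" using xy X(1) by auto
    show "card (C \<inter> colours n x) = card (C \<inter> colours n y)"
      using q(2)[OF w(1)] q(2)[OF w(2)] unfolding xy(3) det_ones_count[OF X(2) xy(1,2)] by linarith
  qed
qed

text \<open>The colours asked with sign 1 and those asked with sign -1 form two sets of at most
  \<open>card J \<le> n\<close> colours, each fitting one query. Blocks are disjoint, so
  \<open>g\<close> names different colours for different positions.\<close>

lemma simulate_white:
  assumes f: "f \<in> atoms.queries (white n) {..<n} J" and J: "finite J" "card J \<le> n" and k: "k \<ge> 1"
    and X: "X \<subseteq> words n k" "det (black.cnt 1 {1..n}) X"
  shows "\<exists>q\<in>words n k. \<exists>q'\<in>words n k. \<forall>x\<in>X. \<forall>y\<in>X.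
    answer n x q = answer n y q \<longrightarrow> answer n x q' = answer n y q' \<longrightarrow> f x = f y"
proof -
  obtain F s q where F: "finite F" "F \<subseteq> J" "\<forall>p\<in>F. s p = 1 \<or> s p = -1"
    "\<forall>p\<in>F. q p \<in> {..<n}" "\<forall>x. f x = (\<Sum>p\<in>F. s p * white n p (q p) x)"
    by (rule atoms.queriesE[OF f]) (rule that, assumption+)
  define g where "g j = 2 + j * n + q j" for j
  \<comment> \<open>The last block may reach beyond \<open>k\<close>. Such colours cannot be put
    into a query and occur in no secret, so they are dropped.\<close>
  define G where "G v = {j \<in> F. s j = v \<and> g j \<le> k}" for v :: int
  have inj: "inj_on g F"
  proof (rule inj_onI)
    fix i j assume ij: "i \<in> F" "j \<in> F" "g i = g j"
    have "q i < n" "q j < n" using F(4) ij(1,2) by auto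
    then have "(i * n + q i) div n = i" "(j * n + q j) div n = j" by simp_all
    moreover have "i * n + q i = j * n + q j" using ij(3) by (simp add: g_def)
    ultimately show "i = j" by metis
  qed
  have GF: "G v \<subseteq> F" for v by (auto simp: G_def)
  have C: "g ` G v \<subseteq> {2..k}" "card (g ` G v) \<le> n" for v
  proof -
    show "g ` G v \<subseteq> {2..k}" by (auto simp: G_def g_def)
    have "card (g ` G v) \<le> card (G v)" by (rule card_image_le[OF finite_subset[OF GF F(1)]])
    also have "\<dots> \<le> card J" by (rule card_mono[OF J(1)]) (use GF F(2) in blast)
    finally show "card (g ` G v) \<le> n" using J(2) by linarith
  qed
  have f_eq: "f x = int (card (g ` G 1 \<inter> colours n x)) - int (card (g ` G (-1) \<inter> colours n x))"
    if x: "x \<in> X" for x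
  proof -
    have "colours n x \<subseteq> {1..k}" using colours_subset x X(1) by blast
    then have big: "g j \<notin> colours n x" if "\<not> g j \<le> k" for j using that by auto
    have part: "(\<Sum>j\<in>F. if j \<in> G v then of_bool (g j \<in> colours n x) else 0)
        = int (card (g ` G v \<inter> colours n x))" for v
    proof -
      have "(\<Sum>j\<in>F. if j \<in> G v then of_bool (g j \<in> colours n x) else (0::int))
          = (\<Sum>j\<in>G v. of_bool (g j \<in> colours n x))"
        by (rule sum.mono_neutral_cong_right[OF F(1) GF]) auto
      also have "\<dots> = int (card (g ` G v \<inter> colours n x))"
        by (rule sum_of_bool_inj[OF finite_subset[OF GF F(1)] inj_on_subset[OF inj GF]])
      finally show ?thesis .
    qed
    have "f x = (\<Sum>j\<in>F. (if j \<in> G 1 then of_bool (g j \<in> colours n x) else 0)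
        - (if j \<in> G (-1) then of_bool (g j \<in> colours n x) else 0))"
      unfolding F(5)[rule_format]
    proof (rule sum.cong[OF refl])
      fix j assume j: "j \<in> F"
      have w: "white n j (q j) x = of_bool (g j \<in> colours n x)" by (simp add: white_def g_def)
      show "s j * white n j (q j) x = (if j \<in> G 1 then of_bool (g j \<in> colours n x) else 0)
        - (if j \<in> G (-1) then of_bool (g j \<in> colours n x) else 0)"
      proof (cases "g j \<le> k")
        case True
        have "s j = 1 \<or> s j = -1" using F(3) j by blast
        then show ?thesis
          unfolding w using j True by (elim disjE) (simp_all add: G_def)
      next
        case False
        then show ?thesis unfolding w using big[OF False] by (simp add: G_def)
      qed
    qed
    also have "\<dots> = int (card (g ` G 1 \<inter> colours n x)) - int (card (g ` G (-1) \<inter> colours n x))"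
      unfolding sum_subtractf part by (rule refl)
    finally show ?thesis .
  qed
  obtain q1 where q1: "q1 \<in> words n k" "\<And>x y. x \<in> X \<Longrightarrow> y \<in> X \<Longrightarrow> answer n x q1 = answer n y q1 \<Longrightarrow>
    card (g ` G 1 \<inter> colours n x) = card (g ` G 1 \<inter> colours n y)"
    by (rule colour_set_known[OF C k X]) (rule that, assumption+)
  obtain q2 where q2: "q2 \<in> words n k" "\<And>x y. x \<in> X \<Longrightarrow> y \<in> X \<Longrightarrow> answer n x q2 = answer n y q2 \<Longrightarrow>
    card (g ` G (-1) \<inter> colours n x) = card (g ` G (-1) \<inter> colours n y)"
    by (rule colour_set_known[OF C k X]) (rule that, assumption+)
  have "f x = f y" if "x \<in> X" "y \<in> X" "answer n x q1 = answer n y q1" "answer n x q2 = answer n y q2" for x y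
    unfolding f_eq[OF that(1)] f_eq[OF that(2)] q1(2)[OF that(1,2,3)] q2(2)[OF that(1,2,4)] by (rule refl)
  then show ?thesis using q1(1) q2(1) by blast
qed

lemma block_above: "n \<ge> 1 \<Longrightarrow> k div n + 1 \<le> j \<Longrightarrow> c \<in> block n j \<Longrightarrow> k < c"
proof -
  assume n: "n \<ge> 1" and j: "k div n + 1 \<le> j" and c: "c \<in> block n j"
  have "k < (k div n + 1) * n" using n dividend_less_div_times[of n k] by simp
  also have "\<dots> \<le> j * n" using j by (rule mult_le_mono1)
  also have "\<dots> \<le> c" using c by (simp add: block_def)
  finally show "k < c" .
qed

lemma game_blocks:
  assumes n: "n \<ge> 1" and k: "k \<ge> 1" and X: "X \<subseteq> words n k" "det (black.cnt 1 {1..n}) X"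
  shows "game n k B X (\<lambda>Y. \<forall>j<B. det (\<lambda>x. card (block n j \<inter> colours n x)) Y)"
proof (induction B)
  case 0
  show ?case by simp
next
  case (Suc B)
  have "game n k (B + 1) X (\<lambda>Y. \<forall>j<Suc B. det (\<lambda>x. card (block n j \<inter> colours n x)) Y)"
    using Suc
  proof (rule game_seq)
    fix Y assume Y: "Y \<subseteq> X" "\<forall>j<B. det (\<lambda>x. card (block n j \<inter> colours n x)) Y"
    let ?C = "block n B \<inter> {..k}"
    have C: "?C \<subseteq> {2..k}" "card ?C \<le> n"
    proof -
      show "?C \<subseteq> {2..k}" by (auto simp: block_def)
      have "card ?C \<le> card (block n B)" by (rule card_mono) (auto simp: block_def)
      then show "card ?C \<le> n" by (simp add: block_def)
    qed
    have YX: "Y \<subseteq> words n k" "det (black.cnt 1 {1..n}) Y"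
      using Y(1) X(1) det_subset[OF X(2) Y(1)] by auto
    obtain q where q: "q \<in> words n k" "\<And>x y. x \<in> Y \<Longrightarrow> y \<in> Y \<Longrightarrow> answer n x q = answer n y q \<Longrightarrow>
      card (?C \<inter> colours n x) = card (?C \<inter> colours n y)"
      by (rule colour_set_known[OF C k YX]) (rule that, assumption+)
    have eq: "?C \<inter> colours n x = block n B \<inter> colours n x" if "x \<in> Y" for x
    proof -
      have "colours n x \<subseteq> {1..k}" using colours_subset that YX(1) by blast
      then show ?thesis by auto
    qed
    have "\<forall>j<Suc B. det (\<lambda>x. card (block n j \<inter> colours n x)) {x\<in>Y. answer n x q = a}" for a
    proof (intro allI impI)
      fix j assume "j < Suc B"
      then consider "j < B" | "j = B" by linarith
      then show "det (\<lambda>x. card (block n j \<inter> colours n x)) {x\<in>Y. answer n x q = a}"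
      proof cases
        case 1
        then have "det (\<lambda>x. card (block n j \<inter> colours n x)) Y" using Y(2) by blast
        then show ?thesis by (rule det_subset) blast
      next
        case 2
        show ?thesis
          unfolding det_def 2
        proof (intro ballI)
          fix x y assume "x \<in> {x\<in>Y. answer n x q = a}" "y \<in> {x\<in>Y. answer n x q = a}"
          then have xy: "x \<in> Y" "y \<in> Y" "answer n x q = answer n y q" by simp_all
          show "card (block n B \<inter> colours n x) = card (block n B \<inter> colours n y)"
            using q(2)[OF xy] unfolding eq[OF xy(1)] eq[OF xy(2)] .
        qed
      qed
    qed
    then show "game n k 1 Y (\<lambda>Y. \<forall>j<Suc B. det (\<lambda>x. card (block n j \<inter> colours n x)) Y)"
      unfolding One_nat_def game.simps using q(1) by blast
  qed
  then show ?case by simp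
qed

text \<open>The nonempty blocks form the job \<open>J\<close>. Their weights are positive and add up
  to at most the number of colours of the secret, so the job size and the number of positions in a
  query are both at most \<open>n\<close>. The constant is \<open>2 * (1 + 512)\<close>.\<close>

lemma game_colours:
  assumes n: "n \<ge> 1" and k: "k \<ge> 1" and X: "X \<subseteq> words n k" "det (black.cnt 1 {1..n}) X"
    and blocks: "\<forall>j<k div n + 1. det (\<lambda>x. card (block n j \<inter> colours n x)) X"
  shows "game n k (1026 * n) X (det (colours n))"
proof (cases "X = {}")
  case True
  have "game n k 0 X (det (colours n))" by (simp add: True det_def)
  then show ?thesis by (rule game_more[OF hereditary_det k]) simp
next
  case False
  then obtain z where z: "z \<in> X" by blast
  define w where "w j = card (block n j \<inter> colours n z)" for j
  have w_eq: "card (block n j \<inter> colours n x) = w j" if x: "x \<in> X" for x j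
  proof (cases "j < k div n + 1")
    case True
    then show ?thesis using blocks x z unfolding w_def det_def by blast
  next
    case False
    have "block n j \<inter> colours n y = {}" if "y \<in> X" for y
    proof -
      have "colours n y \<subseteq> {1..k}" using colours_subset that X(1) by blast
      then show ?thesis using block_above[OF n, of k j] False by fastforce
    qed
    then show ?thesis using x z by (simp add: w_def)
  qed
  define J where "J = {j. j < k div n + 1 \<and> w j > 0}"
  have finJ: "finite J" by (simp add: J_def)
  have sumJ: "sum w J \<le> n"
  proof -
    have "sum w J = card (\<Union>j\<in>J. block n j \<inter> colours n z)"
      unfolding w_def
    proof (rule card_UN_disjoint[symmetric, OF finJ])
      have "block n i \<inter> block n j = {}" if "i < j" for i j
      proof -
        have "(i + 1) * n \<le> j * n" using that by (intro mult_le_mono1) simp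
        then show ?thesis by (auto simp: block_def)
      qed
      then show "\<forall>i\<in>J. \<forall>j\<in>J. i \<noteq> j \<longrightarrow> (block n i \<inter> colours n z) \<inter> (block n j \<inter> colours n z) = {}"
        by (metis inf_assoc inf_bot_left inf_commute linorder_neq_iff)
    qed simp
    also have "\<dots> \<le> card (colours n z)" by (rule card_mono) auto
    also have "\<dots> \<le> n" by (rule card_colours_le)
    finally show ?thesis .
  qed
  have cardJ: "card J \<le> n"
  proof -
    have "card J = (\<Sum>j\<in>J. 1)" by simp
    also have "\<dots> \<le> sum w J" by (rule sum_mono) (simp add: J_def)
    finally show ?thesis using sumJ by linarith
  qed
  interpret white: weighted_atoms "white n" "{..<n}" w X
    by unfold_locales (simp_all add: sum_white w_eq, simp add: white_def)
  obtain j where j: "n < 4 ^ j" "4 ^ j \<le> 4 * n" by (rule power4_bracket[OF n])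
  have "white.run dvd_cap (replicate (n * 1) 0) (\<Union>c<n. J) X (\<lambda>Y. \<forall>c<n. det (white.cnt c J) Y)"
  proof (rule white.run_many)
    fix c assume "c < n"
    then have "white.cnt c J \<in> white.queries J" by (intro white.cnt_query finJ) simp
    then have "white.run dvd_cap [0] J X (det (white.cnt c J))"
      by (rule white.run_single) (simp add: dvd_cap_def)
    then show "white.run dvd_cap (replicate 1 0) J X (det (white.cnt c J))" by simp
  qed (rule hereditary_det)
  then have "white.run dvd_cap (replicate n 0) J X (\<lambda>Y. \<forall>c<n. det (white.cnt c J) Y)"
    unfolding mult_1_right by (rule white.run_support) blast
  then have "white.run dvd_cap (replicate n 0) J X (white.counted J)"
    by (rule white.run_imp) (simp add: white.counted_def)
  then have "white.run dvd_cap (replicate n 0 @ replicate (length (ruler (2 * j + 7))) 0) J X (white.solved J)"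
  proof (rule white.run_seq)
    fix Y assume Y: "Y \<subseteq> X" "white.counted J Y"
    have "white.run dvd_cap (ruler (2 * j + 7)) J Y (white.solved J)"
      by (rule white.run_solve[OF finJ _ Y(2,1)]) (use sumJ j(1) in linarith)
    then show "white.run dvd_cap (replicate (length (ruler (2 * j + 7))) 0) J Y (white.solved J)"
      by (rule white.run_forget)
  qed
  then have "game n k (2 * length (replicate n (0::nat) @ replicate (length (ruler (2 * j + 7))) 0)) X (white.solved J)"
    by (rule game_of_run[OF _ white.hereditary_solved]) (rule simulate_white[OF _ finJ cardJ k X])
  then have "game n k (2 * (n + length (ruler (2 * j + 7)))) X (white.solved J)" by simp
  then have "game n k (2 * (n + length (ruler (2 * j + 7)))) X (det (colours n))"
  proof (rule game_imp)
    fix Y assume Y: "Y \<subseteq> X" "white.solved J Y"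
    have sub: "colours n x \<subseteq> colours n y" if xy: "x \<in> Y" "y \<in> Y" for x y
    proof
      fix c assume c: "c \<in> colours n x"
      have x: "x \<in> X" "y \<in> X" using xy Y(1) by auto
      have "c \<in> {1..k}" using c colours_subset x(1) X(1) by blast
      then have ck: "1 \<le> c" "c \<le> k" by auto
      show "c \<in> colours n y"
      \<comment> \<open>Colour 1 lies in no block; whether it occurs follows from the known number
        of 1s.\<close>
      proof (cases "c = 1")
        case True
        have pos: "card {i \<in> {1..n}. v i = 1} > 0 \<longleftrightarrow> 1 \<in> colours n v" for v
          unfolding card_gt_0_iff colours_def by force
        show ?thesis using pos[of x] pos[of y] c det_ones_count[OF X(2) x] unfolding True by simp
      next
        case False
        define i where "i = (c - 2) div n"
        define r where "r = (c - 2) mod n"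
        have r: "r < n" using n by (simp add: r_def)
        have "(c - 2) = i * n + r" by (simp add: i_def r_def)
        then have c_eq: "c = 2 + i * n + r" using ck False by linarith
        then have "c \<in> block n i" using r by (simp add: block_def)
        then have "block n i \<inter> colours n x \<noteq> {}" using c by blast
        then have "w i > 0" unfolding w_eq[OF x(1), symmetric] by (simp add: card_gt_0_iff)
        moreover have "i < k div n + 1"
        proof -
          have "c - 2 \<le> k" using ck by linarith
          from div_le_mono[OF this, of n] show ?thesis unfolding i_def by linarith
        qed
        ultimately have "i \<in> J" by (simp add: J_def)
        then have "det (white n i r) Y" using Y(2) r unfolding white.solved_def by blast
        then have "white n i r x = white n i r y" using xy unfolding det_def by blast
        then show ?thesis using c unfolding white_def c_eq by simp
      qed
    qed
    show "det (colours n) Y" unfolding det_def using sub by blast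
  qed
  moreover have "2 * (n + length (ruler (2 * j + 7))) \<le> 1026 * n"
  proof -
    have "length (ruler (2 * j + 7)) \<le> 512 * n" by (rule length_ruler_le[OF j(2)])
    then show ?thesis by simp
  qed
  ultimately show ?thesis by (rule game_more[OF hereditary_det k])
qed

section \<open>Assembling the upper bound\<close>

lemma game_many_colours:
  assumes n: "n \<ge> 2" and kn: "n < k"
  obtains T where "real T \<le> 2600 * real n + real k / real n" "game n k T (words n k) (det (\<lambda>x. x))"
proof -
  have k: "k \<ge> 1" "k \<ge> 2" and n1: "n \<ge> 1" using n kn by simp_all
  let ?X0 = "words n k" and ?B = "k div n + 1"
  obtain T1 where T1: "real T1 \<le> 272 * (real n / ln (real n))" "game n k T1 ?X0 (ones_known n)"
    by (rule game_ones[OF n k(2)])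
  have last: "game n k (1025 * n) Y (det (\<lambda>x. x))"
    if Y: "Y \<subseteq> ?X0" "ones_known n Y" "det (colours n) Y" for Y
  proof (cases "Y = {}")
    case True
    have "game n k 0 Y (det (\<lambda>x. x))" by (simp add: True det_def)
    then show ?thesis by (rule game_more[OF hereditary_det k(1)]) simp
  next
    case False
    then obtain z where z: "z \<in> Y" by blast
    show ?thesis
    proof (rule game_known_colours[OF n1 k(1) Y(1,2), where D = "colours n z"])
      show "colours n z \<subseteq> {1..k}" using colours_subset z Y(1) by blast
      show "card (colours n z) \<le> n" by (rule card_colours_le)
      fix x assume "x \<in> Y"
      then have "colours n x = colours n z" using Y(3) z unfolding det_def by blast
      then show "x ` {1..n} \<subseteq> colours n z" by (simp add: colours_def)
    qed
  qed
  have ph4: "game n k (1026 * n + 1025 * n) Y (det (\<lambda>x. x))"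
    if Y: "Y \<subseteq> ?X0" "ones_known n Y" "det (black.cnt 1 {1..n}) Y"
      "\<forall>j<?B. det (\<lambda>x. card (block n j \<inter> colours n x)) Y" for Y
    using game_colours[OF n1 k(1) Y(1,3,4)]
  proof (rule game_seq)
    fix Z assume Z: "Z \<subseteq> Y" "det (colours n) Z"
    show "game n k (1025 * n) Z (det (\<lambda>x. x))"
      by (rule last[OF _ hereditaryD[OF hereditary_ones_known Y(2) Z(1)] Z(2)]) (use Z(1) Y(1) in blast)
  qed
  have ph3: "game n k (?B + (1026 * n + 1025 * n)) Y (det (\<lambda>x. x))"
    if Y: "Y \<subseteq> ?X0" "ones_known n Y" "det (black.cnt 1 {1..n}) Y" for Y
    using game_blocks[OF n1 k(1) Y(1,3)]
  proof (rule game_seq)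
    fix Z assume Z: "Z \<subseteq> Y" "\<forall>j<?B. det (\<lambda>x. card (block n j \<inter> colours n x)) Z"
    show "game n k (1026 * n + 1025 * n) Z (det (\<lambda>x. x))"
      by (rule ph4[OF _ hereditaryD[OF hereditary_ones_known Y(2) Z(1)] det_subset[OF Y(3) Z(1)] Z(2)])
        (use Z(1) Y(1) in blast)
  qed
  have ph2: "game n k (1 + (?B + (1026 * n + 1025 * n))) Y (det (\<lambda>x. x))"
    if Y: "Y \<subseteq> ?X0" "ones_known n Y" for Y
  proof -
    have "game n k (card {1::nat}) Y (\<lambda>Y. \<forall>c\<in>{1}. det (black.cnt c {1..n}) Y)"
      by (rule game_counts) (use k in simp_all)
    then have "game n k 1 Y (\<lambda>Y. \<forall>c\<in>{1}. det (black.cnt c {1..n}) Y)" by simp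
    then show ?thesis
    proof (rule game_seq)
      fix Z assume Z: "Z \<subseteq> Y" "\<forall>c\<in>{1}. det (black.cnt c {1..n}) Z"
      have c1: "det (black.cnt 1 {1..n}) Z" using Z(2) by blast
      show "game n k (?B + (1026 * n + 1025 * n)) Z (det (\<lambda>x. x))"
        by (rule ph3[OF _ hereditaryD[OF hereditary_ones_known Y(2) Z(1)] c1]) (use Z(1) Y(1) in blast)
    qed
  qed
  have "game n k (T1 + (1 + (?B + (1026 * n + 1025 * n)))) ?X0 (det (\<lambda>x. x))"
    using T1(2) by (rule game_seq) (rule ph2)
  moreover have "real (T1 + (1 + (?B + (1026 * n + 1025 * n)))) \<le> 2600 * real n + real k / real n"
  proof -
    have "1 / 2 \<le> ln (real n)"
    proof -
      have "1 / 2 \<le> ln (2::real)" by (rule half_le_ln_2)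
      also have "\<dots> \<le> ln (real n)" using n by simp
      finally show ?thesis .
    qed
    then have "real n / ln (real n) \<le> real n / (1 / 2)"
      by (intro divide_left_mono) auto
    then have "real T1 \<le> 544 * real n" using T1(1) by simp
    moreover have "real (k div n) \<le> real k / real n" by (rule of_nat_div_le_of_nat)
    \<comment> \<open>The constant 2 is at most \<open>n\<close>, and
      \<open>544 + 2051 + 1 = 2596\<close> is rounded up to 2600.\<close>
    moreover have "real (T1 + (1 + (?B + (1026 * n + 1025 * n)))) = real T1 + 2 + real (k div n) + 2051 * real n"
      by simp
    moreover have "2 \<le> real n" using n by simp
    ultimately show ?thesis by linarith
  qed
  ultimately show thesis by (intro that)
qed

text \<open>If \<open>n < k * k\<close>, in particular if \<open>n < k\<close>, the term
  \<open>n * ln k / ln n\<close> is at least \<open>n / 2\<close> and absorbs linear costs; only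
  \<open>k * k \<le> n\<close> calls for the logarithmic saving. The constant is
  \<open>544 + 1674432\<close>.\<close>

lemma min_queries_upper:
  assumes n: "n \<ge> 2" and k: "k \<ge> 2"
  shows "real (min_queries n k) \<le>
    1674976 * (real n * (ln (real k) / ln (real n)) + real k / real n)"
proof -
  let ?L = "real n * (ln (real k) / ln (real n))"
  have k1: "k \<ge> 1" and n1: "n \<ge> 1" using n k by simp_all
  have lnn: "ln (real n) > 0" and lnk: "ln (real k) > 0" using n k by simp_all
  have L0: "0 \<le> ?L" and K0: "0 \<le> real k / real n" using lnn lnk by simp_all
  show ?thesis
  proof (cases "n < k")
    case True
    obtain T where T: "real T \<le> 2600 * real n + real k / real n" "game n k T (words n k) (det (\<lambda>x. x))"
      by (rule game_many_colours[OF n True])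
    have "ln (real n) \<le> ln (real k)" using True n by simp
    then have "1 \<le> ln (real k) / ln (real n)" using lnn by simp
    then have "real n * 1 \<le> ?L" by (intro mult_left_mono) simp_all
    then have "real T \<le> 2600 * ?L + real k / real n" using T(1) by linarith
    moreover have "real (min_queries n k) \<le> real T" using min_queries_le[OF k1 T(2)] by simp
    ultimately show ?thesis unfolding distrib_left using L0 K0 by linarith
  next
    case False
    obtain T1 where T1: "real T1 \<le> 272 * (real n / ln (real n))" "game n k T1 (words n k) (ones_known n)"
      by (rule game_ones[OF n k])
    have T1L: "real T1 \<le> 544 * ?L"
    proof -
      have "1 / 2 \<le> ln (2::real)" by (rule half_le_ln_2)
      also have "\<dots> \<le> ln (real k)" using k by simp
      finally have "(real n / ln (real n)) * (1 / 2) \<le> (real n / ln (real n)) * ln (real k)"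
        by (rule mult_left_mono) (use lnn in simp)
      also have "(real n / ln (real n)) * ln (real k) = ?L" by simp
      finally have *: "(real n / ln (real n)) * (1 / 2) \<le> ?L" .
      have "t \<le> 544 * l" if "a * (1 / 2) \<le> l" "t \<le> 272 * a" for a l t :: real
        using that by linarith
      from this[OF * T1(1)] show ?thesis .
    qed
    obtain T2 where T2: "real T2 \<le> 1674432 * ?L"
      "\<And>Y. Y \<subseteq> words n k \<Longrightarrow> ones_known n Y \<Longrightarrow> game n k T2 Y (det (\<lambda>x. x))"
    proof (cases "k * k \<le> n")
      case True
      \<comment> \<open>\<open>game_few_colours\<close> yields a number of queries that depends on
        \<open>Y\<close>; the floor of its bound serves all \<open>Y\<close> alike.\<close>
      define T where "T = nat \<lfloor>1674432 * ?L\<rfloor>"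
      have T: "real T \<le> 1674432 * ?L" using L0 by (simp add: T_def)
      show ?thesis
      proof (rule that[OF T])
        fix Y assume Y: "Y \<subseteq> words n k" "ones_known n Y"
        obtain T' where T': "real T' \<le> 1674432 * ?L" "game n k T' Y (det (\<lambda>x. x))"
          by (rule game_few_colours[OF n k True Y])
        have "T' \<le> T" unfolding T_def using T'(1) by (simp add: le_nat_floor)
        from game_more[OF hereditary_det k1 T'(2) this] show "game n k T Y (det (\<lambda>x. x))" .
      qed
    next
      case F: False
      have "real n \<le> 2 * ?L"
      proof -
        have "real n \<le> real (k * k)" using F by (simp only: of_nat_le_iff)
        then have "ln (real n) \<le> ln (real k * real k)" using n k by (subst ln_le_cancel_iff) auto
        then have "ln (real n) \<le> 2 * ln (real k)" using k by (simp add: ln_mult)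
        then have "1 \<le> 2 * (ln (real k) / ln (real n))" using lnn by (simp add: pos_le_divide_eq)
        then have "real n * 1 \<le> real n * (2 * (ln (real k) / ln (real n)))" by (intro mult_left_mono) simp_all
        also have "\<dots> = 2 * ?L" by (rule mult.left_commute)
        finally show ?thesis by simp
      qed
      then have le: "real (1025 * n) \<le> 1674432 * ?L" using L0 by simp
      show ?thesis
      proof (rule that[OF le])
        fix Y assume Y: "Y \<subseteq> words n k" "ones_known n Y"
        show "game n k (1025 * n) Y (det (\<lambda>x. x))"
        proof (rule game_known_colours[OF n1 k1 Y, where D = "{1..k}"])
          show "card {1..k} \<le> n" using False by simp
          fix x assume "x \<in> Y"
          then have "x \<in> words n k" using Y(1) by blast
          then show "x ` {1..n} \<subseteq> {1..k}" unfolding colours_def[symmetric] by (rule colours_subset)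
        qed simp
      qed
    qed
    have "game n k (T1 + T2) (words n k) (det (\<lambda>x. x))"
      using T1(2) by (rule game_seq) (rule T2(2))
    from min_queries_le[OF k1 this] have "real (min_queries n k) \<le> real T1 + real T2" by simp
    then show ?thesis unfolding distrib_left using T1L T2(1) K0 by linarith
  qed
qed

section \<open>Lower bounds\<close>

text \<open>Each query is a function of the history before it, so the answers alone determine the
  play. Codewords can therefore be counted by lists of answers.\<close>

lemma play_cong:
  "map snd (play n s x t) = map snd (play n s y t) \<Longrightarrow> play n s x t = play n s y t"
  by (induction t) (simp_all add: Let_def)

lemma play_take: "u \<le> t \<Longrightarrow> take u (play n s x t) = play n s x u"
proof (induction t)
  case (Suc t)
  then show ?case by (cases "u = Suc t") (simp_all add: Let_def)
qed simp

lemma consistent_self: "x \<in> words n k \<Longrightarrow> x \<in> consistent n k (play n s x t)"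
  by (auto simp: consistent_def set_play)

lemma plays_distinct:
  assumes s: "solves_within n k s T" and xy: "x \<in> words n k" "y \<in> words n k"
    and eq: "play n s x T = play n s y T"
  shows "x = y"
proof -
  obtain t where t: "t \<le> T" "consistent n k (play n s x t) = {x}"
    using s xy(1) unfolding solves_within_def by blast
  have "play n s y t = play n s x t" using play_take[OF t(1), of n s] eq by metis
  then have "y \<in> {x}" using consistent_self[OF xy(2), of s t] t(2) by simp
  then show ?thesis by simp
qed

lemma min_queries_solves:
  assumes "k \<ge> 1"
  obtains s where "s \<in> strategies n k" "solves_within n k s (min_queries n k)"
  using LeastI_ex[OF solvable[OF assms, of n]] unfolding min_queries_def by blast

lemma match_bound:
  fixes q :: word
  shows "Max {card {i \<in> {1..n}. x i = q (\<sigma> i)} | \<sigma>. \<sigma> permutes {1..n}} \<le> n"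
proof (rule Max.boundedI)
  let ?M = "{card {i \<in> {1..n}. x i = q (\<sigma> i)} | \<sigma>. \<sigma> permutes {1..n}}"
  have "?M = (\<lambda>\<sigma>. card {i \<in> {1..n}. x i = q (\<sigma> i)}) ` {\<sigma>. \<sigma> permutes {1..n}}" by blast
  then show "finite ?M" by (simp add: finite_permutations)
  have "card {i \<in> {1..n}. x i = q (id i)} \<in> ?M" by (intro CollectI exI[of _ id] conjI permutes_id refl)
  then show "?M \<noteq> {}" by blast
  fix m assume "m \<in> ?M"
  then show "m \<le> n"
  proof (elim CollectE exE conjE)
    fix \<sigma> assume "m = card {i \<in> {1..n}. x i = q (\<sigma> i)}"
    moreover have "card {i \<in> {1..n}. x i = q (\<sigma> i)} \<le> card {1..n}" by (rule card_mono) auto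
    ultimately show ?thesis by simp
  qed
qed

lemma answer_range: "answer n x q \<in> {..n} \<times> {..n}"
proof -
  have "bp n x q \<le> card {1..n}" unfolding bp_def by (rule card_mono) auto
  moreover have "wp n x q \<le> n" unfolding wp_def using match_bound[of n x q] by linarith
  ultimately show ?thesis by (simp add: answer_def)
qed

lemma words_le_answers:
  assumes "solves_within n k s T"
  shows "k ^ n \<le> ((n + 1) * (n + 1)) ^ T"
proof -
  let ?A = "{..n} \<times> {..n}"
  let ?L = "{xs. set xs \<subseteq> ?A \<and> length xs = T}"
  have "inj_on (\<lambda>x. map snd (play n s x T)) (words n k)"
    by (rule inj_onI) (rule plays_distinct[OF assms _ _ play_cong])
  moreover have "(\<lambda>x. map snd (play n s x T)) ` words n k \<subseteq> ?L"
  proof (rule image_subsetI)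
    fix x
    have "set (map snd (play n s x T)) \<subseteq> ?A"
      unfolding set_map set_play image_image snd_conv by (rule image_subsetI) (rule answer_range)
    then show "map snd (play n s x T) \<in> ?L" by simp
  qed
  moreover have "finite ?L" by (rule finite_lists_length_eq) simp
  ultimately have "card (words n k) \<le> card ?L" by (rule card_inj_on_le)
  also have "card ?L = card ?A ^ T" by (rule card_lists_length_eq) simp
  also have "card (words n k) = k ^ n" unfolding words_def by (subst card_PiE) simp_all
  finally show ?thesis by (simp add: card_cartesian_product)
qed

lemma absent_colour_answer:
  assumes "c \<notin> q ` {1..n}" "n \<ge> 1"
  shows "answer n (\<lambda>i\<in>{1..n}. c) q = (0, 0)"
proof -
  have no: "{i \<in> {1..n}. (\<lambda>i\<in>{1..n}. c) i = q (\<sigma> i)} = {}" if "\<sigma> permutes {1..n}" for \<sigma>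
  proof -
    have "q (\<sigma> i) \<noteq> c" if "i \<in> {1..n}" for i
      using assms(1) permutes_in_image[OF \<open>\<sigma> permutes {1..n}\<close>, of i] that by blast
    then show ?thesis by auto
  qed
  have "{card {i \<in> {1..n}. (\<lambda>i\<in>{1..n}. c) i = q (\<sigma> i)} | \<sigma>. \<sigma> permutes {1..n}} = {0}"
  proof (rule set_eqI, rule iffI)
    fix m assume "m \<in> {card {i \<in> {1..n}. (\<lambda>i\<in>{1..n}. c) i = q (\<sigma> i)} | \<sigma>. \<sigma> permutes {1..n}}"
    then show "m \<in> {0}"
    proof (elim CollectE exE conjE)
      fix \<sigma> assume m: "m = card {i \<in> {1..n}. (\<lambda>i\<in>{1..n}. c) i = q (\<sigma> i)}" "\<sigma> permutes {1..n}"
      show ?thesis unfolding m(1) no[OF m(2)] by simp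
    qed
  next
    fix m :: nat assume "m \<in> {0}"
    then have "m = card {i \<in> {1..n}. (\<lambda>i\<in>{1..n}. c) i = q (id i)}"
      unfolding no[OF permutes_id] by simp
    then show "m \<in> {card {i \<in> {1..n}. (\<lambda>i\<in>{1..n}. c) i = q (\<sigma> i)} | \<sigma>. \<sigma> permutes {1..n}}"
      by (intro CollectI exI[of _ id] conjI permutes_id)
  qed
  moreover have "bp n (\<lambda>i\<in>{1..n}. c) q = 0"
    using no[OF permutes_id] unfolding bp_def id_apply by (simp only: card.empty)
  ultimately show ?thesis by (simp only: answer_def wp_def Max_singleton) simp
qed

text \<open>Two constant words whose colours never occur in the queries receive the same answers.\<close>

lemma colours_le_queried:
  assumes s: "solves_within n k s T" and n: "n \<ge> 1"
  shows "k \<le> T * n + 1"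
proof (rule ccontr)
  assume "\<not> k \<le> T * n + 1"
  then have k: "T * n + 2 \<le> k" by simp
  \<comment> \<open>The history in which every answer is \<open>(0, 0)\<close>; constant words
    follow it as long as their colour is not asked.\<close>
  define H where "H = rec_nat [] (\<lambda>_ h. h @ [(s h, (0::nat, 0::nat))])"
  have H: "H 0 = []" "\<And>t. H (Suc t) = H t @ [(s (H t), (0, 0))]" by (simp_all add: H_def)
  define Q where "Q = (\<Union>t<T. s (H t) ` {1..n})"
  have "card Q \<le> (\<Sum>t<T. card (s (H t) ` {1..n}))" unfolding Q_def by (rule card_UN_le) simp
  also have "\<dots> \<le> (\<Sum>t<T. n)"
  proof (rule sum_mono)
    show "card (s (H t) ` {1..n}) \<le> n" for t using card_image_le[of "{1..n}" "s (H t)"] by simp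
  qed
  finally have cQ: "card Q \<le> T * n" by simp
  have finQ: "finite Q" by (simp add: Q_def)
  have "2 \<le> card {1..k} - card Q" using cQ k by simp
  also have "\<dots> \<le> card ({1..k} - Q)" by (rule diff_card_le_card_Diff[OF finQ])
  finally obtain P where "P \<subseteq> {1..k} - Q" "card P = 2"
    using obtain_subset_with_card_n by metis
  then obtain a b where ab: "a \<in> {1..k} - Q" "b \<in> {1..k} - Q" "a \<noteq> b"
    by (auto simp: card_2_iff)
  have play: "play n s (\<lambda>i\<in>{1..n}. c) t = H t" if "t \<le> T" "c \<notin> Q" for t c
    using that(1)
  proof (induction t)
    case (Suc t)
    have "c \<notin> s (H t) ` {1..n}" using that(2) Suc.prems unfolding Q_def by auto
    from absent_colour_answer[OF this n]
    have ans: "answer n (\<lambda>i\<in>{1..n}. c) (s (H t)) = (0, 0)" .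
    have IH: "play n s (\<lambda>i\<in>{1..n}. c) t = H t" by (rule Suc.IH) (use Suc.prems in simp)
    show ?case unfolding play.simps H IH Let_def ans by (rule refl)
  qed (simp add: H)
  have "(\<lambda>i\<in>{1..n}. a) = (\<lambda>i\<in>{1..n}. b)"
    by (rule plays_distinct[OF s]) (use ab play[of T a] play[of T b] constant_word in auto)
  then have "(\<lambda>i\<in>{1..n}. a) 1 = (\<lambda>i\<in>{1..n}. b) 1" by simp
  then show False using n ab(3) by simp
qed

lemma min_queries_lower:
  assumes n: "n \<ge> 2" and k: "k \<ge> 2"
  shows "1 / 8 * (real n * (ln (real k) / ln (real n)) + real k / real n) \<le> real (min_queries n k)"
proof -
  define T where "T = min_queries n k"
  obtain s where s: "solves_within n k s T"
    using min_queries_solves[of k n] k unfolding T_def by auto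
  have lnn: "ln (real n) > 0" using n by simp
  have "real n * ln (real k) \<le> 4 * real T * ln (real n)"
  proof -
    have "real (k ^ n) \<le> real (((n + 1) * (n + 1)) ^ T)"
      using words_le_answers[OF s] by (simp only: of_nat_le_iff)
    then have "real k ^ n \<le> ((real n + 1) * (real n + 1)) ^ T" by (simp add: algebra_simps)
    then have "ln (real k ^ n) \<le> ln (((real n + 1) * (real n + 1)) ^ T)"
      using k by (subst ln_le_cancel_iff) auto
    then have 1: "real n * ln (real k) \<le> real T * (2 * ln (real n + 1))"
      using k by (simp add: ln_realpow ln_mult)
    \<comment> \<open>This trades \<open>ln (n + 1)\<close> for \<open>2 * ln n\<close>, which
      produces the factor 4.\<close>
    have "real n + 1 \<le> real n * real n"
    proof -
      have "2 * real n \<le> real n * real n" using n by (intro mult_right_mono) simp_all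
      then show ?thesis using n by linarith
    qed
    then have "ln (real n + 1) \<le> ln (real n * real n)" using n by (subst ln_le_cancel_iff) auto
    then have "ln (real n + 1) \<le> 2 * ln (real n)" using n by (simp add: ln_mult)
    then have "real T * (2 * ln (real n + 1)) \<le> real T * (2 * (2 * ln (real n)))"
      by (intro mult_left_mono) simp_all
    then show ?thesis using 1 by simp
  qed
  then have 1: "real n * (ln (real k) / ln (real n)) \<le> 4 * real T"
    using lnn by (simp add: pos_divide_le_eq)
  have 2: "real k / real n \<le> 2 * real T"
  proof -
    have "k \<le> T * n + 1" using colours_le_queried[OF s] n by simp
    \<comment> \<open>\<open>k \<ge> 2\<close> forces \<open>T * n \<ge> 1\<close>, which absorbs
      the \<open>+ 1\<close>.\<close>
    then have "k \<le> 2 * T * n" using k by simp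
    then have "real k \<le> real (2 * T * n)" by (simp only: of_nat_le_iff)
    then show ?thesis using n by (simp add: pos_divide_le_eq)
  qed
  \<comment> \<open>The factors add up to \<open>4 + 2 = 6\<close>, rounded up to 8.\<close>
  have "1 / 8 * (l + r) \<le> t" if "l \<le> 4 * t" "r \<le> 2 * t" "0 \<le> t" for l r t :: real
  proof -
    have "l + r \<le> 8 * t" using that by linarith
    then show ?thesis by simp
  qed
  from this[OF 1 2 of_nat_0_le_iff] show ?thesis unfolding T_def .
qed

text \<open>The case \<open>n = 1\<close> is left out because the denominator \<open>ln n\<close>
  vanishes there.\<close>

theorem theorem2:
  "\<exists>c C :: real. c > 0 \<and> C > 0 \<and>
     (\<forall>n k :: nat. n \<ge> 2 \<longrightarrow> k \<ge> 2 \<longrightarrow>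
        c * (real n * (ln (real k) / ln (real n)) + real k / real n) \<le> real (min_queries n k) \<and>
        real (min_queries n k) \<le> C * (real n * (ln (real k) / ln (real n)) + real k / real n))"
  using min_queries_lower min_queries_upper
  by (intro exI[of _ "1 / 8"] exI[of _ 1674976] conjI allI impI) simp_all

end
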